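(* Let $M$ be a compact metric space, $L$ a compact space, $\kappa$ an ordinal, $\{r_\xi:\xi<\kappa\}$ a family of distinct points of $L$, and for each $\xi<\kappa$ let $f_\xi: L\setminus\{r_\xi\}\to M$ be continuous. Let $K$ be the split $L$ induced by $\{f_\xi:\xi<\kappa\}$. If $\{f_\xi:\xi<\kappa\}$ contains no $M$-independent sequence and $L$ is weakly Radon-Nikodým, then $K$ is weakly Radon-Nikodým.
   Context: The split $L$ induced by $\{f_\xi:\xi<\kappa\}$ is the subspace $K$ of $L^{\{*\}}\times M^\kappa$ consisting of the points $x_{\xi,t}$ ($\xi<\kappa$, $t\in M$) and $x_r$ ($r\in L\setminus\{r_\xi:\xi<\kappa\}$), where $x_{\xi,t}( * )=r_\xi$, $x_{\xi,t}(\xi)=t$, $x_{\xi,t}(\eta)=f_\eta(r_\xi)$ for $\eta\neq\xi$, and $x_r( * )=r$, $x_r(\xi)=f_\xi(r)$ for all $\xi<\kappa$. A sequence of pairs of disjoint sets $(A_n^0,A_n^1)$ is independent if $A_1^{\varepsilon_1}\cap\cdots\cap A_m^{\varepsilon_m}\neq\emptyset$ for all $m$ and all $\varepsilon_i\in\{0,1\}$. A sequence of functions $g_n$ from a set into $M$ is $M$-independent if there are disjoint closed $C,C'\subseteq M$ with $(g_n^{-1}(C),g_n^{-1}(C'))_n$ independent. A sequence $f_{\xi_n}$ (distinct $\xi_n$) is $M$-independent if there exist (not necessarily continuous) extensions $g_{\xi_n}:L\to M$ of $f_{\xi_n}$ forming an $M$-independent sequence. A compact space is weakly Radon-Nikodým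 if it is homeomorphic to a weak$^*$ compact subset of the dual $X^*$ of a Banach space $X$ containing no isomorphic copy of $\ell_1$. *)

theory Defs
  imports "HOL-Analysis.Analysis" "HOL-Probability.Discrete_Topology"
begin

text \<open>A Banach space is represented as a complete linear subspace V of a real normed
  vector type (taking V = UNIV for a banach type gives the usual notion).\<close>

definition banach_subspace :: "'v::real_normed_vector set \<Rightarrow> bool" where
  "banach_subspace V \<longleftrightarrow> subspace V \<and> complete V"

definition dual_space :: "'v::real_normed_vector set \<Rightarrow> ('v \<Rightarrow> real) set" where
  "dual_space V = {\<phi> \<in> extensional V.
      (\<forall>x\<in>V. \<forall>y\<in>V. \<phi> (x + y) = \<phi> x + \<phi> y) \<and>
      (\<forall>c. \<forall>x\<in>V. \<phi> (c *\<^sub>R x) = c * \<phi> x) \<and>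
      (\<exists>B. \<forall>x\<in>V. \<bar>\<phi> x\<bar> \<le> B * norm x)}"

definition weak_star :: "'v::real_normed_vector set \<Rightarrow> ('v \<Rightarrow> real) topology" where
  "weak_star V = subtopology (product_topology (\<lambda>_. euclideanreal) V) (dual_space V)"

text \<open>V contains an isomorphic copy of ell-1: a bounded sequence in V equivalent to the unit
  vector basis of ell-1.\<close>
definition contains_l1 :: "'v::real_normed_vector set \<Rightarrow> bool" where
  "contains_l1 V \<longleftrightarrow> (\<exists>x::nat \<Rightarrow> 'v. (\<forall>n. x n \<in> V) \<and> (\<exists>C c. 0 < c \<and> (\<forall>n. norm (x n) \<le> C) \<and>
      (\<forall>(a::nat \<Rightarrow> real) N. c * (\<Sum>i<N. \<bar>a i\<bar>) \<le> norm (\<Sum>i<N. a i *\<^sub>R x i))))"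

definition weakly_RN_via :: "'a topology \<Rightarrow> 'v::real_normed_vector set \<Rightarrow> bool" where
  "weakly_RN_via T V \<longleftrightarrow> banach_subspace V \<and> \<not> contains_l1 V \<and>
     (\<exists>S. compactin (weak_star V) S \<and> T homeomorphic_space subtopology (weak_star V) S)"

definition independent_pairs :: "(nat \<Rightarrow> 'a set \<times> 'a set) \<Rightarrow> bool" where
  "independent_pairs A \<longleftrightarrow> (\<forall>n. fst (A n) \<inter> snd (A n) = {}) \<and>
     (\<forall>m (\<epsilon>::nat \<Rightarrow> bool). (\<Inter>i<m. (if \<epsilon> i then snd (A i) else fst (A i))) \<noteq> {})"

definition M_independent :: "'m::metric_space set \<Rightarrow> 'a set \<Rightarrow> (nat \<Rightarrow> 'a \<Rightarrow> 'm) \<Rightarrow> bool" where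
  "M_independent M S g \<longleftrightarrow> (\<exists>C C'. closedin (top_of_set M) C \<and> closedin (top_of_set M) C' \<and>
      C \<inter> C' = {} \<and> independent_pairs (\<lambda>n. ({x\<in>S. g n x \<in> C}, {x\<in>S. g n x \<in> C'})))"

definition has_M_independent_seq ::
  "'l topology \<Rightarrow> 'm::metric_space set \<Rightarrow> 'i set \<Rightarrow> ('i \<Rightarrow> 'l) \<Rightarrow> ('i \<Rightarrow> 'l \<Rightarrow> 'm) \<Rightarrow> bool" where
  "has_M_independent_seq L M I r f \<longleftrightarrow>
     (\<exists>(\<xi>::nat \<Rightarrow> 'i) (g::nat \<Rightarrow> 'l \<Rightarrow> 'm). inj \<xi> \<and> range \<xi> \<subseteq> I \<and>
        (\<forall>n. \<forall>x\<in>topspace L. g n x \<in> M) \<and>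
        (\<forall>n. \<forall>x\<in>topspace L - {r (\<xi> n)}. g n x = f (\<xi> n) x) \<and>
        M_independent M (topspace L) g)"

definition split_points ::
  "'l topology \<Rightarrow> 'm set \<Rightarrow> 'i set \<Rightarrow> ('i \<Rightarrow> 'l) \<Rightarrow> ('i \<Rightarrow> 'l \<Rightarrow> 'm) \<Rightarrow> ('l \<times> ('i \<Rightarrow> 'm)) set" where
  "split_points L M I r f =
     {(r \<xi>, (\<lambda>\<eta>\<in>I. if \<eta> = \<xi> then t else f \<eta> (r \<xi>))) | \<xi> t. \<xi> \<in> I \<and> t \<in> M} \<union>
     {(x, (\<lambda>\<eta>\<in>I. f \<eta> x)) | x. x \<in> topspace L \<and> x \<notin> r ` I}"

definition split_space ::
  "'l topology \<Rightarrow> 'm::metric_space set \<Rightarrow> 'i set \<Rightarrow> ('i \<Rightarrow> 'l) \<Rightarrow> ('i \<Rightarrow> 'l \<Rightarrow> 'm) \<Rightarrow> ('l \<times> ('i \<Rightarrow> 'm)) topology" where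
  "split_space L M I r f =
     subtopology (prod_topology L (product_topology (\<lambda>_. top_of_set M) I)) (split_points L M I r f)"

end

theory Submission
  imports Defs
begin

text \<open>A compact space is weakly Radon-Nikodym as soon as some bounded family \<open>F\<close> of continuous
  functions separates its points and contains no independent sequence. For this one interpolates:
  the \<open>k\<close>-th norm of \<open>x\<close> is the supremum of \<open>2\<^sup>k \<bar>\<phi>(x)\<bar>\<close> over the functionals \<open>\<phi>\<close> of norm at most
  1 with \<open>\<bar>\<phi>\<bar> \<le> 4\<^sup>-\<^sup>k\<close> on \<open>F\<close>, and the space consists of the \<open>x\<close> whose norms tend to 0. If it
  contained an l1-sequence, a gliding hump would yield an l1-sequence \<open>z\<close> for the sup norm, and a
  minimax argument a positive functional \<open>\<Lambda>\<close> together with an orthogonal sequence of signs \<open>r\<close> such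
  that all \<open>\<Lambda>(z\<^sub>i r\<^sub>i)\<close> are large. By the definition of the norms some \<open>f\<^sub>i\<close> in \<open>F\<close> correlates with
  \<open>r\<^sub>i\<close> as well. Bessel's inequality separates the \<open>f\<^sub>i\<close> in the mean, hence for some thresholds the
  sets \<open>A\<^sub>i = {f\<^sub>i \<le> p}\<close> and \<open>B\<^sub>j = {f\<^sub>j \<ge> q}\<close> have a positive iterated limit of \<open>\<Lambda>(A\<^sub>i \<inter> B\<^sub>j)\<close>.
  Iterated limits commute, so this property passes from the whole space to its intersections with
  most \<open>A\<^sub>i\<close> and most \<open>B\<^sub>i\<close>, which gives an independent subsequence of \<open>f\<close>.

  On the split space \<open>F\<close> consists of the unit ball of the space given for \<open>L\<close>, and of the
  distances of the coordinates to the points of \<open>M\<close>.\<close>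

section \<open>Positive functionals and generalized limits\<close>

text \<open>Two obstacles shape the proof. The first is integration: the functions and threshold
  sets involved carry no measurability, so limits are taken along a generalized limit of finitely
  supported averages. This gives a positive functional on all bounded functions that is only
  finitely additive, and the inner product space behind it need not be complete. Weak limits are
  therefore represented up to a small error, and each estimate leaves room for it. The second is the
  type: the Banach space must live in a type built from the points of the split space alone.
  Functionals that are generalized limits of finitely supported measures are few enough to be coded
  by sets of points, and the minimax argument produces its functionals in exactly this form. On the
  split space, finally, a coordinate agrees with its function only off one fibre, so an independent
  sequence of coordinates has to be moved down to \<open>L\<close> by avoiding finitely many
  fibres.\<close>

definition bdd_on :: "'a set \<Rightarrow> ('a \<Rightarrow> real) \<Rightarrow> bool" where
  "bdd_on X h \<longleftrightarrow> (\<exists>C. \<forall>x\<in>X. \<bar>h x\<bar> \<le> C)"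

lemma bdd_onI: "(\<And>x. x \<in> X \<Longrightarrow> \<bar>h x\<bar> \<le> C) \<Longrightarrow> bdd_on X h"
  unfolding bdd_on_def by blast

lemma bdd_on_const [simp, intro]: "bdd_on X (\<lambda>x. c)"
  by (rule bdd_onI[of _ _ "\<bar>c\<bar>"]) simp

lemma bdd_on_add [simp, intro]:
  assumes "bdd_on X u" "bdd_on X v" shows "bdd_on X (\<lambda>x. u x + v x)"
proof -
  from assms obtain B C where "\<forall>x\<in>X. \<bar>u x\<bar> \<le> B" "\<forall>x\<in>X. \<bar>v x\<bar> \<le> C"
    unfolding bdd_on_def by blast
  then show ?thesis by (intro bdd_onI[of _ _ "B + C"]) (smt (verit))
qed

lemma bdd_on_mult [simp, intro]:
  assumes "bdd_on X u" "bdd_on X v" shows "bdd_on X (\<lambda>x. u x * v x)"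
proof -
  from assms obtain B C where "\<forall>x\<in>X. \<bar>u x\<bar> \<le> B" "\<forall>x\<in>X. \<bar>v x\<bar> \<le> C"
    unfolding bdd_on_def by blast
  then show ?thesis
    by (intro bdd_onI[of _ _ "B * C"]) (simp add: abs_mult mult_mono')
qed

lemma bdd_on_uminus [simp, intro]: "bdd_on X u \<Longrightarrow> bdd_on X (\<lambda>x. - u x)"
  unfolding bdd_on_def by simp

lemma bdd_on_diff [simp, intro]:
  "bdd_on X u \<Longrightarrow> bdd_on X v \<Longrightarrow> bdd_on X (\<lambda>x. u x - v x)"
  using bdd_on_add[of X u "\<lambda>x. - v x"] by simp

lemma bdd_on_abs [simp, intro]: "bdd_on X u \<Longrightarrow> bdd_on X (\<lambda>x. \<bar>u x\<bar>)"
  unfolding bdd_on_def by simp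

lemma bdd_on_power [simp, intro]: "bdd_on X u \<Longrightarrow> bdd_on X (\<lambda>x. u x ^ n)"
  by (induction n) auto

lemma bdd_on_sum [simp, intro]:
  "(\<And>i. i \<in> S \<Longrightarrow> bdd_on X (u i)) \<Longrightarrow> bdd_on X (\<lambda>x. \<Sum>i\<in>S. u i x)"
  by (induction S rule: infinite_finite_induct) auto

lemma bdd_on_indicator [simp, intro]: "bdd_on X (indicator A)"
  by (rule bdd_onI[of _ _ 1]) (simp add: indicator_def)

text \<open>Stands in for a finite positive measure. Every bounded function is integrable, so
  indicators of arbitrary sets may be inserted; the price is that only finite additivity is
  available.\<close>

locale positive_functional =
  fixes X :: "'a set" and \<Lambda> :: "('a \<Rightarrow> real) \<Rightarrow> real"
  assumes add: "bdd_on X u \<Longrightarrow> bdd_on X v \<Longrightarrow> \<Lambda> (\<lambda>x. u x + v x) = \<Lambda> u + \<Lambda> v"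
    and scale: "bdd_on X u \<Longrightarrow> \<Lambda> (\<lambda>x. c * u x) = c * \<Lambda> u"
    and nonneg: "bdd_on X u \<Longrightarrow> (\<And>x. x \<in> X \<Longrightarrow> 0 \<le> u x) \<Longrightarrow> 0 \<le> \<Lambda> u"
begin

lemma minus: "bdd_on X u \<Longrightarrow> \<Lambda> (\<lambda>x. - u x) = - \<Lambda> u"
  using scale[of u "-1"] by simp

lemma diff: "bdd_on X u \<Longrightarrow> bdd_on X v \<Longrightarrow> \<Lambda> (\<lambda>x. u x - v x) = \<Lambda> u - \<Lambda> v"
  using add[of u "\<lambda>x. - v x"] minus[of v] by simp

lemma zero: "\<Lambda> (\<lambda>x. 0) = 0"
  using scale[of "\<lambda>x. 0" 0] by simp

lemma sum: "(\<And>i. i \<in> S \<Longrightarrow> bdd_on X (u i)) \<Longrightarrow> \<Lambda> (\<lambda>x. \<Sum>i\<in>S. u i x) = (\<Sum>i\<in>S. \<Lambda> (u i))"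
  by (induction S rule: infinite_finite_induct) (auto simp: zero add)

lemma mono:
  assumes "bdd_on X u" "bdd_on X v" "\<And>x. x \<in> X \<Longrightarrow> u x \<le> v x"
  shows "\<Lambda> u \<le> \<Lambda> v"
  using nonneg[of "\<lambda>x. v x - u x"] diff[of v u] assms by auto

lemma cong: "bdd_on X u \<Longrightarrow> (\<And>x. x \<in> X \<Longrightarrow> u x = v x) \<Longrightarrow> \<Lambda> u = \<Lambda> v"
  using mono[of u v] mono[of v u] by (force simp: bdd_on_def)

lemma const: "\<Lambda> (\<lambda>x. c) = c * \<Lambda> (\<lambda>x. 1)"
  using scale[of "\<lambda>x. 1" c] by simp

lemma one_nonneg: "0 \<le> \<Lambda> (\<lambda>x. 1)"
  by (rule nonneg) auto

lemma bound:
  assumes "\<And>x. x \<in> X \<Longrightarrow> \<bar>u x\<bar> \<le> C"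
  shows "\<bar>\<Lambda> u\<bar> \<le> C * \<Lambda> (\<lambda>x. 1)"
proof -
  have u: "bdd_on X u" using assms by (rule bdd_onI)
  have "\<Lambda> u \<le> \<Lambda> (\<lambda>x. C)"
    by (rule mono) (use u assms abs_le_D1 in auto)
  moreover have "- \<Lambda> u \<le> \<Lambda> (\<lambda>x. C)"
    unfolding minus[OF u, symmetric] by (rule mono) (use u assms abs_le_D2 in auto)
  ultimately show ?thesis using const[of C] by (simp add: abs_le_iff)
qed

lemma abs_le: "bdd_on X u \<Longrightarrow> \<bar>\<Lambda> u\<bar> \<le> \<Lambda> (\<lambda>x. \<bar>u x\<bar>)"
  using mono[of u "\<lambda>x. \<bar>u x\<bar>"] mono[of "\<lambda>x. - u x" "\<lambda>x. \<bar>u x\<bar>"] minus[of u]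
  by (auto simp: abs_le_iff)

lemma square_expand:
  assumes "bdd_on X u" "bdd_on X v"
  shows "\<Lambda> (\<lambda>x. (u x + t * v x)\<^sup>2) = \<Lambda> (\<lambda>x. (u x)\<^sup>2) + 2 * t * \<Lambda> (\<lambda>x. u x * v x) + t\<^sup>2 * \<Lambda> (\<lambda>x. (v x)\<^sup>2)"
proof -
  have "\<Lambda> (\<lambda>x. (u x + t * v x)\<^sup>2) = \<Lambda> (\<lambda>x. ((u x)\<^sup>2 + (2 * t) * (u x * v x)) + t\<^sup>2 * (v x)\<^sup>2)"
    by (rule arg_cong[of _ _ \<Lambda>]) (auto simp: power2_eq_square algebra_simps)
  also have "\<dots> = \<Lambda> (\<lambda>x. (u x)\<^sup>2) + 2 * t * \<Lambda> (\<lambda>x. u x * v x) + t\<^sup>2 * \<Lambda> (\<lambda>x. (v x)\<^sup>2)"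
    using assms by (subst add; (subst add)?; (subst scale)?; (subst scale)?) auto
  finally show ?thesis .
qed

end

text \<open>The discriminant test for \<open>k + 2 * t * D + t^2 * E\<close>, used with
  \<open>k = \<Lambda>(u^2)\<close> for Cauchy-Schwarz and with a small error \<open>k\<close> for
  Riesz. The case \<open>E = 0\<close> is genuine because \<open>\<Lambda>\<close> may annihilate
  squares.\<close>

lemma nonneg_quadratic:
  fixes D E k :: real
  assumes "\<And>t. - k \<le> 2 * t * D + t\<^sup>2 * E" "0 \<le> E" "0 \<le> k"
  shows "D\<^sup>2 \<le> k * E"
proof (cases "E = 0")
  case True
  have "D = 0"
  proof (rule ccontr)
    assume "D \<noteq> 0"
    then show False using assms(1)[of "- (k + 1) / D"] True assms(3) by simp
  qed
  then show ?thesis using True by simp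
next
  case False
  then have "- k \<le> - (D\<^sup>2 / E)"
    using assms(1)[of "- D / E"] by (simp add: power2_eq_square field_simps)
  then show ?thesis using False assms(2) by (simp add: field_simps)
qed

context positive_functional begin

lemma Cauchy_Schwarz:
  assumes "bdd_on X u" "bdd_on X v"
  shows "(\<Lambda> (\<lambda>x. u x * v x))\<^sup>2 \<le> \<Lambda> (\<lambda>x. (u x)\<^sup>2) * \<Lambda> (\<lambda>x. (v x)\<^sup>2)"
proof (rule nonneg_quadratic)
  fix t
  have "0 \<le> \<Lambda> (\<lambda>x. (u x + t * v x)\<^sup>2)" by (rule nonneg) (use assms in auto)
  then show "- \<Lambda> (\<lambda>x. (u x)\<^sup>2) \<le> 2 * t * \<Lambda> (\<lambda>x. u x * v x) + t\<^sup>2 * \<Lambda> (\<lambda>x. (v x)\<^sup>2)"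
    using square_expand[OF assms, of t] by simp
qed (rule nonneg; use assms in auto)+

text \<open>Riesz representation up to an error \<open>k\<close>; the representing function is an almost
  minimizer of \<open>\<Lambda>(a\<^sup>2) - 2 \<phi>(a)\<close>, so that no completion is needed.\<close>

lemma approx_Riesz:
  assumes add\<phi>: "\<And>u v. bdd_on X u \<Longrightarrow> bdd_on X v \<Longrightarrow> \<phi> (\<lambda>x. u x + v x) = \<phi> u + \<phi> v"
    and scale\<phi>: "\<And>u c. bdd_on X u \<Longrightarrow> \<phi> (\<lambda>x. c * u x) = c * \<phi> u"
    and bound\<phi>: "\<And>u. bdd_on X u \<Longrightarrow> (\<phi> u)\<^sup>2 \<le> C * \<Lambda> (\<lambda>x. (u x)\<^sup>2)"
    and "0 < k" "0 \<le> C"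
  shows "\<exists>a. bdd_on X a \<and> \<Lambda> (\<lambda>x. (a x)\<^sup>2) \<le> 4 * C \<and>
    (\<forall>w. bdd_on X w \<longrightarrow> (\<Lambda> (\<lambda>x. a x * w x) - \<phi> w)\<^sup>2 \<le> k * \<Lambda> (\<lambda>x. (w x)\<^sup>2))"
proof -
  define Q where "Q a = \<Lambda> (\<lambda>x. (a x)\<^sup>2) - 2 * \<phi> a" for a
  define m where "m = Inf (Q ` {a. bdd_on X a})"
  \<comment> \<open>Since \<open>\<phi> a \<le> sqrt C * s\<close>, completing the square gives
    \<open>Q a \<ge> s^2 - 2 * sqrt C * s \<ge> - C\<close>.\<close>
  have Qlow: "- C \<le> Q a" if "bdd_on X a" for a
  proof -
    define s where "s = sqrt (\<Lambda> (\<lambda>x. (a x)\<^sup>2))"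
    have s0: "0 \<le> \<Lambda> (\<lambda>x. (a x)\<^sup>2)" by (rule nonneg) (use that in auto)
    then have s: "\<Lambda> (\<lambda>x. (a x)\<^sup>2) = s\<^sup>2" "0 \<le> s" by (auto simp: s_def)
    have "\<phi> a \<le> sqrt C * s"
    proof (rule power2_le_imp_le)
      show "(\<phi> a)\<^sup>2 \<le> (sqrt C * s)\<^sup>2"
        using bound\<phi>[OF that] s \<open>0 \<le> C\<close> by (simp add: power_mult_distrib)
    qed (use s \<open>0 \<le> C\<close> in auto)
    moreover have "0 \<le> (s - sqrt C)\<^sup>2" by simp
    ultimately show ?thesis
      using s \<open>0 \<le> C\<close> unfolding Q_def by (simp add: power2_diff algebra_simps)
  qed
  have bb: "bdd_below (Q ` {a. bdd_on X a})"
    using Qlow by (auto intro!: bdd_belowI2[of _ "-C"])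
  have m: "m \<le> Q a" if "bdd_on X a" for a
    unfolding m_def using bb that by (intro cInf_lower) auto
  have "\<exists>q\<in>Q ` {a. bdd_on X a}. q < m + k"
    unfolding m_def using \<open>0 < k\<close> by (intro cInf_lessD) auto
  then obtain a0 where a0: "bdd_on X a0" "Q a0 < m + k" by auto
  \<comment> \<open>Replacing a candidate with positive \<open>Q\<close> by the zero function lowers
    \<open>Q\<close>, and \<open>Q a \<le> 0\<close> is what bounds
    \<open>\<Lambda>(a^2)\<close>.\<close>
  define a where "a = (if Q a0 \<le> 0 then a0 else (\<lambda>x. 0))"
  have Q0: "Q (\<lambda>x. 0) = 0" using scale\<phi>[of "\<lambda>x. 0" 0] by (simp add: Q_def zero)
  have a: "bdd_on X a" "Q a < m + k" "Q a \<le> 0"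
    using a0 Q0 by (auto simp: a_def)
  have nn: "0 \<le> \<Lambda> (\<lambda>x. (w x)\<^sup>2)" if "bdd_on X w" for w
    by (rule nonneg) (use that in auto)
  show ?thesis
  proof (intro exI[of _ a] conjI allI impI)
    show "bdd_on X a" by (fact a(1))
    show "\<Lambda> (\<lambda>x. (a x)\<^sup>2) \<le> 4 * C"
    proof -
      let ?A = "\<Lambda> (\<lambda>x. (a x)\<^sup>2)"
      have "?A \<le> 2 * \<phi> a" using a(3) by (simp add: Q_def)
      then have "?A * ?A \<le> (2 * \<phi> a)\<^sup>2" using nn[OF a(1)]
        by (metis power2_eq_square power_mono)
      also have "\<dots> \<le> 4 * C * ?A" using bound\<phi>[OF a(1)] by (simp add: power_mult_distrib)
      finally show ?thesis using nn[OF a(1)] \<open>0 \<le> C\<close>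
        by (cases "?A = 0") auto
    qed
    fix w assume w: "bdd_on X w"
    show "(\<Lambda> (\<lambda>x. a x * w x) - \<phi> w)\<^sup>2 \<le> k * \<Lambda> (\<lambda>x. (w x)\<^sup>2)"
    proof (rule nonneg_quadratic)
      fix t
      have "\<phi> (\<lambda>x. a x + t * w x) = \<phi> a + t * \<phi> w"
        using a(1) w by (subst add\<phi>) (auto simp: scale\<phi>)
      then have "Q (\<lambda>x. a x + t * w x)
        = Q a + 2 * t * (\<Lambda> (\<lambda>x. a x * w x) - \<phi> w) + t\<^sup>2 * \<Lambda> (\<lambda>x. (w x)\<^sup>2)"
        unfolding Q_def square_expand[OF a(1) w] by (simp add: algebra_simps)
      moreover have "m \<le> Q (\<lambda>x. a x + t * w x)" using a(1) w by (intro m) auto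
      ultimately show "- k \<le> 2 * t * (\<Lambda> (\<lambda>x. a x * w x) - \<phi> w) + t\<^sup>2 * \<Lambda> (\<lambda>x. (w x)\<^sup>2)"
        using a(2) by linarith
    qed (use nn[OF w] \<open>0 < k\<close> in auto)
  qed
qed

end

text \<open>Models the limit along a free ultrafilter by one property: finitely many bounded
  sequences come close to their limits at a common, arbitrarily late index. Linearity and positivity
  are read off at such an index.\<close>

locale generalized_limit =
  fixes Ulim :: "(nat \<Rightarrow> real) \<Rightarrow> real"
  assumes approx: "finite Y \<Longrightarrow> (\<And>x. x \<in> Y \<Longrightarrow> bdd_on UNIV x) \<Longrightarrow> 0 < e \<Longrightarrow>
    \<exists>n\<ge>N. \<forall>x\<in>Y. \<bar>x n - Ulim x\<bar> < e"

text \<open>\<open>Ulim\<close> is a cluster point of the evaluations at \<open>n\<close> in a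
  product of compact intervals; neighbourhoods in the product constrain finitely many coordinates,
  which is the approximation property.\<close>

lemma ex_generalized_limit: "\<exists>Ulim. generalized_limit Ulim"
proof -
  define B where "B x = (if bdd_on UNIV x then SOME C. \<forall>n. \<bar>x n\<bar> \<le> C else 0)" for x :: "nat \<Rightarrow> real"
  have B: "\<bar>x n\<bar> \<le> B x" if "bdd_on UNIV x" for x n
    using someI_ex[of "\<lambda>C. \<forall>n. \<bar>x n\<bar> \<le> C"] that by (auto simp: B_def bdd_on_def)
  define U where "U = Pi\<^sub>E (UNIV :: (nat \<Rightarrow> real) set) (\<lambda>x. {- B x..B x})"
  have "compactin (product_topology (\<lambda>_. euclideanreal) UNIV) U"
    unfolding U_def by (subst compactin_PiE) auto
  then have "compact U"
    by (simp add: euclidean_product_topology compactin_euclidean_iff)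
  \<comment> \<open>Unbounded sequences are sent to 0, so that all evaluations stay in the compact
    box \<open>U\<close>.\<close>
  define ev where "ev n = (\<lambda>x :: nat \<Rightarrow> real. if bdd_on UNIV x then x n else 0)" for n
  have "\<bar>ev n x\<bar> \<le> B x" for n x
    using B[of x n] by (cases "bdd_on UNIV x") (auto simp: ev_def B_def)
  then have "ev n \<in> U" for n
    unfolding U_def by (auto simp: abs_le_iff) (metis minus_le_iff)
  then have "\<exists>x\<in>U. inf (nhds x) (filtermap ev sequentially) \<noteq> bot"
    using \<open>compact U\<close>[unfolded compact_filter, rule_format, of "filtermap ev sequentially"]
    by (auto simp: eventually_filtermap filtermap_bot_iff)
  then obtain Ulim where Ulim: "inf (nhds Ulim) (filtermap ev sequentially) \<noteq> bot" by blast
  have "generalized_limit Ulim"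
  proof
    fix Y :: "(nat \<Rightarrow> real) set" and e :: real and N :: nat
    assume Y: "finite Y" "\<And>x. x \<in> Y \<Longrightarrow> bdd_on UNIV x" and "0 < e"
    let ?O = "\<Inter>x\<in>Y. {g. \<bar>g x - Ulim x\<bar> < e}"
    have "open ?O"
      by (intro open_INT \<open>finite Y\<close> ballI open_Collect_less continuous_intros
          continuous_on_product_coordinates)
    moreover have "Ulim \<in> ?O" using \<open>0 < e\<close> by auto
    ultimately have 1: "eventually (\<lambda>g. g \<in> ?O) (nhds Ulim)"
      using eventually_nhds by blast
    have "eventually (\<lambda>g. g \<in> ev ` {N..}) (filtermap ev sequentially)"
      by (auto simp: eventually_filtermap eventually_sequentially)
    with 1 have "eventually (\<lambda>g. g \<in> ?O \<and> g \<in> ev ` {N..}) (inf (nhds Ulim) (filtermap ev sequentially))"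
      unfolding eventually_inf by blast
    then obtain g where "g \<in> ?O" "g \<in> ev ` {N..}"
      using Ulim eventually_happens' by blast
    then show "\<exists>n\<ge>N. \<forall>x\<in>Y. \<bar>x n - Ulim x\<bar> < e"
      using Y(2) by (auto simp: ev_def)
  qed
  then show ?thesis by blast
qed

context generalized_limit begin

lemma Ulim_ge:
  assumes "bdd_on UNIV x" "\<forall>\<^sub>F n in sequentially. a \<le> x n" shows "a \<le> Ulim x"
proof (rule ccontr)
  assume "\<not> a \<le> Ulim x"
  moreover obtain N where "\<And>n. n \<ge> N \<Longrightarrow> a \<le> x n"
    using assms(2) by (auto simp: eventually_sequentially)
  moreover obtain n where "n \<ge> N" "\<bar>x n - Ulim x\<bar> < a - Ulim x"
    using approx[of "{x}" "a - Ulim x" N] assms(1) calculation(1) by auto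
  ultimately show False by force
qed

sublocale positive_functional UNIV Ulim
proof
  fix u v :: "nat \<Rightarrow> real" and c :: real
  assume u: "bdd_on UNIV u"
  show "Ulim (\<lambda>x. c * u x) = c * Ulim u"
  proof (rule dense_eq0_I[of "Ulim (\<lambda>x. c * u x) - c * Ulim u", simplified])
    fix e :: real assume "0 < e"
    define d where "d = e / (1 + \<bar>c\<bar>)"
    have "0 < d" using \<open>0 < e\<close> by (simp add: d_def)
    have "\<exists>n\<ge>0. \<forall>x\<in>{u, \<lambda>x. c * u x}. \<bar>x n - Ulim x\<bar> < d"
      using u \<open>0 < d\<close> by (intro approx) auto
    then obtain n where "\<bar>c * u n - Ulim (\<lambda>x. c * u x)\<bar> < d" "\<bar>u n - Ulim u\<bar> < d"
      by auto
    moreover have "\<bar>c * u n - c * Ulim u\<bar> \<le> \<bar>c\<bar> * d"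
      using calculation(2) by (simp add: abs_mult mult_left_mono flip: right_diff_distrib)
    ultimately have "\<bar>Ulim (\<lambda>x. c * u x) - c * Ulim u\<bar> \<le> (1 + \<bar>c\<bar>) * d"
      by (simp add: algebra_simps)
    also have "\<dots> = e" by (simp add: d_def)
    finally show "\<bar>Ulim (\<lambda>x. c * u x) - c * Ulim u\<bar> \<le> e" .
  qed
  show "0 \<le> Ulim u" if "\<And>x. x \<in> UNIV \<Longrightarrow> 0 \<le> u x"
    using Ulim_ge[of u 0] u that by auto
  assume v: "bdd_on UNIV v"
  show "Ulim (\<lambda>x. u x + v x) = Ulim u + Ulim v"
  proof (rule dense_eq0_I[of "Ulim (\<lambda>x. u x + v x) - (Ulim u + Ulim v)", simplified])
    fix e :: real assume "0 < e"
    then have "\<exists>n\<ge>0. \<forall>x\<in>{u, v, \<lambda>x. u x + v x}. \<bar>x n - Ulim x\<bar> < e / 3"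
      using u v by (intro approx) auto
    then obtain n where "\<bar>u n + v n - Ulim (\<lambda>x. u x + v x)\<bar> < e / 3" "\<bar>u n - Ulim u\<bar> < e / 3"
       "\<bar>v n - Ulim v\<bar> < e / 3"
      by auto
    then show "\<bar>Ulim (\<lambda>x. u x + v x) - (Ulim u + Ulim v)\<bar> \<le> e" by linarith
  qed
qed

lemma Ulim_1: "Ulim (\<lambda>n. 1) = 1"
  using Ulim_ge[of "\<lambda>n. 1" 1] Ulim_ge[of "\<lambda>n. -1" "-1"] minus[of "\<lambda>n. 1"] by simp

lemma Ulim_const [simp]: "Ulim (\<lambda>n. c) = c"
  using const[of c] Ulim_1 by simp

lemma Ulim_abs_le: "(\<And>n. \<bar>x n\<bar> \<le> C) \<Longrightarrow> \<bar>Ulim x\<bar> \<le> C"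
  using bound[of x C] by simp

lemma ex_pos:
  assumes "finite Y" "\<And>x. x \<in> Y \<Longrightarrow> bdd_on UNIV x" "\<And>x. x \<in> Y \<Longrightarrow> 0 < Ulim x"
  shows "\<exists>n\<ge>N. \<forall>x\<in>Y. 0 < x n"
proof (cases "Y = {}")
  case False
  define e where "e = Min (Ulim ` Y)"
  have "0 < e" using assms False by (auto simp: e_def)
  then obtain n where n: "n \<ge> N" "\<forall>x\<in>Y. \<bar>x n - Ulim x\<bar> < e" using approx assms by meson
  have "0 < x n" if "x \<in> Y" for x
  proof -
    have "e \<le> Ulim x" using that assms(1) by (auto simp: e_def)
    then show ?thesis using n(2) that by force
  qed
  then show ?thesis using n(1) by blast
qed auto

end

section \<open>Commuting limits and independent sequences of sets\<close>

locale functional_with_limit = positive_functional X \<Lambda> + U: generalized_limit Ulim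
  for X :: "'a set" and \<Lambda> Ulim
begin

lemma bdd_on_seq:
  assumes "\<And>i x. x \<in> X \<Longrightarrow> \<bar>w i x\<bar> \<le> C"
  shows "bdd_on UNIV (\<lambda>i. \<Lambda> (w i))"
  using bound[of "w _" C] assms by (intro bdd_onI) blast

lemma bdd_on_seq_mult:
  assumes "\<And>i x. x \<in> X \<Longrightarrow> \<bar>u i x\<bar> \<le> 1" "bdd_on X w"
  shows "bdd_on UNIV (\<lambda>i. \<Lambda> (\<lambda>x. u i x * w x))"
proof -
  obtain C where C: "\<And>x. x \<in> X \<Longrightarrow> \<bar>w x\<bar> \<le> C" using assms(2) by (auto simp: bdd_on_def)
  show ?thesis
  proof (rule bdd_on_seq)
    fix i x assume x: "x \<in> X"
    then have "\<bar>u i x\<bar> * \<bar>w x\<bar> \<le> 1 * C"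
      using assms(1)[OF x, of i] C[OF x] by (intro mult_mono) auto
    then show "\<bar>u i x * w x\<bar> \<le> C" by (simp add: abs_mult)
  qed
qed

lemma square_le_one:
  assumes "\<And>x. x \<in> X \<Longrightarrow> \<bar>u x\<bar> \<le> 1" shows "\<Lambda> (\<lambda>x. (u x)\<^sup>2) \<le> \<Lambda> (\<lambda>x. 1)"
proof (rule mono)
  have "bdd_on X u" using assms by (rule bdd_onI)
  then show "bdd_on X (\<lambda>x. (u x)\<^sup>2)" by simp
qed (use assms abs_square_le_1 in auto)

section \<open>Weak limits of functions and iterated limits\<close>

lemma weak_limit_functional:
  assumes u: "\<And>i x. x \<in> X \<Longrightarrow> 0 \<le> u i x \<and> u i x \<le> 1"
  shows "positive_functional X (\<lambda>w. Ulim (\<lambda>i. \<Lambda> (\<lambda>x. u i x * w x)))"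
proof
  have u1: "\<And>i x. x \<in> X \<Longrightarrow> \<bar>u i x\<bar> \<le> 1" using u by auto
  then have bu: "bdd_on X (u i)" for i by (rule bdd_onI)
  fix w v :: "'a \<Rightarrow> real" and c :: real
  assume w: "bdd_on X w"
  have "\<Lambda> (\<lambda>x. u i x * (c * w x)) = c * \<Lambda> (\<lambda>x. u i x * w x)" for i
    using scale[of "\<lambda>x. u i x * w x" c] w bu by (simp add: mult.left_commute)
  then show "Ulim (\<lambda>i. \<Lambda> (\<lambda>x. u i x * (c * w x))) = c * Ulim (\<lambda>i. \<Lambda> (\<lambda>x. u i x * w x))"
    using U.scale[OF bdd_on_seq_mult[OF u1 w]] by simp
  show "0 \<le> Ulim (\<lambda>i. \<Lambda> (\<lambda>x. u i x * w x))" if "\<And>x. x \<in> X \<Longrightarrow> 0 \<le> w x"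
    using that w u bu by (intro U.nonneg bdd_on_seq_mult[OF u1 w] nonneg) auto
  assume v: "bdd_on X v"
  have "\<Lambda> (\<lambda>x. u i x * (w x + v x)) = \<Lambda> (\<lambda>x. u i x * w x) + \<Lambda> (\<lambda>x. u i x * v x)" for i
    using add[of "\<lambda>x. u i x * w x" "\<lambda>x. u i x * v x"] w v bu by (simp add: distrib_left)
  then show "Ulim (\<lambda>i. \<Lambda> (\<lambda>x. u i x * (w x + v x)))
      = Ulim (\<lambda>i. \<Lambda> (\<lambda>x. u i x * w x)) + Ulim (\<lambda>i. \<Lambda> (\<lambda>x. u i x * v x))"
    using U.add[OF bdd_on_seq_mult[OF u1 w] bdd_on_seq_mult[OF u1 v]] by simp
qed

text \<open>\<open>a\<close> approximates the weak limit of the \<open>u i\<close> in the inner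
  product of \<open>\<Lambda>\<close>. The test functions fill a ball of the radius that
  \<open>approx_Riesz\<close> gives for \<open>a\<close>, so that one representative may be tested
  against another.\<close>

lemma weak_limit_rep:
  assumes u: "\<And>i x. x \<in> X \<Longrightarrow> 0 \<le> u i x \<and> u i x \<le> 1" and "0 < e"
  shows "\<exists>a. bdd_on X a \<and> \<Lambda> (\<lambda>x. (a x)\<^sup>2) \<le> 4 * \<Lambda> (\<lambda>x. 1) \<and>
    (\<forall>w. bdd_on X w \<longrightarrow> \<Lambda> (\<lambda>x. (w x)\<^sup>2) \<le> 4 * \<Lambda> (\<lambda>x. 1) \<longrightarrow>
      \<bar>Ulim (\<lambda>i. \<Lambda> (\<lambda>x. u i x * w x)) - \<Lambda> (\<lambda>x. a x * w x)\<bar> \<le> e)"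
proof -
  have u1: "\<And>i x. x \<in> X \<Longrightarrow> \<bar>u i x\<bar> \<le> 1" using u by auto
  then have bu: "bdd_on X (u i)" for i by (rule bdd_onI)
  let ?\<phi> = "\<lambda>w. Ulim (\<lambda>i. \<Lambda> (\<lambda>x. u i x * w x))"
  let ?c = "\<Lambda> (\<lambda>x. 1)"
  interpret P: positive_functional X ?\<phi> by (rule weak_limit_functional[OF u])
  have c: "0 \<le> ?c" by (rule one_nonneg)
  define k where "k = e\<^sup>2 / (4 * ?c + 1)"
  have k: "0 < k" using c \<open>0 < e\<close> by (simp add: k_def)
  have bd: "(?\<phi> w)\<^sup>2 \<le> ?c * \<Lambda> (\<lambda>x. (w x)\<^sup>2)" if w: "bdd_on X w" for w
  proof -
    have nn: "0 \<le> \<Lambda> (\<lambda>x. (w x)\<^sup>2)" using w by (intro nonneg) auto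
    have "\<bar>\<Lambda> (\<lambda>x. u i x * w x)\<bar> \<le> sqrt (?c * \<Lambda> (\<lambda>x. (w x)\<^sup>2))" for i
    proof (rule real_le_rsqrt)
      have "(\<Lambda> (\<lambda>x. u i x * w x))\<^sup>2 \<le> \<Lambda> (\<lambda>x. (u i x)\<^sup>2) * \<Lambda> (\<lambda>x. (w x)\<^sup>2)"
        by (rule Cauchy_Schwarz[OF bu w])
      also have "\<dots> \<le> ?c * \<Lambda> (\<lambda>x. (w x)\<^sup>2)"
        using square_le_one[OF u1] nn by (rule mult_right_mono)
      finally show "\<bar>\<Lambda> (\<lambda>x. u i x * w x)\<bar>\<^sup>2 \<le> ?c * \<Lambda> (\<lambda>x. (w x)\<^sup>2)" by simp
    qed
    then have "\<bar>?\<phi> w\<bar> \<le> sqrt (?c * \<Lambda> (\<lambda>x. (w x)\<^sup>2))" by (rule U.Ulim_abs_le)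
    then have "\<bar>?\<phi> w\<bar>\<^sup>2 \<le> (sqrt (?c * \<Lambda> (\<lambda>x. (w x)\<^sup>2)))\<^sup>2" by (rule power_mono) simp
    then show ?thesis using c nn by simp
  qed
  obtain a where a: "bdd_on X a" "\<Lambda> (\<lambda>x. (a x)\<^sup>2) \<le> 4 * ?c"
    "\<And>w. bdd_on X w \<Longrightarrow> (\<Lambda> (\<lambda>x. a x * w x) - ?\<phi> w)\<^sup>2 \<le> k * \<Lambda> (\<lambda>x. (w x)\<^sup>2)"
    using approx_Riesz[OF P.add P.scale bd k c] by blast
  show ?thesis
  proof (intro exI[of _ a] conjI allI impI a(1,2))
    fix w assume w: "bdd_on X w" "\<Lambda> (\<lambda>x. (w x)\<^sup>2) \<le> 4 * ?c"
    have "(\<Lambda> (\<lambda>x. a x * w x) - ?\<phi> w)\<^sup>2 \<le> k * \<Lambda> (\<lambda>x. (w x)\<^sup>2)" by (rule a(3)[OF w(1)])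
    also have "\<dots> \<le> k * (4 * ?c + 1)" using w k by (intro mult_left_mono) auto
    also have "\<dots> = e\<^sup>2" using c by (simp add: k_def)
    finally have "\<bar>\<Lambda> (\<lambda>x. a x * w x) - ?\<phi> w\<bar> \<le> e"
      using \<open>0 < e\<close> power2_le_iff_abs_le[of e] by simp
    then show "\<bar>?\<phi> w - \<Lambda> (\<lambda>x. a x * w x)\<bar> \<le> e" by (simp add: abs_minus_commute)
  qed
qed

lemma Ulim_close:
  assumes "bdd_on UNIV x" "bdd_on UNIV y" "\<And>i. \<bar>x i - y i\<bar> \<le> e"
  shows "\<bar>Ulim x - Ulim y\<bar> \<le> e"
  using U.Ulim_abs_le[of "\<lambda>i. x i - y i" e] U.diff[of x y] assms by simp

lemma bdd_on_double:
  assumes u: "\<And>i x. x \<in> X \<Longrightarrow> 0 \<le> u i x \<and> u i x \<le> 1"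
    and v: "\<And>i x. x \<in> X \<Longrightarrow> 0 \<le> v i x \<and> v i x \<le> 1"
  shows "bdd_on UNIV (\<lambda>i. Ulim (\<lambda>j. \<Lambda> (\<lambda>x. u i x * v j x)))"
proof (rule bdd_onI, rule U.Ulim_abs_le, rule bound)
  fix i j x assume "x \<in> X"
  then have "\<bar>u i x\<bar> * \<bar>v j x\<bar> \<le> 1 * 1" using u v by (intro mult_mono) auto
  then show "\<bar>u i x * v j x\<bar> \<le> 1" by (simp add: abs_mult)
qed

text \<open>With approximate weak limits \<open>a\<close> of \<open>u\<close> and \<open>b\<close>
  of \<open>v\<close>, each iterated limit is within \<open>2 * e\<close> of
  \<open>\<Lambda> (\<lambda>x. a x * b x)\<close>.\<close>

lemma double_limit_commute:
  assumes u: "\<And>i x. x \<in> X \<Longrightarrow> 0 \<le> u i x \<and> u i x \<le> 1"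
    and v: "\<And>i x. x \<in> X \<Longrightarrow> 0 \<le> v i x \<and> v i x \<le> 1"
  shows "Ulim (\<lambda>i. Ulim (\<lambda>j. \<Lambda> (\<lambda>x. u i x * v j x))) = Ulim (\<lambda>j. Ulim (\<lambda>i. \<Lambda> (\<lambda>x. u i x * v j x)))"
    (is "?s = ?t")
proof -
  have u1: "\<And>i x. x \<in> X \<Longrightarrow> \<bar>u i x\<bar> \<le> 1" using u by auto
  then have bu: "bdd_on X (u i)" for i by (rule bdd_onI)
  have v1: "\<And>i x. x \<in> X \<Longrightarrow> \<bar>v i x\<bar> \<le> 1" using v by auto
  then have bv: "bdd_on X (v i)" for i by (rule bdd_onI)
  have c4: "\<Lambda> (\<lambda>x. (u i x)\<^sup>2) \<le> 4 * \<Lambda> (\<lambda>x. 1)" "\<Lambda> (\<lambda>x. (v i x)\<^sup>2) \<le> 4 * \<Lambda> (\<lambda>x. 1)" for i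
    using square_le_one[of "u i", OF u1] square_le_one[of "v i", OF v1] one_nonneg by auto
  have "\<bar>?s - ?t\<bar> \<le> 4 * e" if "0 < e" for e
  proof -
    obtain a where a: "bdd_on X a" "\<Lambda> (\<lambda>x. (a x)\<^sup>2) \<le> 4 * \<Lambda> (\<lambda>x. 1)"
      "\<And>w. bdd_on X w \<Longrightarrow> \<Lambda> (\<lambda>x. (w x)\<^sup>2) \<le> 4 * \<Lambda> (\<lambda>x. 1) \<Longrightarrow>
      \<bar>Ulim (\<lambda>i. \<Lambda> (\<lambda>x. u i x * w x)) - \<Lambda> (\<lambda>x. a x * w x)\<bar> \<le> e"
      using weak_limit_rep[of u e] u \<open>0 < e\<close> by auto
    obtain b where b: "bdd_on X b" "\<Lambda> (\<lambda>x. (b x)\<^sup>2) \<le> 4 * \<Lambda> (\<lambda>x. 1)"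
      "\<And>w. bdd_on X w \<Longrightarrow> \<Lambda> (\<lambda>x. (w x)\<^sup>2) \<le> 4 * \<Lambda> (\<lambda>x. 1) \<Longrightarrow>
      \<bar>Ulim (\<lambda>i. \<Lambda> (\<lambda>x. v i x * w x)) - \<Lambda> (\<lambda>x. b x * w x)\<bar> \<le> e"
      using weak_limit_rep[of v e] v \<open>0 < e\<close> by auto
    have "\<bar>?s - Ulim (\<lambda>i. \<Lambda> (\<lambda>x. u i x * b x))\<bar> \<le> e"
    proof (rule Ulim_close)
      show "\<bar>Ulim (\<lambda>j. \<Lambda> (\<lambda>x. u i x * v j x)) - \<Lambda> (\<lambda>x. u i x * b x)\<bar> \<le> e" for i
        using b(3)[OF bu c4(1), of i] by (simp add: mult.commute)
    qed (use u v in \<open>auto intro!: bdd_on_double bdd_on_seq_mult[OF u1 b(1)]\<close>)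
    moreover have "\<bar>Ulim (\<lambda>i. \<Lambda> (\<lambda>x. u i x * b x)) - \<Lambda> (\<lambda>x. a x * b x)\<bar> \<le> e"
      by (rule a(3)[OF b(1,2)])
    moreover have "\<bar>?t - Ulim (\<lambda>i. \<Lambda> (\<lambda>x. v i x * a x))\<bar> \<le> e"
    proof (rule Ulim_close)
      show "\<bar>Ulim (\<lambda>i. \<Lambda> (\<lambda>x. u i x * v j x)) - \<Lambda> (\<lambda>x. v j x * a x)\<bar> \<le> e" for j
        using a(3)[OF bv c4(2), of j] by (simp add: mult.commute)
      show "bdd_on UNIV (\<lambda>j. Ulim (\<lambda>i. \<Lambda> (\<lambda>x. u i x * v j x)))"
        using bdd_on_double[OF v u] by (simp add: mult.commute)
    qed (rule bdd_on_seq_mult[of v, OF v1 a(1)])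
    moreover have "\<bar>Ulim (\<lambda>i. \<Lambda> (\<lambda>x. v i x * a x)) - \<Lambda> (\<lambda>x. a x * b x)\<bar> \<le> e"
      using b(3)[OF a(1,2)] by (simp add: mult.commute)
    ultimately show ?thesis by linarith
  qed
  from this[of "_ / 4"] have "\<bar>?s - ?t\<bar> \<le> e" if "0 < e" for e using that by simp
  then show ?thesis using dense_eq0_I[of "?s - ?t"] by simp
qed

text \<open>The iterated limit is close to \<open>\<Lambda>(a^2)\<close> for an approximate weak
  limit \<open>a\<close>. Cauchy-Schwarz against the constant 1 bounds this below through
  \<open>\<Lambda> a\<close>, which is close to the positive limit of the
  \<open>\<Lambda> (u i)\<close>.\<close>

lemma double_limit_pos:
  assumes u: "\<And>i x. x \<in> X \<Longrightarrow> 0 \<le> u i x \<and> u i x \<le> 1" and pos: "0 < Ulim (\<lambda>i. \<Lambda> (u i))"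
  shows "0 < Ulim (\<lambda>i. Ulim (\<lambda>j. \<Lambda> (\<lambda>x. u i x * u j x)))"
proof -
  have u1: "\<And>i x. x \<in> X \<Longrightarrow> \<bar>u i x\<bar> \<le> 1" using u by auto
  then have bu: "bdd_on X (u i)" for i by (rule bdd_onI)
  have c4: "\<Lambda> (\<lambda>x. (u i x)\<^sup>2) \<le> 4 * \<Lambda> (\<lambda>x. 1)" for i
    using square_le_one[of "u i", OF u1] one_nonneg by auto
  let ?c = "\<Lambda> (\<lambda>x. 1)" and ?p = "Ulim (\<lambda>i. \<Lambda> (u i))"
  let ?\<beta> = "Ulim (\<lambda>i. Ulim (\<lambda>j. \<Lambda> (\<lambda>x. u i x * u j x)))"
  have "\<bar>\<Lambda> (u i)\<bar> \<le> 1 * ?c" for i using u1 by (rule bound)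
  then have "?p \<le> ?c" using U.Ulim_abs_le[of "\<lambda>i. \<Lambda> (u i)" ?c] by simp
  then have c: "0 < ?c" using pos by linarith
  \<comment> \<open>The first bound gives \<open>?p / 2 \<le> \<Lambda> a\<close>, hence
    \<open>\<Lambda>(a^2) \<ge> ?p^2 / (4 * ?c)\<close>; the second makes the two approximation
    errors together at most half of this.\<close>
  define e where "e = min (?p / 2) (?p\<^sup>2 / (16 * ?c))"
  have e: "0 < e" "e \<le> ?p / 2" "e \<le> ?p\<^sup>2 / (16 * ?c)" using pos c by (auto simp: e_def)
  obtain a where a: "bdd_on X a" "\<Lambda> (\<lambda>x. (a x)\<^sup>2) \<le> 4 * \<Lambda> (\<lambda>x. 1)"
      "\<And>w. bdd_on X w \<Longrightarrow> \<Lambda> (\<lambda>x. (w x)\<^sup>2) \<le> 4 * \<Lambda> (\<lambda>x. 1) \<Longrightarrow>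
      \<bar>Ulim (\<lambda>i. \<Lambda> (\<lambda>x. u i x * w x)) - \<Lambda> (\<lambda>x. a x * w x)\<bar> \<le> e"
    using weak_limit_rep[of u e] u e(1) by auto
  have "\<bar>?p - \<Lambda> a\<bar> \<le> e" using a(3)[of "\<lambda>x. 1"] c by simp
  then have "?p / 2 \<le> \<Lambda> a" using e(2) by linarith
  then have "(?p / 2)\<^sup>2 \<le> (\<Lambda> a)\<^sup>2" using pos by (intro power_mono) auto
  also have "\<dots> \<le> \<Lambda> (\<lambda>x. (a x)\<^sup>2) * ?c" using Cauchy_Schwarz[OF a(1), of "\<lambda>x. 1"] by simp
  finally have *: "?p\<^sup>2 / (4 * ?c) \<le> \<Lambda> (\<lambda>x. (a x)\<^sup>2)" using c by (simp add: field_simps power2_eq_square)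
  have "\<bar>?\<beta> - Ulim (\<lambda>i. \<Lambda> (\<lambda>x. u i x * a x))\<bar> \<le> e"
  proof (rule Ulim_close)
    show "\<bar>Ulim (\<lambda>j. \<Lambda> (\<lambda>x. u i x * u j x)) - \<Lambda> (\<lambda>x. u i x * a x)\<bar> \<le> e" for i
      using a(3)[OF bu c4, of i] by (simp add: mult.commute)
  qed (use u in \<open>auto intro!: bdd_on_double bdd_on_seq_mult[OF u1 a(1)]\<close>)
  moreover have "\<bar>Ulim (\<lambda>i. \<Lambda> (\<lambda>x. u i x * a x)) - \<Lambda> (\<lambda>x. (a x)\<^sup>2)\<bar> \<le> e"
    using a(3)[OF a(1,2)] by (simp add: power2_eq_square)
  ultimately have "?p\<^sup>2 / (4 * ?c) - 2 * e \<le> ?\<beta>" using * by linarith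
  moreover have "2 * (?p\<^sup>2 / (16 * ?c)) < ?p\<^sup>2 / (4 * ?c)" using pos c by (simp add: field_simps)
  ultimately show ?thesis using e(3) by linarith
qed

definition double_limit :: "(nat \<Rightarrow> 'a set) \<Rightarrow> (nat \<Rightarrow> 'a set) \<Rightarrow> 'a set \<Rightarrow> real" where
  "double_limit A B E = Ulim (\<lambda>i. Ulim (\<lambda>j. \<Lambda> (indicator (E \<inter> A i \<inter> B j))))"

text \<open>\<open>double_limit_commute\<close> for the indicators of \<open>E \<inter> A i\<close>
  and \<open>E \<inter> B j\<close>. It gives \<open>A\<close> and \<open>B\<close> symmetric roles,
  so heredity is proved for one of them only.\<close>

lemma double_limit_swap: "double_limit A B E = double_limit B A E"
proof -
  have "double_limit A B E
    = Ulim (\<lambda>i. Ulim (\<lambda>j. \<Lambda> (\<lambda>x. indicator (E \<inter> A i) x * indicator (E \<inter> B j) x)))"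
    unfolding double_limit_def
    by (intro arg_cong[of _ _ Ulim] arg_cong[of _ _ \<Lambda>] ext) (auto simp: indicator_def)
  also have "\<dots> = Ulim (\<lambda>j. Ulim (\<lambda>i. \<Lambda> (\<lambda>x. indicator (E \<inter> A i) x * indicator (E \<inter> B j) x)))"
    by (rule double_limit_commute) (auto simp: indicator_def)
  also have "\<dots> = double_limit B A E"
    unfolding double_limit_def
    by (intro arg_cong[of _ _ Ulim] arg_cong[of _ _ \<Lambda>] ext) (auto simp: indicator_def)
  finally show ?thesis .
qed

text \<open>\<open>double_limit_pos\<close> for the functional \<open>m\<close>, the weak limit of
  \<open>\<Lambda>\<close> restricted to the \<open>B j\<close>: the indicators of
  \<open>E \<inter> A i\<close> have a positive limit under \<open>m\<close>, hence so do their
  pairwise products.\<close>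

lemma double_limit_hereditary:
  assumes "0 < double_limit A B E"
  shows "0 < Ulim (\<lambda>i. double_limit A B (E \<inter> A i))"
proof -
  define m where "m w = Ulim (\<lambda>j. \<Lambda> (\<lambda>x. indicator (B j) x * w x))" for w
  interpret m: positive_functional X m
    unfolding m_def by (rule weak_limit_functional) (auto simp: indicator_def)
  interpret m: functional_with_limit X m Ulim ..
  have "double_limit A B E = Ulim (\<lambda>i. m (indicator (E \<inter> A i)))"
    unfolding double_limit_def m_def
    by (intro arg_cong[of _ _ Ulim] arg_cong[of _ _ \<Lambda>] ext) (auto simp: indicator_def)
  then have "0 < Ulim (\<lambda>i. Ulim (\<lambda>j. m (\<lambda>x. indicator (E \<inter> A i) x * indicator (E \<inter> A j) x)))"
    using assms by (intro m.double_limit_pos) simp_all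
  also have "\<dots> = Ulim (\<lambda>i. double_limit A B (E \<inter> A i))"
    unfolding double_limit_def m_def
    by (intro arg_cong[of _ _ Ulim] arg_cong[of _ _ \<Lambda>] ext) (auto simp: indicator_def)
  finally show ?thesis .
qed

lemma bdd_on_double_limit: "bdd_on UNIV (\<lambda>i. double_limit A B (E i))"
  unfolding double_limit_def
  by (rule bdd_onI, rule U.Ulim_abs_le, rule U.Ulim_abs_le, rule bound[of _ 1]) (auto simp: indicator_def)

lemma double_limit_empty: "E \<inter> X = {} \<Longrightarrow> double_limit A B E = 0"
proof -
  assume E: "E \<inter> X = {}"
  have "\<Lambda> (indicator (E \<inter> A i \<inter> B j)) = \<Lambda> (\<lambda>x. 0)" for i j
    by (rule cong) (use E in \<open>auto simp: indicator_def\<close>)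
  then show ?thesis by (simp add: double_limit_def zero)
qed

text \<open>Positivity of \<open>double_limit\<close> is the invariant: all finitely many cells
  built so far have it, and by heredity one later index keeps it for all their intersections with
  \<open>A n\<close> and with \<open>B n\<close>. A cell with this property meets
  \<open>X\<close>.\<close>

lemma double_limit_independent:
  assumes pos: "0 < double_limit A B UNIV"
  shows "\<exists>n :: nat \<Rightarrow> nat. strict_mono n \<and>
    (\<forall>m \<epsilon>. \<exists>x\<in>X. \<forall>i<m. x \<in> (if \<epsilon> i then B (n i) else A (n i)))"
proof -
  \<comment> \<open>A state is the last index used, with a finite family containing the cells of all
    sign patterns so far.\<close>
  define P where "P p \<longleftrightarrow> finite (snd p) \<and> (\<forall>E\<in>snd p. 0 < double_limit A B E)" for p :: "nat \<times> 'a set set"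
  define Q where "Q p q \<longleftrightarrow> fst p < fst q \<and>
    (\<forall>E\<in>snd p. E \<inter> A (fst q) \<in> snd q \<and> E \<inter> B (fst q) \<in> snd q)" for p q :: "nat \<times> 'a set set"
  have step: "\<exists>q. P q \<and> Q p q" if "P p" for p
  proof -
    let ?Y = "(\<lambda>E i. double_limit A B (E \<inter> A i)) ` snd p \<union> (\<lambda>E i. double_limit A B (E \<inter> B i)) ` snd p"
    have "\<exists>n\<ge>Suc (fst p). \<forall>x\<in>?Y. 0 < x n"
    proof (rule U.ex_pos)
      show "finite ?Y" using that by (auto simp: P_def)
      show "bdd_on UNIV x" if "x \<in> ?Y" for x
        using that by (auto intro: bdd_on_double_limit)
      show "0 < Ulim x" if "x \<in> ?Y" for x
        using that \<open>P p\<close> double_limit_hereditary[of A B] double_limit_hereditary[of B A]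
        by (auto simp: P_def double_limit_swap[of B A])
    qed
    then obtain n where n: "n > fst p" "\<forall>x\<in>?Y. 0 < x n" by (auto simp: Suc_le_eq)
    let ?q = "(n, (\<lambda>E. E \<inter> A n) ` snd p \<union> (\<lambda>E. E \<inter> B n) ` snd p)"
    have "P ?q" using n(2) that by (auto simp: P_def)
    moreover have "Q p ?q" using n(1) by (auto simp: Q_def)
    ultimately show ?thesis by blast
  qed
  have "P (0, {UNIV})" using pos by (simp add: P_def)
  then have "\<exists>g. \<forall>k. (P (g k) \<and> (k = 0 \<longrightarrow> g k = (0, {UNIV}))) \<and> Q (g k) (g (Suc k))"
    using step by (intro dependent_nat_choice) auto
  then obtain g where g: "g 0 = (0, {UNIV})" "\<And>k. P (g k)" "\<And>k. Q (g k) (g (Suc k))"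
    by blast
  \<comment> \<open>The index 0 of the initial state is a placeholder, so the selected indices start
    with state 1.\<close>
  define n where "n k = fst (g (Suc k))" for k
  have "strict_mono n"
    unfolding strict_mono_Suc_iff n_def using g(3) by (auto simp: Q_def)
  have "(\<Inter>i<m. if \<epsilon> i then B (n i) else A (n i)) \<in> snd (g m)" for m \<epsilon>
  proof (induction m)
    case 0 then show ?case using g(1) by simp
  next
    case (Suc m)
    have "(\<Inter>i<Suc m. if \<epsilon> i then B (n i) else A (n i))
       = (\<Inter>i<m. if \<epsilon> i then B (n i) else A (n i)) \<inter> (if \<epsilon> m then B (n m) else A (n m))"
      by (auto simp: less_Suc_eq)
    then show ?case using Suc g(3)[of m] by (auto simp: Q_def n_def)
  qed
  moreover have "E \<inter> X \<noteq> {}" if "E \<in> snd (g m)" for E m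
  proof
    assume "E \<inter> X = {}"
    then have "double_limit A B E = 0" by (rule double_limit_empty)
    moreover have "0 < double_limit A B E" using g(2)[of m] that by (simp add: P_def)
    ultimately show False by simp
  qed
  ultimately have ne: "(\<Inter>i<m. if \<epsilon> i then B (n i) else A (n i)) \<inter> X \<noteq> {}" for m \<epsilon>
    by blast
  show ?thesis
  proof (intro exI[of _ n] conjI allI \<open>strict_mono n\<close>)
    fix m \<epsilon>
    obtain x where "x \<in> X" "x \<in> (\<Inter>i<m. if \<epsilon> i then B (n i) else A (n i))"
      using ne[where m=m and \<epsilon>=\<epsilon>] by blast
    then show "\<exists>x\<in>X. \<forall>i<m. x \<in> (if \<epsilon> i then B (n i) else A (n i))"
      by (intro bexI[of _ x]) simp_all
  qed
qed

end

section \<open>Sequences correlated with orthogonal functions\<close>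

text \<open>Independence in the sense of Rosenthal, with thresholds common to all functions; for the
  evaluations of a bounded sequence of vectors it yields l1, see
  \<open>contains_l1_of_indep_seq\<close>.\<close>

definition indep_seq :: "'a set \<Rightarrow> (nat \<Rightarrow> 'a \<Rightarrow> real) \<Rightarrow> real \<Rightarrow> real \<Rightarrow> bool" where
  "indep_seq K h p q \<longleftrightarrow> p < q \<and>
    (\<forall>m \<epsilon>. \<exists>x\<in>K. \<forall>i<m. if \<epsilon> i then q \<le> h i x else h i x \<le> p)"

text \<open>Two numbers more than \<open>d\<close> apart have a whole grid interval between them,
  because \<open>2 / N \<le> d\<close>, and their distance is at most 2. After integration this
  turns separation in the mean into finitely many products of a sublevel with a superlevel
  indicator.\<close>

lemma threshold_grid:
  fixes x y d :: real and N :: nat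
  assumes "\<bar>x\<bar> \<le> 1" "\<bar>y\<bar> \<le> 1" "0 < N" "2 / real N \<le> d"
  shows "\<bar>x - y\<bar> \<le> d + 2 * (\<Sum>l\<in>{- int N..int N}.
     of_bool (x \<le> l / N \<and> (l + 1) / N \<le> y) + of_bool (y \<le> l / N \<and> (l + 1) / N \<le> x))"
    (is "_ \<le> d + 2 * sum ?g _")
proof -
  have *: "\<exists>l\<in>{- int N..int N}. x \<le> l / N \<and> (l + 1) / N \<le> y"
    if "\<bar>x\<bar> \<le> 1" "d < y - x" for x y :: real
  proof (intro bexI conjI)
    let ?l = "\<lceil>x * N\<rceil>"
    have N: "0 < real N" using assms by simp
    show "x \<le> ?l / N" using N by (simp add: pos_le_divide_eq)
    have "(?l + 1) / N \<le> (x * N + 2) / N" by (intro divide_right_mono) linarith+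
    also have "\<dots> = x + 2 / N" using N by (simp add: field_simps)
    also have "\<dots> \<le> y" using that assms by linarith
    finally show "(?l + 1) / N \<le> y" .
    have "x * real N \<le> 1 * real N" "- 1 * real N \<le> x * real N"
      using that(1) N by (intro mult_right_mono; simp add: abs_le_iff)+
    then show "?l \<in> {- int N..int N}" by (auto simp: ceiling_le_iff le_ceiling_iff)
  qed
  have g0: "0 \<le> ?g l" for l by simp
  show ?thesis
  proof (cases "\<bar>x - y\<bar> \<le> d")
    case True
    then show ?thesis using sum_nonneg[of "{- int N..int N}" ?g] g0 by auto
  next
    case False
    then have "d < y - x \<or> d < x - y" by linarith
    then obtain l where l: "l \<in> {- int N..int N}" "1 \<le> ?g l"
      using *[of x y] *[of y x] assms by (auto split: if_splits)
    have "?g l \<le> sum ?g {- int N..int N}" using l g0 by (intro member_le_sum) auto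
    moreover have "0 < d" using assms by (smt (verit) divide_pos_pos of_nat_0_less_iff)
    ultimately show ?thesis using l assms by (simp add: abs_le_iff)
  qed
qed

context functional_with_limit begin

text \<open>Bessel's inequality from \<open>0 \<le> \<Lambda>((f - g)^2)\<close> with
  \<open>g\<close> the sum of the \<open>a i * r i\<close>. The \<open>r i\<close> are bounded by 1
  instead of normalized, which still gives
  \<open>\<Lambda>(g^2) \<le> (\<Sum>i\<in>S. (a i)^2)\<close>.\<close>

lemma Bessel_card:
  fixes c :: real
  assumes r: "\<And>i x. x \<in> X \<Longrightarrow> \<bar>r i x\<bar> \<le> 1" and one: "\<Lambda> (\<lambda>x. 1) \<le> 1"
    and orth: "\<And>i j. i \<noteq> j \<Longrightarrow> \<Lambda> (\<lambda>x. r i x * r j x) = 0"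
    and f: "bdd_on X f" and "finite S" and c0: "0 \<le> c" and cS: "\<And>i. i \<in> S \<Longrightarrow> c \<le> \<bar>\<Lambda> (\<lambda>x. f x * r i x)\<bar>"
  shows "card S * c\<^sup>2 \<le> \<Lambda> (\<lambda>x. (f x)\<^sup>2)"
proof -
  have br: "bdd_on X (r i)" for i using r by (rule bdd_onI)
  define a where "a i = \<Lambda> (\<lambda>x. f x * r i x)" for i
  define g where "g x = (\<Sum>i\<in>S. a i * r i x)" for x
  have g: "bdd_on X g" unfolding g_def using br by auto
  have fg: "\<Lambda> (\<lambda>x. f x * g x) = (\<Sum>i\<in>S. (a i)\<^sup>2)"
  proof -
    have "\<Lambda> (\<lambda>x. f x * g x) = \<Lambda> (\<lambda>x. \<Sum>i\<in>S. a i * (f x * r i x))"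
      by (rule arg_cong[of _ _ \<Lambda>]) (auto simp: g_def sum_distrib_left algebra_simps)
    also have "\<dots> = (\<Sum>i\<in>S. a i * a i)"
      using f br by (simp add: sum scale a_def)
    finally show ?thesis by (simp add: power2_eq_square)
  qed
  have gg: "\<Lambda> (\<lambda>x. (g x)\<^sup>2) \<le> (\<Sum>i\<in>S. (a i)\<^sup>2)"
  proof -
    have "\<Lambda> (\<lambda>x. (g x)\<^sup>2) = \<Lambda> (\<lambda>x. \<Sum>i\<in>S. \<Sum>j\<in>S. (a i * a j) * (r i x * r j x))"
      by (rule arg_cong[of _ _ \<Lambda>])
        (auto simp: g_def power2_eq_square sum_product intro!: sum.cong)
    also have "\<dots> = (\<Sum>i\<in>S. \<Sum>j\<in>S. (a i * a j) * \<Lambda> (\<lambda>x. r i x * r j x))"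
      using br by (simp add: sum scale)
    also have "\<dots> = (\<Sum>i\<in>S. \<Sum>j\<in>S. if i = j then (a i)\<^sup>2 * \<Lambda> (\<lambda>x. (r i x)\<^sup>2) else 0)"
      by (intro sum.cong) (auto simp: orth power2_eq_square)
    also have "\<dots> = (\<Sum>i\<in>S. (a i)\<^sup>2 * \<Lambda> (\<lambda>x. (r i x)\<^sup>2))" using \<open>finite S\<close> by simp
    also have "\<dots> \<le> (\<Sum>i\<in>S. (a i)\<^sup>2 * 1)"
      by (intro sum_mono mult_left_mono order_trans[OF square_le_one[OF r] one]) auto
    finally show ?thesis by simp
  qed
  have "0 \<le> \<Lambda> (\<lambda>x. (f x + (-1) * g x)\<^sup>2)" by (rule nonneg) (use f g in auto)
  then have "0 \<le> \<Lambda> (\<lambda>x. (f x)\<^sup>2) - (\<Sum>i\<in>S. (a i)\<^sup>2)"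
    using square_expand[OF f g, of "-1"] fg gg by simp
  moreover have "card S * c\<^sup>2 \<le> (\<Sum>i\<in>S. (a i)\<^sup>2)"
  proof -
    have "c\<^sup>2 \<le> (a i)\<^sup>2" if "i \<in> S" for i
      using power_mono[OF cS[OF that] c0, of 2] by (simp add: a_def)
    then have "(\<Sum>i\<in>S. c\<^sup>2) \<le> (\<Sum>i\<in>S. (a i)\<^sup>2)" by (intro sum_mono)
    then show ?thesis by simp
  qed
  ultimately show ?thesis by linarith
qed

text \<open>For fixed \<open>i\<close>, Bessel leaves only finitely many \<open>j\<close> for which
  \<open>f i\<close> has correlation at least \<open>\<delta> / 2\<close> with \<open>r j\<close>.
  For all others the correlation of \<open>f j\<close> with \<open>r j\<close> is at least
  \<open>\<delta>\<close>, so \<open>r j\<close> witnesses the distance of \<open>f i\<close> and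
  \<open>f j\<close>.\<close>

lemma orthogonal_correlated_separated:
  assumes r: "\<And>i x. x \<in> X \<Longrightarrow> \<bar>r i x\<bar> \<le> 1" and one: "\<Lambda> (\<lambda>x. 1) \<le> 1"
    and orth: "\<And>i j. i \<noteq> j \<Longrightarrow> \<Lambda> (\<lambda>x. r i x * r j x) = 0"
    and f: "\<And>i x. x \<in> X \<Longrightarrow> \<bar>f i x\<bar> \<le> 1"
    and "0 < \<delta>" and corr: "\<And>i. \<delta> \<le> \<bar>\<Lambda> (\<lambda>x. f i x * r i x)\<bar>"
  shows "\<forall>\<^sub>F j in sequentially. \<delta> / 2 \<le> \<Lambda> (\<lambda>x. \<bar>f i x - f j x\<bar>)"
proof -
  have br: "bdd_on X (r i)" for i using r by (rule bdd_onI)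
  have bf: "bdd_on X (f i)" for i using f by (rule bdd_onI)
  have "finite {j. \<delta> / 2 \<le> \<bar>\<Lambda> (\<lambda>x. f i x * r j x)\<bar>}" (is "finite ?J")
  proof (rule ccontr)
    assume inf: "infinite ?J"
    obtain N :: nat where N: "1 < real N * (\<delta> / 2)\<^sup>2"
      using reals_Archimedean3[of "(\<delta> / 2)\<^sup>2"] \<open>0 < \<delta>\<close> by auto
    obtain S where S: "S \<subseteq> ?J" "finite S" "card S = N"
      using infinite_arbitrarily_large[OF inf] by blast
    have "real (card S) * (\<delta> / 2)\<^sup>2 \<le> \<Lambda> (\<lambda>x. (f i x)\<^sup>2)"
      by (rule Bessel_card[OF r one orth bf]) (use S \<open>0 < \<delta>\<close> in auto)
    also have "\<dots> \<le> 1" using square_le_one[of "f i", OF f] one by linarith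
    finally show False using N S by simp
  qed
  then have "\<forall>\<^sub>F j in sequentially. \<not> \<delta> / 2 \<le> \<bar>\<Lambda> (\<lambda>x. f i x * r j x)\<bar>"
    by (simp add: eventually_cofinite flip: cofinite_eq_sequentially)
  then show ?thesis
  proof eventually_elim
    case (elim j)
    have "\<Lambda> (\<lambda>x. (f i x - f j x) * r j x) = \<Lambda> (\<lambda>x. f i x * r j x) - \<Lambda> (\<lambda>x. f j x * r j x)"
      using diff[of "\<lambda>x. f i x * r j x" "\<lambda>x. f j x * r j x"] bf br by (simp add: left_diff_distrib)
    then have "\<delta> / 2 \<le> \<bar>\<Lambda> (\<lambda>x. (f i x - f j x) * r j x)\<bar>" using elim corr[of j] by linarith
    also have "\<dots> \<le> \<Lambda> (\<lambda>x. \<bar>(f i x - f j x) * r j x\<bar>)" by (rule abs_le) (use bf br in auto)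
    also have "\<dots> \<le> \<Lambda> (\<lambda>x. \<bar>f i x - f j x\<bar>)"
      by (rule mono) (use bf br r in \<open>auto simp: abs_mult mult_left_le\<close>)
    finally show ?case .
  qed
qed

text \<open>Taking both limits in the grid estimate leaves a positive amount for the double limits
  of the threshold sets. Sublevel set first or superlevel set first makes no difference by
  \<open>double_limit_swap\<close>, so a single grid interval has a positive double limit.\<close>

lemma orthogonal_correlated_independent:
  assumes r: "\<And>i x. x \<in> X \<Longrightarrow> \<bar>r i x\<bar> \<le> 1" and one: "\<Lambda> (\<lambda>x. 1) \<le> 1"
    and orth: "\<And>i j. i \<noteq> j \<Longrightarrow> \<Lambda> (\<lambda>x. r i x * r j x) = 0"
    and f: "\<And>i x. x \<in> X \<Longrightarrow> \<bar>f i x\<bar> \<le> 1"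
    and "0 < \<delta>" and corr: "\<And>i. \<delta> \<le> \<bar>\<Lambda> (\<lambda>x. f i x * r i x)\<bar>"
  shows "\<exists>n p q. strict_mono (n :: nat \<Rightarrow> nat) \<and> indep_seq X (\<lambda>i. f (n i)) p q"
proof -
  have bf: "bdd_on X (f i)" for i using f by (rule bdd_onI)
  \<comment> \<open>The grid may cost \<open>\<delta> / 4\<close>, half of the separation in the
    mean.\<close>
  obtain N :: nat where "8 / \<delta> < N" using reals_Archimedean2 by blast
  moreover have "0 < 8 / \<delta>" using \<open>0 < \<delta>\<close> by simp
  ultimately have "0 < real N" by linarith
  with \<open>8 / \<delta> < N\<close> have N: "0 < N" "2 / real N \<le> \<delta> / 4" using \<open>0 < \<delta>\<close>
    by (auto simp: field_simps)
  let ?L = "{- int N..int N}"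
  define A where "A l i = {x. f i x \<le> l / N}" for l :: int and i
  define B where "B l i = {x. (l + 1) / N \<le> f i x}" for l :: int and i
  define a where "a l i j = \<Lambda> (indicator (UNIV \<inter> A l i \<inter> B l j))" for l i j
  define b where "b l i j = \<Lambda> (indicator (UNIV \<inter> B l i \<inter> A l j))" for l i j
  have bd: "\<bar>\<Lambda> (indicator E)\<bar> \<le> 1" for E
    using bound[of "indicator E" 1] one by (auto simp: indicator_def)
  have bab: "bdd_on UNIV (a l i)" "bdd_on UNIV (b l i)"
    "bdd_on UNIV (\<lambda>i. Ulim (a l i))" "bdd_on UNIV (\<lambda>i. Ulim (b l i))" for l i
    unfolding a_def b_def by (rule bdd_onI[of _ _ 1], rule bd U.Ulim_abs_le, (rule bd)?)+
  let ?S = "\<lambda>i j. \<delta> / 4 + 2 * (\<Sum>l\<in>?L. a l i j + b l i j)"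
  have le: "\<Lambda> (\<lambda>x. \<bar>f i x - f j x\<bar>) \<le> ?S i j" for i j
  proof -
    let ?u = "\<lambda>x. \<Sum>l\<in>?L. indicator (UNIV \<inter> A l i \<inter> B l j) x + indicator (UNIV \<inter> B l i \<inter> A l j) x"
    have "\<Lambda> (\<lambda>x. \<bar>f i x - f j x\<bar>) \<le> \<Lambda> (\<lambda>x. \<delta> / 4 + 2 * ?u x)"
    proof (rule mono)
      fix x assume "x \<in> X"
      then show "\<bar>f i x - f j x\<bar> \<le> \<delta> / 4 + 2 * ?u x"
        using threshold_grid[OF f f N, of x x i j]
        by (simp add: indicator_def A_def B_def conj_commute)
    qed (use bf in auto)
    also have "\<dots> = \<Lambda> (\<lambda>x. \<delta> / 4) + 2 * \<Lambda> ?u"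
      by (subst add) (auto simp: scale)
    also have "\<Lambda> ?u = (\<Sum>l\<in>?L. a l i j + b l i j)"
      unfolding a_def b_def by (subst sum) (auto intro!: sum.cong add)
    also have "\<Lambda> (\<lambda>x. \<delta> / 4) \<le> \<delta> / 4"
      using const[of "\<delta> / 4"] one \<open>0 < \<delta>\<close> mult_left_mono[OF one, of "\<delta> / 4"] by simp
    finally show ?thesis by simp
  qed
  have "\<delta> / 2 \<le> Ulim (?S i)" for i
  proof (rule U.Ulim_ge)
    show "bdd_on UNIV (?S i)" using bab by auto
    show "\<forall>\<^sub>F j in sequentially. \<delta> / 2 \<le> ?S i j"
    proof (rule eventually_mono)
      show "\<forall>\<^sub>F j in sequentially. \<delta> / 2 \<le> \<Lambda> (\<lambda>x. \<bar>f i x - f j x\<bar>)"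
        by (rule orthogonal_correlated_separated[OF r one orth f \<open>0 < \<delta>\<close> corr])
    qed (use le in \<open>blast intro: order_trans\<close>)
  qed
  moreover have "Ulim (?S i) = \<delta> / 4 + 2 * (\<Sum>l\<in>?L. Ulim (a l i) + Ulim (b l i))" for i
  proof -
    have "Ulim (?S i) = \<delta> / 4 + 2 * Ulim (\<lambda>j. \<Sum>l\<in>?L. a l i j + b l i j)"
      using bab by (subst U.add) (auto simp: U.scale)
    also have "Ulim (\<lambda>j. \<Sum>l\<in>?L. a l i j + b l i j) = (\<Sum>l\<in>?L. Ulim (a l i) + Ulim (b l i))"
      using bab by (subst U.sum) (auto intro!: sum.cong U.add)
    finally show ?thesis .
  qed
  ultimately have "\<delta> / 2 \<le> Ulim (\<lambda>i. \<delta> / 4 + 2 * (\<Sum>l\<in>?L. Ulim (a l i) + Ulim (b l i)))"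
    using bab by (intro U.Ulim_ge) auto
  also have "\<dots> = \<delta> / 4 + 2 * (\<Sum>l\<in>?L. Ulim (\<lambda>i. Ulim (a l i)) + Ulim (\<lambda>i. Ulim (b l i)))"
  proof -
    have "Ulim (\<lambda>i. \<delta> / 4 + 2 * (\<Sum>l\<in>?L. Ulim (a l i) + Ulim (b l i)))
      = \<delta> / 4 + 2 * Ulim (\<lambda>i. \<Sum>l\<in>?L. Ulim (a l i) + Ulim (b l i))"
      using bab by (subst U.add) (auto simp: U.scale)
    also have "Ulim (\<lambda>i. \<Sum>l\<in>?L. Ulim (a l i) + Ulim (b l i))
       = (\<Sum>l\<in>?L. Ulim (\<lambda>i. Ulim (a l i)) + Ulim (\<lambda>i. Ulim (b l i)))"
      using bab by (subst U.sum) (auto intro!: sum.cong U.add)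
    finally show ?thesis .
  qed
  also have "\<dots> = \<delta> / 4 + 2 * (\<Sum>l\<in>?L. 2 * double_limit (A l) (B l) UNIV)"
  proof -
    have "Ulim (\<lambda>i. Ulim (a l i)) = double_limit (A l) (B l) UNIV"
      "Ulim (\<lambda>i. Ulim (b l i)) = double_limit (A l) (B l) UNIV" for l
      unfolding a_def b_def using double_limit_swap[of "B l" "A l" UNIV]
      by (simp_all add: double_limit_def)
    then show ?thesis by simp
  qed
  finally have "0 < (\<Sum>l\<in>?L. 2 * double_limit (A l) (B l) UNIV)" using \<open>0 < \<delta>\<close> by simp
  then obtain l where "0 < double_limit (A l) (B l) UNIV"
    by (metis (no_types, lifting) sum_nonpos linorder_not_le mult_nonneg_nonpos zero_le_numeral)
  then obtain n where n: "strict_mono (n :: nat \<Rightarrow> nat)"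
    "\<And>m \<epsilon>. \<exists>x\<in>X. \<forall>i<m. x \<in> (if \<epsilon> i then B l (n i) else A l (n i))"
    using double_limit_independent by blast
  have "indep_seq X (\<lambda>i. f (n i)) (l / N) ((l + 1) / N)"
    unfolding indep_seq_def
  proof (intro conjI allI)
    show "real_of_int l / N < real_of_int (l + 1) / N" using N(1) by (intro divide_strict_right_mono) auto
    fix m \<epsilon>
    obtain x where x: "x \<in> X" "\<forall>i<m. x \<in> (if \<epsilon> i then B l (n i) else A l (n i))"
      using n(2) by blast
    then show "\<exists>x\<in>X. \<forall>i<m. if \<epsilon> i then real_of_int (l + 1) / N \<le> f (n i) x else f (n i) x \<le> l / N"
      by (intro bexI[of _ x]) (auto simp: A_def B_def split: if_splits)
  qed
  with n(1) show ?thesis by blast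
qed

end

section \<open>From l1-sequences to independent sequences\<close>

text \<open>\<open>Q\<close> need not be closed, so an almost minimizer \<open>q\<close> of the
  squared deficit \<open>S\<close> is used, whence the loss from \<open>\<delta>\<close> to
  \<open>\<delta>'\<close>. With the deficits of \<open>q\<close> as weights \<open>a\<close>, a
  short step towards the resulting \<open>q'\<close> would lower \<open>S\<close> too much unless
  \<open>S q\<close> is small.\<close>

lemma finite_minimax:
  fixes Q :: "(nat \<Rightarrow> real) set"
  assumes conv: "\<And>q q' t. q \<in> Q \<Longrightarrow> q' \<in> Q \<Longrightarrow> 0 \<le> t \<Longrightarrow> t \<le> 1 \<Longrightarrow> (\<lambda>i. q i + t * (q' i - q i)) \<in> Q"
    and bound: "\<And>q i. q \<in> Q \<Longrightarrow> i < n \<Longrightarrow> \<bar>q i\<bar> \<le> C"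
    and ex: "\<And>a. (\<And>i. 0 \<le> a i) \<Longrightarrow> \<exists>q\<in>Q. \<delta> * (\<Sum>i<n. a i) \<le> (\<Sum>i<n. a i * q i)"
    and "\<delta>' < \<delta>"
  shows "\<exists>q\<in>Q. \<forall>i<n. \<delta>' \<le> q i"
proof -
  define S where "S q = (\<Sum>i<n. (max 0 (\<delta> - q i))\<^sup>2)" for q
  define m where "m = Inf (S ` Q)"
  have "Q \<noteq> {}" using ex[of "\<lambda>_. 0"] by auto
  have S0: "0 \<le> S q" for q by (simp add: S_def sum_nonneg)
  have m: "m \<le> S q" if "q \<in> Q" for q
    unfolding m_def using S0 that by (intro cInf_lower bdd_belowI2[of _ 0]) auto
  define D where "D = (1 + (2 * C)\<^sup>2 * n) / 2"
  have D: "0 < D" by (simp add: D_def add_pos_nonneg)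
  \<comment> \<open>\<open>t\<close> is the step length and \<open>t^2\<close> the accuracy of the
    almost minimizer: the errors add up to
    \<open>t^2 * (1 + (2 * C)^2 * n) = 2 * t * (t * D)\<close>, which leads to
    \<open>S q \<le> t * D\<close>.\<close>
  define t where "t = min 1 ((\<delta> - \<delta>')\<^sup>2 / (2 * D))"
  have t: "0 < t" "t \<le> 1" using D \<open>\<delta>' < \<delta>\<close> by (auto simp: t_def)
  have "t \<le> (\<delta> - \<delta>')\<^sup>2 / (2 * D)" by (simp add: t_def)
  then have "t * D \<le> (\<delta> - \<delta>')\<^sup>2 / 2" using D by (simp add: field_simps)
  then have tD: "t * D < (\<delta> - \<delta>')\<^sup>2" using \<open>\<delta>' < \<delta>\<close> by (smt (verit) field_sum_of_halves zero_less_power)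
  have "\<exists>s\<in>S ` Q. s < m + t\<^sup>2"
    unfolding m_def using \<open>Q \<noteq> {}\<close> t by (intro cInf_lessD) auto
  then obtain q where q: "q \<in> Q" "S q < m + t\<^sup>2" by blast
  define a where "a i = max 0 (\<delta> - q i)" for i
  obtain q' where q': "q' \<in> Q" "\<delta> * (\<Sum>i<n. a i) \<le> (\<Sum>i<n. a i * q' i)"
    using ex[of a] by (auto simp: a_def)
  let ?d = "\<lambda>i. q' i - q i"
  have "m \<le> S (\<lambda>i. q i + t * ?d i)" using conv[OF q(1) q'(1)] t by (intro m) auto
  also have "\<dots> \<le> (\<Sum>i<n. (a i - t * ?d i)\<^sup>2)"
    unfolding S_def
  proof (rule sum_mono)
    fix i
    show "(max 0 (\<delta> - (q i + t * ?d i)))\<^sup>2 \<le> (a i - t * ?d i)\<^sup>2"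
    proof (cases "\<delta> - (q i + t * ?d i) \<le> 0")
      case False
      then have "max 0 (\<delta> - (q i + t * ?d i)) \<le> a i - t * ?d i" by (simp add: a_def)
      then show ?thesis by (intro power_mono) auto
    qed auto
  qed
  also have "\<dots> = S q - 2 * t * (\<Sum>i<n. a i * ?d i) + t\<^sup>2 * (\<Sum>i<n. (?d i)\<^sup>2)"
  proof -
    have "(a i - t * ?d i)\<^sup>2 = (a i)\<^sup>2 - 2 * t * (a i * ?d i) + t\<^sup>2 * (?d i)\<^sup>2" for i
      by (simp add: power2_eq_square algebra_simps)
    then show ?thesis
      by (simp only: S_def a_def[symmetric] sum.distrib sum_subtractf sum_distrib_left)
  qed
  finally have 1: "m \<le> S q - 2 * t * (\<Sum>i<n. a i * ?d i) + t\<^sup>2 * (\<Sum>i<n. (?d i)\<^sup>2)" .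
  \<comment> \<open>\<open>a i\<close> is zero wherever \<open>\<delta> - q i\<close> is negative,
    so \<open>(a i)^2\<close> equals \<open>a i * (\<delta> - q i)\<close>.\<close>
  have "S q = (\<Sum>i<n. a i * (\<delta> - q i))"
    unfolding S_def by (intro sum.cong) (auto simp: a_def max_def power2_eq_square)
  also have "\<dots> \<le> (\<Sum>i<n. a i * ?d i)"
    using q'(2) by (simp add: right_diff_distrib sum_subtractf sum_distrib_left mult.commute)
  finally have "2 * t * S q \<le> 2 * t * (\<Sum>i<n. a i * ?d i)" using t by simp
  moreover have "t\<^sup>2 * (\<Sum>i<n. (?d i)\<^sup>2) \<le> t\<^sup>2 * ((2 * C)\<^sup>2 * n)"
  proof (rule mult_left_mono)
    have "(?d i)\<^sup>2 \<le> (2 * C)\<^sup>2" if "i < n" for i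
    proof -
      have "\<bar>?d i\<bar> \<le> 2 * C" using bound[OF q(1) that] bound[OF q'(1) that] by linarith
      then show ?thesis by (metis abs_ge_zero power2_abs power_mono)
    qed
    then have "(\<Sum>i<n. (?d i)\<^sup>2) \<le> (\<Sum>i<n. (2 * C)\<^sup>2)" by (intro sum_mono) auto
    then show "(\<Sum>i<n. (?d i)\<^sup>2) \<le> (2 * C)\<^sup>2 * n" by (simp add: mult.commute)
  qed simp
  ultimately have "2 * t * S q \<le> t\<^sup>2 + t\<^sup>2 * ((2 * C)\<^sup>2 * n)" using 1 q(2) by linarith
  also have "\<dots> = 2 * t * (t * D)" by (simp add: D_def power2_eq_square field_simps)
  finally have Sq: "S q \<le> t * D" using t by simp
  show ?thesis
  proof (intro bexI[OF _ q(1)] allI impI)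
    fix i assume "i < n"
    then have "(max 0 (\<delta> - q i))\<^sup>2 \<le> S q" unfolding S_def by (intro member_le_sum) auto
    then have "(max 0 (\<delta> - q i))\<^sup>2 < (\<delta> - \<delta>')\<^sup>2" using Sq tD by linarith
    then have "max 0 (\<delta> - q i) < \<delta> - \<delta>'" by (rule power2_less_imp_less) (use \<open>\<delta>' < \<delta>\<close> in simp)
    then show "\<delta>' \<le> q i" by simp
  qed
qed

section \<open>Finitely supported averages\<close>

definition fin_integral :: "('a \<Rightarrow> real) \<Rightarrow> ('a \<Rightarrow> real) \<Rightarrow> real" where
  "fin_integral W h = (\<Sum>\<omega> | W \<omega> \<noteq> 0. W \<omega> * h \<omega>)"

definition fin_prob :: "'a set \<Rightarrow> ('a \<Rightarrow> real) \<Rightarrow> bool" where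
  "fin_prob X W \<longleftrightarrow> finite {\<omega>. W \<omega> \<noteq> 0} \<and> {\<omega>. W \<omega> \<noteq> 0} \<subseteq> X \<and> (\<forall>\<omega>. 0 \<le> W \<omega>) \<and> fin_integral W (\<lambda>_. 1) = 1"

lemma fin_integral_superset:
  "finite S \<Longrightarrow> {\<omega>. W \<omega> \<noteq> 0} \<subseteq> S \<Longrightarrow> fin_integral W h = (\<Sum>\<omega>\<in>S. W \<omega> * h \<omega>)"
  unfolding fin_integral_def by (rule sum.mono_neutral_left) auto

lemma fin_integral_convex:
  assumes "finite {\<omega>. W \<omega> \<noteq> 0}" "finite {\<omega>. W' \<omega> \<noteq> 0}"
  shows "fin_integral (\<lambda>\<omega>. W \<omega> + t * (W' \<omega> - W \<omega>)) h
    = fin_integral W h + t * (fin_integral W' h - fin_integral W h)"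
proof -
  let ?S = "{\<omega>. W \<omega> \<noteq> 0} \<union> {\<omega>. W' \<omega> \<noteq> 0}"
  have "finite ?S" using assms by simp
  then have 1: "fin_integral V h = (\<Sum>\<omega>\<in>?S. V \<omega> * h \<omega>)"
    if "{\<omega>. V \<omega> \<noteq> 0} \<subseteq> ?S" for V
    using that by (intro fin_integral_superset)
  have "{\<omega>. W \<omega> + t * (W' \<omega> - W \<omega>) \<noteq> 0} \<subseteq> ?S" by auto
  from 1[OF this] 1[of W] 1[of W'] show ?thesis
    by (simp add: sum_distrib_left algebra_simps flip: sum.distrib sum_subtractf)
qed

lemma fin_prob_convex:
  assumes "fin_prob X W" "fin_prob X W'" "0 \<le> t" "t \<le> 1"
  shows "fin_prob X (\<lambda>\<omega>. W \<omega> + t * (W' \<omega> - W \<omega>))"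
  unfolding fin_prob_def
proof (intro conjI allI)
  have fin: "finite {\<omega>. W \<omega> \<noteq> 0}" "finite {\<omega>. W' \<omega> \<noteq> 0}"
    using assms by (auto simp: fin_prob_def)
  have sub: "{\<omega>. W \<omega> + t * (W' \<omega> - W \<omega>) \<noteq> 0} \<subseteq> {\<omega>. W \<omega> \<noteq> 0} \<union> {\<omega>. W' \<omega> \<noteq> 0}" by auto
  then show "finite {\<omega>. W \<omega> + t * (W' \<omega> - W \<omega>) \<noteq> 0}" using fin finite_subset by blast
  show "{\<omega>. W \<omega> + t * (W' \<omega> - W \<omega>) \<noteq> 0} \<subseteq> X"
    using sub assms by (auto simp: fin_prob_def)
  show "fin_integral (\<lambda>\<omega>. W \<omega> + t * (W' \<omega> - W \<omega>)) (\<lambda>_. 1) = 1"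
    using assms by (subst fin_integral_convex[OF fin]) (simp add: fin_prob_def)
  fix \<omega>
  have "0 \<le> (1 - t) * W \<omega> + t * W' \<omega>" using assms by (simp add: fin_prob_def)
  then show "0 \<le> W \<omega> + t * (W' \<omega> - W \<omega>)" by (simp add: algebra_simps)
qed

lemma fin_integral_bound:
  assumes "fin_prob X W" "\<And>\<omega>. \<omega> \<in> X \<Longrightarrow> \<bar>h \<omega>\<bar> \<le> C"
  shows "\<bar>fin_integral W h\<bar> \<le> C"
proof -
  have "\<bar>fin_integral W h\<bar> \<le> (\<Sum>\<omega> | W \<omega> \<noteq> 0. \<bar>W \<omega> * h \<omega>\<bar>)"
    unfolding fin_integral_def by (rule sum_abs)
  also have "\<dots> \<le> (\<Sum>\<omega> | W \<omega> \<noteq> 0. W \<omega> * C)"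
    using assms by (intro sum_mono) (auto simp: fin_prob_def abs_mult intro!: mult_left_mono)
  also have "\<dots> = C * fin_integral W (\<lambda>_. 1)"
    by (simp add: fin_integral_def sum_distrib_left mult.commute)
  also have "\<dots> = C" using assms by (simp add: fin_prob_def)
  finally show ?thesis .
qed

text \<open>Sample space: a sign pattern, a point, and a sign that is chosen together with the point.\<close>

definition rad :: "nat \<Rightarrow> nat set \<times> 'a \<times> bool \<Rightarrow> real" where
  "rad i \<omega> = (if (i \<in> fst \<omega>) = snd (snd \<omega>) then 1 else - 1)"

definition pt :: "nat set \<times> 'a \<times> bool \<Rightarrow> 'a" where
  "pt \<omega> = fst (snd \<omega>)"

lemma abs_rad [simp]: "\<bar>rad i \<omega>\<bar> = 1"
  by (simp add: rad_def)

text \<open>Toggling \<open>i\<close> is an involution of the power set that reverses the first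
  factor and keeps the second.\<close>

lemma sum_sign_products:
  assumes "i < n" "i \<noteq> j"
  shows "(\<Sum>\<epsilon>\<in>Pow {..<n}. (if i \<in> \<epsilon> then 1 else - 1) * (if j \<in> \<epsilon> then 1 else - 1 :: real)) = 0"
    (is "(\<Sum>\<epsilon>\<in>_. ?g \<epsilon>) = 0")
proof -
  let ?t = "\<lambda>\<epsilon>. if i \<in> \<epsilon> then \<epsilon> - {i} else insert i \<epsilon>"
  have "(\<Sum>\<epsilon>\<in>Pow {..<n}. ?g \<epsilon>) = (\<Sum>\<epsilon>\<in>Pow {..<n}. - ?g \<epsilon>)"
    by (rule sum.reindex_bij_witness[of _ ?t ?t]) (use assms in \<open>auto split: if_splits\<close>)
  then show ?thesis by (simp add: sum_negf)
qed

text \<open>Minimax over the probabilities under which the signs are orthogonal; this condition is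
  linear, so the set is convex. Against weights \<open>a\<close> the answer is the uniform
  distribution over all sign patterns, each placed at a point where the l1 estimate for the signed
  weights holds.\<close>

lemma sup_l1_balanced:
  fixes z :: "nat \<Rightarrow> 'a \<Rightarrow> real"
  assumes z: "\<And>i k. k \<in> K \<Longrightarrow> \<bar>z i k\<bar> \<le> C"
    and l1: "\<And>n a. \<exists>k\<in>K. \<eta> * (\<Sum>i<n. \<bar>a i\<bar>) \<le> \<bar>\<Sum>i<n. a i * z i k\<bar>"
    and "0 < \<eta>"
  shows "\<exists>W. fin_prob {\<omega>. pt \<omega> \<in> K} W \<and>
    (\<forall>i<n. \<eta> / 2 \<le> fin_integral W (\<lambda>\<omega>. z i (pt \<omega>) * rad i \<omega>)) \<and>
    (\<forall>i<n. \<forall>j<n. i \<noteq> j \<longrightarrow> fin_integral W (\<lambda>\<omega>. rad i \<omega> * rad j \<omega>) = 0)"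
proof -
  let ?X = "{\<omega>::nat set \<times> 'a \<times> bool. pt \<omega> \<in> K}"
  define P where "P = {W. fin_prob ?X W \<and>
    (\<forall>i<n. \<forall>j<n. i \<noteq> j \<longrightarrow> fin_integral W (\<lambda>\<omega>. rad i \<omega> * rad j \<omega>) = 0)}"
  define q where "q W i = fin_integral W (\<lambda>\<omega>. z i (pt \<omega>) * rad i \<omega>)" for W i
  have "\<exists>x\<in>q ` P. \<forall>i<n. \<eta> / 2 \<le> x i"
  proof (rule finite_minimax)
    show "\<eta> / 2 < \<eta>" using \<open>0 < \<eta>\<close> by simp
    fix x assume "x \<in> q ` P"
    then obtain W where W: "W \<in> P" "x = q W" by blast
    then have fW: "fin_prob ?X W" "finite {\<omega>. W \<omega> \<noteq> 0}" by (auto simp: P_def fin_prob_def)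
    show "\<bar>x i\<bar> \<le> C" if "i < n" for i
      unfolding W q_def using fW(1) by (rule fin_integral_bound) (simp add: abs_mult z)
    fix y t assume "y \<in> q ` P" and t: "0 \<le> t" "t \<le> (1::real)"
    then obtain W' where W': "W' \<in> P" "y = q W'" by blast
    then have fW': "fin_prob ?X W'" "finite {\<omega>. W' \<omega> \<noteq> 0}" by (auto simp: P_def fin_prob_def)
    let ?V = "\<lambda>\<omega>. W \<omega> + t * (W' \<omega> - W \<omega>)"
    have "?V \<in> P" using W W' fin_prob_convex[OF fW(1) fW'(1) t]
      by (auto simp: P_def fin_integral_convex[OF fW(2) fW'(2)])
    moreover have "q ?V = (\<lambda>i. x i + t * (y i - x i))"
      using W W' by (auto simp: q_def fin_integral_convex[OF fW(2) fW'(2)])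
    ultimately show "(\<lambda>i. x i + t * (y i - x i)) \<in> q ` P"
      using imageI[of ?V P q] by (simp only:)
  next
    fix a :: "nat \<Rightarrow> real" assume a: "\<And>i. 0 \<le> a i"
    define \<sigma> :: "nat set \<Rightarrow> nat \<Rightarrow> real" where "\<sigma> \<epsilon> i = (if i \<in> \<epsilon> then 1 else - 1)" for \<epsilon> i
    have "\<exists>k\<in>K. \<eta> * (\<Sum>i<n. a i) \<le> \<bar>\<Sum>i<n. (a i * \<sigma> \<epsilon> i) * z i k\<bar>" for \<epsilon>
    proof -
      have eq: "\<bar>a i * \<sigma> \<epsilon> i\<bar> = a i" for i using a[of i] by (simp add: \<sigma>_def)
      show ?thesis using l1[where n=n and a="\<lambda>i. a i * \<sigma> \<epsilon> i"] by (simp only: eq)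
    qed
    then have "\<forall>\<epsilon>. \<exists>k. k \<in> K \<and> \<eta> * (\<Sum>i<n. a i) \<le> \<bar>\<Sum>i<n. (a i * \<sigma> \<epsilon> i) * z i k\<bar>" by blast
    from choice[OF this] obtain k where
      "\<forall>\<epsilon>. k \<epsilon> \<in> K \<and> \<eta> * (\<Sum>i<n. a i) \<le> \<bar>\<Sum>i<n. (a i * \<sigma> \<epsilon> i) * z i (k \<epsilon>)\<bar>" ..
    then have k: "\<And>\<epsilon>. k \<epsilon> \<in> K"
      "\<And>\<epsilon>. \<eta> * (\<Sum>i<n. a i) \<le> \<bar>\<Sum>i<n. (a i * \<sigma> \<epsilon> i) * z i (k \<epsilon>)\<bar>" by simp_all
    \<comment> \<open>The last component records the sign of the sum at the chosen point, so that
      the products with \<open>rad i\<close> add up to its absolute value.\<close>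
    define g where "g \<epsilon> = (\<epsilon>, k \<epsilon>, 0 \<le> (\<Sum>i<n. (a i * \<sigma> \<epsilon> i) * z i (k \<epsilon>)))" for \<epsilon>
    let ?G = "g ` Pow {..<n}"
    define W where "W = (\<lambda>\<omega>. if \<omega> \<in> ?G then 1 / 2 ^ n else (0::real))"
    have inj: "inj_on g (Pow {..<n})" by (auto simp: inj_on_def g_def)
    have supp: "{\<omega>. W \<omega> \<noteq> 0} = ?G" by (auto simp: W_def)
    have int: "fin_integral W h = (\<Sum>\<epsilon>\<in>Pow {..<n}. h (g \<epsilon>)) / 2 ^ n" for h
    proof -
      have "fin_integral W h = (\<Sum>\<omega>\<in>?G. h \<omega> / 2 ^ n)"
        unfolding fin_integral_def supp by (rule sum.cong) (auto simp: W_def)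
      also have "\<dots> = (\<Sum>\<epsilon>\<in>Pow {..<n}. h (g \<epsilon>) / 2 ^ n)" using inj by (simp add: sum.reindex)
      finally show ?thesis by (simp add: sum_divide_distrib)
    qed
    have "fin_prob ?X W"
      unfolding fin_prob_def int supp by (auto simp: W_def g_def pt_def k card_Pow)
    moreover have "fin_integral W (\<lambda>\<omega>. rad i \<omega> * rad j \<omega>) = 0" if "i < n" "j < n" "i \<noteq> j" for i j
    proof -
      \<comment> \<open>The sign attached to the point enters both factors and cancels.\<close>
      have "(\<Sum>\<epsilon>\<in>Pow {..<n}. rad i (g \<epsilon>) * rad j (g \<epsilon>))
        = (\<Sum>\<epsilon>\<in>Pow {..<n}. (if i \<in> \<epsilon> then 1 else - 1) * (if j \<in> \<epsilon> then 1 else - 1 :: real))"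
        by (intro sum.cong) (auto simp: rad_def g_def)
      then show ?thesis using sum_sign_products[OF that(1,3)] by (simp add: int)
    qed
    ultimately have "W \<in> P" by (simp add: P_def)
    moreover have "\<eta> * (\<Sum>i<n. a i) \<le> (\<Sum>i<n. a i * q W i)"
    proof -
      have "\<eta> * (\<Sum>i<n. a i) = (\<Sum>\<epsilon>\<in>Pow {..<n}. \<eta> * (\<Sum>i<n. a i)) / 2 ^ n"
        by (simp add: card_Pow)
      also have "\<dots> \<le> (\<Sum>\<epsilon>\<in>Pow {..<n}. \<bar>\<Sum>i<n. (a i * \<sigma> \<epsilon> i) * z i (k \<epsilon>)\<bar>) / 2 ^ n"
        by (intro divide_right_mono sum_mono k) auto
      also have "\<dots> = (\<Sum>\<epsilon>\<in>Pow {..<n}. \<Sum>i<n. a i * (z i (pt (g \<epsilon>)) * rad i (g \<epsilon>))) / 2 ^ n"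
      proof (intro arg_cong[of _ _ "\<lambda>x. x / 2 ^ n"] sum.cong refl)
        fix \<epsilon>
        have "\<bar>\<Sum>i<n. (a i * \<sigma> \<epsilon> i) * z i (k \<epsilon>)\<bar>
          = (if snd (snd (g \<epsilon>)) then 1 else - 1) * (\<Sum>i<n. (a i * \<sigma> \<epsilon> i) * z i (k \<epsilon>))"
          by (auto simp: g_def)
        also have "\<dots> = (\<Sum>i<n. a i * (z i (pt (g \<epsilon>)) * rad i (g \<epsilon>)))"
          unfolding sum_distrib_left
          by (intro sum.cong refl) (auto simp: g_def rad_def pt_def \<sigma>_def)
        finally show "\<bar>\<Sum>i<n. (a i * \<sigma> \<epsilon> i) * z i (k \<epsilon>)\<bar>
          = (\<Sum>i<n. a i * (z i (pt (g \<epsilon>)) * rad i (g \<epsilon>)))" .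
      qed
      also have "\<dots> = (\<Sum>i<n. \<Sum>\<epsilon>\<in>Pow {..<n}. a i * (z i (pt (g \<epsilon>)) * rad i (g \<epsilon>))) / 2 ^ n"
        by (subst sum.swap) simp
      also have "\<dots> = (\<Sum>i<n. a i * q W i)"
        by (simp add: q_def int sum_divide_distrib sum_distrib_left)
      finally show ?thesis .
    qed
    ultimately show "\<exists>x\<in>q ` P. \<eta> * (\<Sum>i<n. a i) \<le> (\<Sum>i<n. a i * x i)" by blast
  qed
  then show ?thesis by (auto simp: P_def q_def)
qed

text \<open>Sequences of signed measures of finite support and total variation at most 1; their
  generalized limits are the norming functionals.\<close>

definition sub_mass :: "'a set \<Rightarrow> (nat \<Rightarrow> 'a \<Rightarrow> real) \<Rightarrow> bool" where
  "sub_mass K \<mu> \<longleftrightarrow> (\<forall>n. finite {t. \<mu> n t \<noteq> 0} \<and> {t. \<mu> n t \<noteq> 0} \<subseteq> K \<and> (\<Sum>t | \<mu> n t \<noteq> 0. \<bar>\<mu> n t\<bar>) \<le> 1)"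

context generalized_limit begin

definition limit_integral :: "(nat \<Rightarrow> 'a \<Rightarrow> real) \<Rightarrow> ('a \<Rightarrow> real) \<Rightarrow> real" where
  "limit_integral \<mu> x = Ulim (\<lambda>n. fin_integral (\<mu> n) x)"

lemma limit_integral_functional:
  assumes "\<And>n. fin_prob X (W n)"
  shows "positive_functional X (limit_integral W)"
proof
  fix u v :: "'a \<Rightarrow> real" and c
  have b: "bdd_on UNIV (\<lambda>n. fin_integral (W n) u)" if "bdd_on X u" for u
  proof -
    obtain C where C: "\<And>x. x \<in> X \<Longrightarrow> \<bar>u x\<bar> \<le> C" using \<open>bdd_on X u\<close> by (auto simp: bdd_on_def)
    show ?thesis by (rule bdd_onI, rule fin_integral_bound[OF assms C])
  qed
  assume u: "bdd_on X u"
  have "fin_integral (W n) (\<lambda>x. c * u x) = c * fin_integral (W n) u" for n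
    by (simp add: fin_integral_def sum_distrib_left mult_ac)
  then show "limit_integral W (\<lambda>x. c * u x) = c * limit_integral W u"
    using scale[OF b[OF u]] by (simp add: limit_integral_def)
  show "0 \<le> limit_integral W u" if "\<And>x. x \<in> X \<Longrightarrow> 0 \<le> u x"
    unfolding limit_integral_def
  proof (rule nonneg[OF b[OF u]])
    fix n
    show "0 \<le> fin_integral (W n) u" unfolding fin_integral_def
      using assms[of n] that by (intro sum_nonneg mult_nonneg_nonneg) (auto simp: fin_prob_def)
  qed
  assume v: "bdd_on X v"
  have "fin_integral (W n) (\<lambda>x. u x + v x) = fin_integral (W n) u + fin_integral (W n) v" for n
    by (simp add: fin_integral_def distrib_left sum.distrib)
  then show "limit_integral W (\<lambda>x. u x + v x) = limit_integral W u + limit_integral W v"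
    using add[OF b[OF u] b[OF v]] by (simp add: limit_integral_def)
qed

text \<open>Read contrapositively, \<open>polar\<close> says that a functional of norm at most 1
  with value at least \<open>\<eta> / 2\<close> at some \<open>z i\<close> exceeds
  \<open>\<delta>\<close> on some member of \<open>F\<close>. It is applied to integration against
  \<open>rad i\<close> under the limit of the balanced probabilities \<open>W n\<close>, so the
  resulting members of \<open>F\<close> correlate with orthogonal signs.\<close>

lemma independent_of_l1:
  fixes z :: "nat \<Rightarrow> 'a \<Rightarrow> real" and F :: "('a \<Rightarrow> real) set"
  assumes z: "\<And>i k. k \<in> K \<Longrightarrow> \<bar>z i k\<bar> \<le> C"
    and l1: "\<And>n a. \<exists>k\<in>K. \<eta> * (\<Sum>i<n. \<bar>a i\<bar>) \<le> \<bar>\<Sum>i<n. a i * z i k\<bar>"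
    and "0 < \<eta>" "0 < \<delta>"
    and F: "\<And>f k. f \<in> F \<Longrightarrow> k \<in> K \<Longrightarrow> \<bar>f k\<bar> \<le> 1"
    and polar: "\<And>\<mu> i. sub_mass K \<mu> \<Longrightarrow> (\<And>f. f \<in> F \<Longrightarrow> \<bar>limit_integral \<mu> f\<bar> \<le> \<delta>) \<Longrightarrow>
       \<bar>limit_integral \<mu> (z i)\<bar> < \<eta> / 2"
  shows "\<exists>h p q. (\<forall>i. h i \<in> F) \<and> indep_seq K h p q"
proof -
  let ?X = "{\<omega>::nat set \<times> 'a \<times> bool. pt \<omega> \<in> K}"
  have "\<forall>n. \<exists>W. fin_prob ?X W \<and>
    (\<forall>i<n. \<eta> / 2 \<le> fin_integral W (\<lambda>\<omega>. z i (pt \<omega>) * rad i \<omega>)) \<and>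
    (\<forall>i<n. \<forall>j<n. i \<noteq> j \<longrightarrow> fin_integral W (\<lambda>\<omega>. rad i \<omega> * rad j \<omega>) = 0)"
    using sup_l1_balanced[OF z l1 \<open>0 < \<eta>\<close>] by blast
  from choice[OF this] obtain W where W_all: "\<forall>n. fin_prob ?X (W n) \<and>
    (\<forall>i<n. \<eta> / 2 \<le> fin_integral (W n) (\<lambda>\<omega>. z i (pt \<omega>) * rad i \<omega>)) \<and>
    (\<forall>i<n. \<forall>j<n. i \<noteq> j \<longrightarrow> fin_integral (W n) (\<lambda>\<omega>. rad i \<omega> * rad j \<omega>) = 0)" ..
  have W: "\<And>n. fin_prob ?X (W n)"
    "\<And>n i. i < n \<Longrightarrow> \<eta> / 2 \<le> fin_integral (W n) (\<lambda>\<omega>. z i (pt \<omega>) * rad i \<omega>)"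
    "\<And>n i j. i < n \<Longrightarrow> j < n \<Longrightarrow> i \<noteq> j \<Longrightarrow> fin_integral (W n) (\<lambda>\<omega>. rad i \<omega> * rad j \<omega>) = 0"
    using W_all by simp_all
  let ?\<Lambda> = "limit_integral W"
  interpret L: positive_functional ?X ?\<Lambda> by (rule limit_integral_functional[OF W(1)])
  interpret L: functional_with_limit ?X ?\<Lambda> Ulim ..
  have bd: "bdd_on UNIV (\<lambda>n. fin_integral (W n) h)" if "\<And>\<omega>. \<omega> \<in> ?X \<Longrightarrow> \<bar>h \<omega>\<bar> \<le> D" for h D
    by (rule bdd_onI, rule fin_integral_bound[OF W(1) that])
  have one: "?\<Lambda> (\<lambda>x. 1) \<le> 1"
    using W(1) by (simp add: limit_integral_def fin_prob_def)
  \<comment> \<open>\<open>W n\<close> is balanced only for indices below \<open>n\<close>; the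
    generalized limit ignores the early terms.\<close>
  have orth: "?\<Lambda> (\<lambda>\<omega>. rad i \<omega> * rad j \<omega>) = 0" if "i \<noteq> j" for i j
  proof -
    let ?x = "\<lambda>n. fin_integral (W n) (\<lambda>\<omega>. rad i \<omega> * rad j \<omega>)"
    have b: "bdd_on UNIV ?x" by (rule bd[of _ 1]) (simp add: abs_mult)
    have ev: "\<forall>\<^sub>F n in sequentially. ?x n = 0"
      using W(3) that by (intro eventually_sequentiallyI[of "Suc (max i j)"]) auto
    have "0 \<le> Ulim ?x" using b by (rule Ulim_ge) (rule eventually_mono[OF ev], simp)
    moreover have "0 \<le> Ulim (\<lambda>n. - ?x n)"
      by (rule Ulim_ge[OF bdd_on_uminus[OF b]]) (rule eventually_mono[OF ev], simp)
    ultimately show ?thesis using minus[OF b] by (simp add: limit_integral_def)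
  qed
  \<comment> \<open>The push-forward under \<open>pt\<close> of \<open>W n\<close> weighted by
    \<open>rad i\<close>: it turns a correlation on the sample space into a functional on functions
    of the point.\<close>
  define \<mu> where "\<mu> i n t = (\<Sum>\<omega> | W n \<omega> \<noteq> 0 \<and> pt \<omega> = t. W n \<omega> * rad i \<omega>)" for i n t
  have finW: "finite {\<omega>. W n \<omega> \<noteq> 0}" "\<And>\<omega>. W n \<omega> \<noteq> 0 \<Longrightarrow> pt \<omega> \<in> K" for n
    using W(1)[of n] by (auto simp: fin_prob_def)
  have supp: "{t. \<mu> i n t \<noteq> 0} \<subseteq> pt ` {\<omega>. W n \<omega> \<noteq> 0}" for i n
  proof
    fix t assume "t \<in> {t. \<mu> i n t \<noteq> 0}"
    then have "{\<omega>. W n \<omega> \<noteq> 0 \<and> pt \<omega> = t} \<noteq> {}"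
      unfolding \<mu>_def mem_Collect_eq by (metis sum.empty)
    then show "t \<in> pt ` {\<omega>. W n \<omega> \<noteq> 0}" by blast
  qed
  have \<mu>_int: "fin_integral (\<mu> i n) x = fin_integral (W n) (\<lambda>\<omega>. x (pt \<omega>) * rad i \<omega>)" for i n x
  proof -
    have "fin_integral (\<mu> i n) x = (\<Sum>t\<in>pt ` {\<omega>. W n \<omega> \<noteq> 0}. \<mu> i n t * x t)"
      using supp finW by (intro fin_integral_superset) auto
    also have "\<dots> = (\<Sum>t\<in>pt ` {\<omega>. W n \<omega> \<noteq> 0}. \<Sum>\<omega> | \<omega> \<in> {\<omega>. W n \<omega> \<noteq> 0} \<and> pt \<omega> = t.
        W n \<omega> * (x (pt \<omega>) * rad i \<omega>))"
    proof (rule sum.cong[OF refl])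
      fix t
      show "\<mu> i n t * x t = (\<Sum>\<omega> | \<omega> \<in> {\<omega>. W n \<omega> \<noteq> 0} \<and> pt \<omega> = t. W n \<omega> * (x (pt \<omega>) * rad i \<omega>))"
        unfolding \<mu>_def sum_distrib_right mem_Collect_eq
        by (rule sum.cong[OF refl]) (simp only: mem_Collect_eq mult_ac)
    qed
    also have "\<dots> = fin_integral (W n) (\<lambda>\<omega>. x (pt \<omega>) * rad i \<omega>)"
      unfolding fin_integral_def using finW(1) by (rule sum.image_gen[symmetric])
    finally show ?thesis .
  qed
  have limit_\<mu>: "limit_integral (\<mu> i) x = ?\<Lambda> (\<lambda>\<omega>. x (pt \<omega>) * rad i \<omega>)" for i x
    by (simp add: limit_integral_def \<mu>_int)
  have mass: "sub_mass K (\<mu> i)" for i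
    unfolding sub_mass_def
  proof (intro allI conjI)
    fix n
    show "finite {t. \<mu> i n t \<noteq> 0}" using supp finW finite_subset by blast
    show "{t. \<mu> i n t \<noteq> 0} \<subseteq> K" using supp finW by blast
    \<comment> \<open>Total variation is the integral against the sign of \<open>\<mu> i n\<close>,
      which pulls back to a function bounded by 1 on the sample space.\<close>
    have "(\<Sum>t | \<mu> i n t \<noteq> 0. \<bar>\<mu> i n t\<bar>) = fin_integral (\<mu> i n) (\<lambda>t. sgn (\<mu> i n t))"
      unfolding fin_integral_def by (simp add: abs_sgn mult.commute)
    also have "\<dots> \<le> \<bar>fin_integral (W n) (\<lambda>\<omega>. sgn (\<mu> i n (pt \<omega>)) * rad i \<omega>)\<bar>"
      unfolding \<mu>_int by simp
    also have "\<dots> \<le> 1"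
      using W(1) by (rule fin_integral_bound) (simp add: abs_mult abs_sgn_eq)
    finally show "(\<Sum>t | \<mu> i n t \<noteq> 0. \<bar>\<mu> i n t\<bar>) \<le> 1" .
  qed
  have "\<exists>f\<in>F. \<delta> \<le> \<bar>limit_integral (\<mu> i) f\<bar>" for i
  proof (rule ccontr)
    assume "\<not> ?thesis"
    then have "\<bar>limit_integral (\<mu> i) (z i)\<bar> < \<eta> / 2" using mass by (intro polar) auto
    moreover have "\<eta> / 2 \<le> limit_integral (\<mu> i) (z i)"
      unfolding limit_integral_def \<mu>_int
    proof (rule Ulim_ge)
      show "bdd_on UNIV (\<lambda>n. fin_integral (W n) (\<lambda>\<omega>. z i (pt \<omega>) * rad i \<omega>))"
        by (rule bd[of _ C]) (simp add: abs_mult z)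
      show "\<forall>\<^sub>F n in sequentially. \<eta> / 2 \<le> fin_integral (W n) (\<lambda>\<omega>. z i (pt \<omega>) * rad i \<omega>)"
        using W(2) by (intro eventually_sequentiallyI[of "Suc i"]) auto
    qed
    ultimately show False by linarith
  qed
  then obtain f where f: "\<And>i. f i \<in> F" "\<And>i. \<delta> \<le> \<bar>limit_integral (\<mu> i) (f i)\<bar>" by metis
  have "\<exists>n p q. strict_mono (n :: nat \<Rightarrow> nat) \<and> indep_seq ?X (\<lambda>i \<omega>. f (n i) (pt \<omega>)) p q"
    using f F by (intro L.orthogonal_correlated_independent[of rad, where \<delta>=\<delta>])
      (auto simp: one orth \<open>0 < \<delta>\<close> limit_\<mu>)
  then obtain n p q where n: "indep_seq ?X (\<lambda>i \<omega>. f (n i) (pt \<omega>)) p q" by blast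
  have "indep_seq K (\<lambda>i. f (n i)) p q"
    using n unfolding indep_seq_def by blast
  then show ?thesis
    using f(1) by (intro exI[of _ "\<lambda>i. f (n i)"] exI[of _ p] exI[of _ q]) simp
qed

end

section \<open>Realizing a compact space in a dual space\<close>

text \<open>The map \<open>x \<mapsto> E x\<close> is a continuous injection of a compact space into
  a Hausdorff space, hence a homeomorphism onto its image. It is restricted to \<open>V\<close>
  because \<open>dual_space\<close> consists of extensional functions.\<close>

lemma weakly_RN_viaI:
  fixes E :: "'t \<Rightarrow> 'v::real_normed_vector \<Rightarrow> real"
  assumes T: "compact_space T" and V: "banach_subspace V" "\<not> contains_l1 V"
    and add: "\<And>x u v. x \<in> topspace T \<Longrightarrow> u \<in> V \<Longrightarrow> v \<in> V \<Longrightarrow> E x (u + v) = E x u + E x v"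
    and scale: "\<And>x c v. x \<in> topspace T \<Longrightarrow> v \<in> V \<Longrightarrow> E x (c *\<^sub>R v) = c * E x v"
    and bound: "\<And>x v. x \<in> topspace T \<Longrightarrow> v \<in> V \<Longrightarrow> \<bar>E x v\<bar> \<le> norm v"
    and cont: "\<And>v. v \<in> V \<Longrightarrow> continuous_map T euclideanreal (\<lambda>x. E x v)"
    and sep: "\<And>x y. x \<in> topspace T \<Longrightarrow> y \<in> topspace T \<Longrightarrow> x \<noteq> y \<Longrightarrow> \<exists>v\<in>V. E x v \<noteq> E y v"
  shows "weakly_RN_via T V"
proof -
  define g where "g x = restrict (E x) V" for x
  have subV: "subspace V" using V by (simp add: banach_subspace_def)
  have gD: "g x \<in> dual_space V" if "x \<in> topspace T" for x
    unfolding dual_space_def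
  proof (intro CollectI conjI)
    show "\<exists>B. \<forall>v\<in>V. \<bar>g x v\<bar> \<le> B * norm v"
      using bound[OF that] by (intro exI[of _ 1]) (simp add: g_def)
  qed (use that in \<open>auto simp: g_def add scale subspace_add[OF subV] subspace_scale[OF subV]\<close>)
  have g: "continuous_map T (weak_star V) g"
    unfolding weak_star_def
  proof (rule continuous_map_into_subtopology)
    show "continuous_map T (product_topology (\<lambda>_. euclideanreal) V) g"
      unfolding continuous_map_componentwise using cont by (auto simp: g_def)
  qed (use gD in auto)
  let ?S = "g ` topspace T"
  have S: "compactin (weak_star V) ?S"
    using T g image_compactin unfolding compact_space_def by blast
  have H: "Hausdorff_space (subtopology (weak_star V) ?S)"
    unfolding weak_star_def by (intro Hausdorff_space_subtopology) (simp add: Hausdorff_space_product_topology)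
  have top: "topspace (subtopology (weak_star V) ?S) = ?S"
    using S compactin_subset_topspace by fastforce
  have "homeomorphic_map T (subtopology (weak_star V) ?S) g"
  proof (rule continuous_imp_homeomorphic_map)
    show "continuous_map T (subtopology (weak_star V) ?S) g"
      using g by (intro continuous_map_into_subtopology) auto
    show "inj_on g (topspace T)"
    proof (rule inj_onI, rule ccontr)
      fix x y assume xy: "x \<in> topspace T" "y \<in> topspace T" "g x = g y" "x \<noteq> y"
      then obtain v where v: "v \<in> V" "E x v \<noteq> E y v" using sep by blast
      then show False using fun_cong[OF xy(3), of v] by (simp add: g_def)
    qed
  qed (use T H top in auto)
  then have "T homeomorphic_space subtopology (weak_star V) ?S"
    by (rule homeomorphic_map_imp_homeomorphic_space)
  then show ?thesis using V S unfolding weakly_RN_via_def by blast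
qed

text \<open>A sequence of real functions is determined by the rationals below its values, so
  \<open>(k, \<mu>)\<close> becomes a set of tuples of three countable entries and one point; for
  infinite \<open>'t\<close> these tuples inject into \<open>'t\<close>.\<close>

lemma ex_index_injection:
  assumes inf: "infinite (UNIV :: 't set)"
  shows "\<exists>\<iota> :: nat \<times> (nat \<Rightarrow> 't \<Rightarrow> real) \<Rightarrow> 't set. inj \<iota>"
proof -
  obtain h :: "nat \<Rightarrow> 't" where h: "inj h" using infinite_countable_subset[OF inf] by blast
  have "\<exists>g :: 't \<times> 't \<Rightarrow> 't. inj_on g (UNIV \<times> UNIV) \<and> g ` (UNIV \<times> UNIV) \<subseteq> UNIV"
    unfolding card_of_ordLeq
    using card_of_Times_same_infinite[OF inf] ordIso_iff_ordLeq by blast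
  then obtain g :: "'t \<times> 't \<Rightarrow> 't" where g: "inj g" by auto
  define j where "j = (\<lambda>(k :: nat, n :: nat, q :: rat, t). g (h (to_nat (k, n, q)), t))"
  have j: "inj j"
    by (rule injI) (auto simp: j_def inj_eq[OF g] inj_eq[OF h] inj_eq[OF inj_to_nat])
  define R where "R = (\<lambda>(k :: nat, \<mu> :: nat \<Rightarrow> 't \<Rightarrow> real). {(k, n, q, t) | n q t. of_rat q < \<mu> n t})"
  have "inj R"
  proof (rule injI)
    fix a b assume ab: "R a = R b"
    obtain k \<mu> k' \<mu>' where [simp]: "a = (k, \<mu>)" "b = (k', \<mu>')" by (metis surj_pair)
    have mem: "(i, n, q, t) \<in> R (l, \<nu>) \<longleftrightarrow> i = l \<and> of_rat q < \<nu> n t" for i l n q t \<nu>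
      by (auto simp: R_def)
    \<comment> \<open>A rational below one of the values shows that the coded set is nonempty, so
      \<open>k\<close> can be read off.\<close>
    obtain q where "real_of_rat q < \<mu> 0 undefined" using of_rat_dense[of "\<mu> 0 undefined - 1" "\<mu> 0 undefined"] by auto
    then have "(k, 0, q, undefined) \<in> R (k, \<mu>)" by (simp add: mem)
    then have "(k, 0, q, undefined) \<in> R (k', \<mu>')" using ab by simp
    then have k: "k = k'" by (simp add: mem)
    have eq: "of_rat q < \<mu> n t \<longleftrightarrow> of_rat q < \<mu>' n t" for q n t
      using ab mem[of k n q t k \<mu>] mem[of k n q t k' \<mu>'] k by simp
    have "\<mu> n t = \<mu>' n t" for n t
    proof (rule ccontr)
      assume "\<mu> n t \<noteq> \<mu>' n t"
      then obtain q where "(\<mu> n t < of_rat q \<and> of_rat q < \<mu>' n t) \<or> (\<mu>' n t < of_rat q \<and> of_rat q < \<mu> n t)"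
        by (metis linorder_neqE_linordered_idom of_rat_dense)
      then show False using eq[of q n t] by auto
    qed
    then show "a = b" using k by auto
  qed
  then have "inj (\<lambda>p. j ` R p)"
    using inj_image_eq_iff[OF j] by (auto simp: inj_def)
  then show ?thesis by blast
qed

text \<open>The lower l1 estimate makes the \<open>x i\<close> linearly independent, too many for a
  finite spanning set.\<close>

lemma finite_dim_not_contains_l1:
  assumes B: "finite B" and V: "V \<subseteq> span B"
  shows "\<not> contains_l1 V"
proof
  assume "contains_l1 V"
  then obtain x c where x_all: "(\<forall>n. x n \<in> V) \<and> 0 < c \<and>
    (\<forall>(a :: nat \<Rightarrow> real) N. c * (\<Sum>i<N. \<bar>a i\<bar>) \<le> norm (\<Sum>i<N. a i *\<^sub>R x i))"
    unfolding contains_l1_def by (elim exE conjE) simp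
  then have x: "\<And>n. x n \<in> V" "0 < c"
    "\<And>(a :: nat \<Rightarrow> real) N. c * (\<Sum>i<N. \<bar>a i\<bar>) \<le> norm (\<Sum>i<N. a i *\<^sub>R x i)"
    by simp_all
  have zero: "a i = 0" if "(\<Sum>i<N. a i *\<^sub>R x i) = 0" "i < N" for a N i
  proof -
    have "c * (\<Sum>i<N. \<bar>a i\<bar>) \<le> 0" using x(3)[where a=a and N=N] that by simp
    then have "(\<Sum>i<N. \<bar>a i\<bar>) \<le> 0" using x(2) by (simp add: mult_le_0_iff)
    then have "(\<Sum>i<N. \<bar>a i\<bar>) = 0" by (intro antisym sum_nonneg) auto
    then have "\<bar>a i\<bar> = 0" using that(2) by (subst (asm) sum_nonneg_eq_0_iff) auto
    then show ?thesis by simp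
  qed
  \<comment> \<open>\<open>independent\<close> is a property of sets and does not see repetitions;
    the coefficients 1 at \<open>i\<close> and -1 at \<open>j\<close> exclude them.\<close>
  have "inj x"
  proof (rule injI, rule ccontr)
    fix i j assume ij: "x i = x j" "i \<noteq> j"
    let ?a = "\<lambda>k. (if k = i then 1 else 0) - (if k = j then 1 else (0::real))"
    have "(\<Sum>k<Suc (max i j). ?a k *\<^sub>R x k)
      = (\<Sum>k<Suc (max i j). (if k = i then x k else 0)) - (\<Sum>k<Suc (max i j). (if k = j then x k else 0))"
      unfolding sum_subtractf[symmetric] by (intro sum.cong) (auto simp: scaleR_diff_left)
    also have "\<dots> = 0" using ij(1) by (simp add: sum.delta less_Suc_eq_le del: sum.lessThan_Suc)
    finally have "?a i = 0" by (rule zero) simp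
    then show False using ij(2) by simp
  qed
  let ?S = "x ` {..<Suc (card B)}"
  have "independent ?S"
  proof
    assume "dependent ?S"
    then obtain u v where u: "v \<in> ?S" "u v \<noteq> 0" "(\<Sum>v\<in>?S. u v *\<^sub>R v) = 0"
      by (subst (asm) dependent_finite) auto
    then obtain i where i: "v = x i" "i < Suc (card B)" by auto
    have "(\<Sum>i<Suc (card B). u (x i) *\<^sub>R x i) = 0"
      using u(3) inj_on_subset[OF \<open>inj x\<close>] by (simp add: sum.reindex del: sum.lessThan_Suc)
    then have "u (x i) = 0" using i(2) by (rule zero)
    then show False using u i by simp
  qed
  moreover have "?S \<subseteq> span B" using x(1) V by auto
  ultimately have "card ?S \<le> card B" using independent_span_bound[OF B] by blast
  moreover have "card ?S = Suc (card B)"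
    using inj_on_subset[OF \<open>inj x\<close>] by (subst card_image) auto
  ultimately show False by simp
qed

section \<open>Bounded functions on a discrete index type, and finite spaces\<close>

lemma continuous_on_discrete_type: "continuous_on UNIV (f :: 'a discrete \<Rightarrow> 'b::topological_space)"
  unfolding continuous_on_open_vimage[OF open_UNIV] by (simp add: open_discrete)

lemma bcontfun_discrete:
  fixes f :: "'a discrete \<Rightarrow> real"
  assumes "\<And>j. \<bar>f j\<bar> \<le> b" shows "f \<in> bcontfun"
  by (rule bcontfun_normI[of _ b]) (use assms in \<open>auto intro: continuous_on_discrete_type\<close>)

lemma bcontfun_sum_apply:
  fixes f :: "'i \<Rightarrow> 'a::topological_space \<Rightarrow>\<^sub>C 'b::real_normed_vector"
  shows "(\<Sum>i\<in>I. f i) y = (\<Sum>i\<in>I. f i y)"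
  by (induction I rule: infinite_finite_induct) auto

text \<open>A finite Hausdorff space is discrete, so finitely many coordinate functions realize it
  in a finite-dimensional space. They sit in the \<open>nat\<close> summand of the index type, which
  has room for them however small \<open>'s\<close> is.\<close>

lemma weakly_RN_finite:
  fixes T :: "'t topology"
  assumes fin: "finite (topspace T)" and H: "Hausdorff_space T"
  shows "\<exists>V :: ((nat + 's) discrete \<Rightarrow>\<^sub>C real) set. weakly_RN_via T V"
proof -
  obtain e n where e: "bij_betw e (topspace T) {..<n::nat}"
    using ex_bij_betw_finite_nat[OF fin] by (auto simp: atLeast0LessThan)
  let ?d = "\<lambda>i. discrete (Inl i) :: (nat + 's) discrete"
  define V where "V = {v :: (nat + 's) discrete \<Rightarrow>\<^sub>C real. \<forall>j. j \<notin> ?d ` {..<n} \<longrightarrow> v j = 0}"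
  define b where "b i = Bcontfun (\<lambda>j. if j = ?d i then 1 else 0 :: real)" for i
  have b: "b i j = (if j = ?d i then 1 else 0)" for i j
    unfolding b_def by (subst Bcontfun_inverse) (auto intro!: bcontfun_discrete[of _ 1])
  have bV: "b i \<in> V" if "i < n" for i using that by (auto simp: V_def b)
  have sub: "subspace V" by (auto simp: V_def subspace_def)
  have "closed V"
  proof -
    have "V = (\<Inter>j\<in>- ?d ` {..<n}. {v :: (nat + 's) discrete \<Rightarrow>\<^sub>C real. v j = 0})" by (auto simp: V_def)
    moreover have "closed {v :: (nat + 's) discrete \<Rightarrow>\<^sub>C real. v j = 0}" for j
    proof -
      have "{v :: (nat + 's) discrete \<Rightarrow>\<^sub>C real. v j = 0} = (\<lambda>v. apply_bcontfun v j) -` {0}" by auto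
      moreover have "continuous_on UNIV (\<lambda>v :: (nat + 's) discrete \<Rightarrow>\<^sub>C real. v j)"
        unfolding continuous_on_iff by (metis dist_fun_lt_imp_dist_val_lt)
      ultimately show ?thesis by (metis closed_vimage closed_singleton)
    qed
    ultimately show ?thesis by auto
  qed
  have "V \<subseteq> span (b ` {..<n})"
  proof
    fix v assume v: "v \<in> V"
    have "v = (\<Sum>i<n. v (?d i) *\<^sub>R b i)"
    proof (rule bcontfun_eqI)
      fix j
      show "v j = (\<Sum>i<n. v (?d i) *\<^sub>R b i) j"
      proof (cases "j \<in> ?d ` {..<n}")
        case True
        then obtain k where k: "k < n" "j = ?d k" by auto
        have "(\<Sum>i<n. v (?d i) * b i j) = (\<Sum>i<n. if i = k then v (?d i) else 0)"
          by (intro sum.cong) (auto simp: b k discrete_inject)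
        then show ?thesis using k by (simp add: bcontfun_sum_apply)
      next
        case False
        then have "(\<Sum>i<n. v (?d i) * b i j) = 0" by (intro sum.neutral) (auto simp: b)
        then show ?thesis using False v by (simp add: bcontfun_sum_apply V_def)
      qed
    qed
    also have "\<dots> \<in> span (b ` {..<n})" by (intro span_sum span_scale span_base) auto
    finally show "v \<in> span (b ` {..<n})" .
  qed
  then have nl1: "\<not> contains_l1 V" by (intro finite_dim_not_contains_l1[of "b ` {..<n}"]) auto
  have "weakly_RN_via T V"
  proof (rule weakly_RN_viaI[where E="\<lambda>x v. apply_bcontfun v (?d (e x))"])
    show "compact_space T" using fin finite_imp_compactin[of "topspace T" T] by (simp add: compact_space_def)
    show "banach_subspace V" using sub \<open>closed V\<close> by (simp add: banach_subspace_def complete_eq_closed)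
    show "\<not> contains_l1 V" by (fact nl1)
    have "T = discrete_topology (topspace T)"
      using fin H Hausdorff_imp_t1_space finite_t1_space_imp_discrete_topology by blast
    then show "continuous_map T euclideanreal (\<lambda>x. v (?d (e x)))" for v :: "(nat + 's) discrete \<Rightarrow>\<^sub>C real"
      by (metis continuous_map_from_discrete_topology Pi_UNIV UNIV_I topspace_euclidean)
    show "\<exists>v\<in>V. v (?d (e x)) \<noteq> v (?d (e y))"
      if "x \<in> topspace T" "y \<in> topspace T" "x \<noteq> y" for x y
    proof (rule bexI[of _ "b (e x)"])
      have "e x \<noteq> e y" using e that by (auto simp: bij_betw_def inj_on_def)
      then show "b (e x) (?d (e x)) \<noteq> b (e x) (?d (e y))" by (simp add: b discrete_inject)
      show "b (e x) \<in> V" using e that by (intro bV) (auto simp: bij_betw_def)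
    qed
    show "\<bar>v (?d (e x))\<bar> \<le> norm v" for v :: "(nat + 's) discrete \<Rightarrow>\<^sub>C real" and x
      using norm_bounded[of v] by simp
  qed auto
  then show ?thesis by blast
qed

section \<open>The interpolation space\<close>

lemma sub_mass_fin_integral_le:
  assumes "sub_mass K \<mu>" "0 \<le> C" "\<And>t. t \<in> K \<Longrightarrow> \<bar>x t\<bar> \<le> C"
  shows "\<bar>fin_integral (\<mu> n) x\<bar> \<le> C"
proof -
  have "\<bar>fin_integral (\<mu> n) x\<bar> \<le> (\<Sum>t | \<mu> n t \<noteq> 0. \<bar>\<mu> n t * x t\<bar>)"
    unfolding fin_integral_def by (rule sum_abs)
  also have "\<dots> \<le> (\<Sum>t | \<mu> n t \<noteq> 0. \<bar>\<mu> n t\<bar> * C)"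
    using assms by (intro sum_mono) (auto simp: sub_mass_def abs_mult intro!: mult_left_mono)
  also have "\<dots> = (\<Sum>t | \<mu> n t \<noteq> 0. \<bar>\<mu> n t\<bar>) * C" by (simp add: sum_distrib_right)
  also have "\<dots> \<le> 1 * C" using assms by (intro mult_right_mono) (auto simp: sub_mass_def)
  finally show ?thesis by simp
qed

definition point_mass :: "'a \<Rightarrow> nat \<Rightarrow> 'a \<Rightarrow> real" where
  "point_mass x n t = (if t = x then 1 else 0)"

lemma fin_integral_point_mass: "fin_integral (point_mass x n) h = h x"
proof -
  have "{t. point_mass x n t \<noteq> 0} = {x}" by (auto simp: point_mass_def)
  then show ?thesis by (simp add: fin_integral_def) (simp add: point_mass_def)
qed

lemma sub_mass_point_mass: "sub_mass K (point_mass x) \<longleftrightarrow> x \<in> K"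
proof -
  have "{t. point_mass x n t \<noteq> 0} = {x}" for n by (auto simp: point_mass_def)
  then show ?thesis by (simp add: sub_mass_def) (simp add: point_mass_def)
qed

context generalized_limit begin

lemma limit_integral_le:
  assumes "sub_mass K \<mu>" "0 \<le> C" "\<And>t. t \<in> K \<Longrightarrow> \<bar>x t\<bar> \<le> C"
  shows "\<bar>limit_integral \<mu> x\<bar> \<le> C"
  unfolding limit_integral_def by (rule Ulim_abs_le, rule sub_mass_fin_integral_le[OF assms])

lemma limit_integral_cong:
  assumes "sub_mass K \<mu>" "\<And>t. t \<in> K \<Longrightarrow> x t = y t"
  shows "limit_integral \<mu> x = limit_integral \<mu> y"
proof -
  have "fin_integral (\<mu> n) x = fin_integral (\<mu> n) y" for n
    unfolding fin_integral_def using assms by (intro sum.cong) (auto simp: sub_mass_def)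
  then show ?thesis by (simp add: limit_integral_def)
qed

lemma bdd_fin_integral:
  assumes "sub_mass K \<mu>" "bdd_on K x" shows "bdd_on UNIV (\<lambda>n. fin_integral (\<mu> n) x)"
proof -
  obtain C where C: "\<And>t. t \<in> K \<Longrightarrow> \<bar>x t\<bar> \<le> C" using assms by (auto simp: bdd_on_def)
  show ?thesis
  proof (rule bdd_onI, rule sub_mass_fin_integral_le[OF assms(1)])
    show "\<bar>x t\<bar> \<le> max 0 C" if "t \<in> K" for t using C[OF that] by simp
  qed simp
qed

lemma limit_integral_add:
  assumes "sub_mass K \<mu>" "bdd_on K x" "bdd_on K y"
  shows "limit_integral \<mu> (\<lambda>t. x t + y t) = limit_integral \<mu> x + limit_integral \<mu> y"
proof -
  have "fin_integral (\<mu> n) (\<lambda>t. x t + y t) = fin_integral (\<mu> n) x + fin_integral (\<mu> n) y" for n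
    by (simp add: fin_integral_def distrib_left sum.distrib)
  then show ?thesis
    unfolding limit_integral_def
    using add[OF bdd_fin_integral[OF assms(1,2)] bdd_fin_integral[OF assms(1,3)]] by simp
qed

lemma limit_integral_scale:
  assumes "sub_mass K \<mu>" "bdd_on K x"
  shows "limit_integral \<mu> (\<lambda>t. c * x t) = c * limit_integral \<mu> x"
proof -
  have "fin_integral (\<mu> n) (\<lambda>t. c * x t) = c * fin_integral (\<mu> n) x" for n
    by (simp add: fin_integral_def sum_distrib_left mult_ac)
  then show ?thesis
    unfolding limit_integral_def
    using scale[OF bdd_fin_integral[OF assms]] by simp
qed

lemma limit_integral_point_mass: "limit_integral (point_mass x) h = h x"
  by (simp add: limit_integral_def fin_integral_point_mass)

end

text \<open>An interpolation space in the style of Davis, Figiel, Johnson and Pelczynski, with a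
  \<open>c\<^sub>0\<close>-sum. Its \<open>k\<close>-th norm is the supremum of \<open>2\<^sup>k\<close> times the functionals of norm at most 1 that
  are at most \<open>4\<^sup>-\<^sup>k\<close> on \<open>F\<close>; only functionals that are limits of finitely supported ones
  are used, so that the space embeds into the bounded functions on the power set of the points.\<close>

locale interpolation_space = generalized_limit Ulim for Ulim +
  fixes T :: "'t topology" and F :: "('t \<Rightarrow> real) set"
    and \<iota> :: "nat \<times> (nat \<Rightarrow> 't \<Rightarrow> real) \<Rightarrow> 't set"
  assumes inj: "inj \<iota>"
    and F_cont: "f \<in> F \<Longrightarrow> continuous_map T euclideanreal f"
    and F_le_1: "f \<in> F \<Longrightarrow> x \<in> topspace T \<Longrightarrow> \<bar>f x\<bar> \<le> 1"
begin

definition pos :: "nat \<Rightarrow> (nat \<Rightarrow> 't \<Rightarrow> real) \<Rightarrow> (nat + 't set) discrete" where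
  "pos k \<mu> = discrete (Inr (\<iota> (k, \<mu>)))"

text \<open>Against the factor \<open>2 ^ k\<close> in \<open>V\<close>, the bound
  \<open>(1/4) ^ k\<close> does two jobs: members of \<open>F\<close> get a \<open>k\<close>-th norm
  of at most \<open>(1/2) ^ k\<close>, tending to 0, while a vector of norm \<open>C\<close> has
  values at most \<open>C * (1/2) ^ k\<close> on functionals admissible for
  \<open>k\<close>.\<close>

definition adm :: "nat \<Rightarrow> (nat \<Rightarrow> 't \<Rightarrow> real) \<Rightarrow> bool" where
  "adm k \<mu> \<longleftrightarrow> sub_mass (topspace T) \<mu> \<and> (\<forall>f\<in>F. \<bar>limit_integral \<mu> f\<bar> \<le> (1/4) ^ k)"

text \<open>At level 0 the bound on \<open>F\<close> is 1, so point masses are admissible and the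
  represented function can be read off there.\<close>

definition ev :: "((nat + 't set) discrete \<Rightarrow>\<^sub>C real) \<Rightarrow> 't \<Rightarrow> real" where
  "ev v x = v (pos 0 (point_mass x))"

definition V :: "((nat + 't set) discrete \<Rightarrow>\<^sub>C real) set" where
  "V = {v. (\<forall>j. (\<forall>k \<mu>. adm k \<mu> \<longrightarrow> j \<noteq> pos k \<mu>) \<longrightarrow> apply_bcontfun v j = 0) \<and>
    (\<forall>k \<mu>. adm k \<mu> \<longrightarrow> apply_bcontfun v (pos k \<mu>) = 2 ^ k * limit_integral \<mu> (ev v)) \<and>
    continuous_map T euclideanreal (ev v) \<and>
    (\<forall>e>0. \<exists>k0. \<forall>k \<mu>. adm k \<mu> \<longrightarrow> k0 \<le> k \<longrightarrow> \<bar>apply_bcontfun v (pos k \<mu>)\<bar> \<le> e)}"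

lemma pos_eq_iff [simp]: "pos k \<mu> = pos l \<nu> \<longleftrightarrow> k = l \<and> \<mu> = \<nu>"
  using inj by (auto simp: pos_def discrete_inject inj_eq)

lemma adm_point_mass: "x \<in> topspace T \<Longrightarrow> adm 0 (point_mass x)"
  by (simp add: adm_def sub_mass_point_mass limit_integral_point_mass F_le_1)

lemma ev_add: "ev (u + v) x = ev u x + ev v x"
  and ev_diff: "ev (u - v) x = ev u x - ev v x"
  and ev_scale: "ev (c *\<^sub>R v) x = c * ev v x"
  by (simp_all add: ev_def)

lemma abs_le_norm: "\<bar>apply_bcontfun v j\<bar> \<le> norm v" for v :: "'a::topological_space \<Rightarrow>\<^sub>C real"
  using norm_bounded[of v j] by simp

lemma ev_le: "\<bar>ev v x\<bar> \<le> norm v"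
  by (simp add: ev_def abs_le_norm)

lemma bdd_ev: "bdd_on K (ev v)"
  using ev_le by (rule bdd_onI)

lemma V_zero: "v \<in> V \<Longrightarrow> (\<And>k \<mu>. adm k \<mu> \<Longrightarrow> j \<noteq> pos k \<mu>) \<Longrightarrow> v j = 0"
  by (simp add: V_def)

lemma V_pos: "v \<in> V \<Longrightarrow> adm k \<mu> \<Longrightarrow> v (pos k \<mu>) = 2 ^ k * limit_integral \<mu> (ev v)"
  by (simp add: V_def)

lemma V_cont: "v \<in> V \<Longrightarrow> continuous_map T euclideanreal (ev v)"
  by (simp add: V_def)

lemma V_vanish:
  assumes "v \<in> V" "0 < e"
  shows "\<exists>k0. \<forall>k \<mu>. adm k \<mu> \<longrightarrow> k0 \<le> k \<longrightarrow> \<bar>apply_bcontfun v (pos k \<mu>)\<bar> \<le> e"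
  using assms(1)[unfolded V_def mem_Collect_eq] assms(2) by blast

lemma subspace_V: "subspace V"
  unfolding subspace_def
proof (intro conjI ballI allI)
  have "ev 0 = (\<lambda>x. 0)" by (simp add: ev_def fun_eq_iff)
  moreover have "limit_integral \<mu> (\<lambda>x. 0) = 0" for \<mu> :: "nat \<Rightarrow> 't \<Rightarrow> real"
    by (simp add: limit_integral_def fin_integral_def)
  ultimately show "0 \<in> V" by (simp add: V_def)
next
  fix u v assume u: "u \<in> V" and v: "v \<in> V"
  have ev: "ev (u + v) = (\<lambda>x. ev u x + ev v x)" by (simp add: ev_add fun_eq_iff)
  show "u + v \<in> V"
    unfolding V_def
  proof (intro CollectI conjI allI impI)
    show "(u + v) j = 0" if "\<forall>k \<mu>. adm k \<mu> \<longrightarrow> j \<noteq> pos k \<mu>" for j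
      using that V_zero[OF u] V_zero[OF v] by simp
    show "(u + v) (pos k \<mu>) = 2 ^ k * limit_integral \<mu> (ev (u + v))" if "adm k \<mu>" for k \<mu>
      using that unfolding ev by (subst limit_integral_add[of "topspace T"])
        (auto simp: V_pos u v bdd_ev distrib_left adm_def)
    show "continuous_map T euclideanreal (ev (u + v))"
      unfolding ev using V_cont[OF u] V_cont[OF v] by (intro continuous_intros)
    fix e :: real assume "0 < e"
    then have e: "0 < e / 2" by simp
    obtain k where k: "\<And>i \<mu>. adm i \<mu> \<Longrightarrow> k \<le> i \<Longrightarrow> \<bar>u (pos i \<mu>)\<bar> \<le> e / 2"
      using V_vanish[OF u e] by blast
    obtain l where l: "\<And>i \<mu>. adm i \<mu> \<Longrightarrow> l \<le> i \<Longrightarrow> \<bar>v (pos i \<mu>)\<bar> \<le> e / 2"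
      using V_vanish[OF v e] by blast
    have "\<bar>(u + v) (pos i \<mu>)\<bar> \<le> e" if "adm i \<mu>" "max k l \<le> i" for i \<mu>
      using k[OF that(1)] l[OF that(1)] that(2) by fastforce
    then show "\<exists>k0. \<forall>k \<mu>. adm k \<mu> \<longrightarrow> k0 \<le> k \<longrightarrow> \<bar>(u + v) (pos k \<mu>)\<bar> \<le> e" by blast
  qed
next
  fix c :: real and v assume v: "v \<in> V"
  have ev: "ev (c *\<^sub>R v) = (\<lambda>x. c * ev v x)" by (simp add: ev_scale fun_eq_iff)
  show "c *\<^sub>R v \<in> V"
    unfolding V_def
  proof (intro CollectI conjI allI impI)
    show "(c *\<^sub>R v) j = 0" if "\<forall>k \<mu>. adm k \<mu> \<longrightarrow> j \<noteq> pos k \<mu>" for j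
      using that V_zero[OF v] by simp
    show "(c *\<^sub>R v) (pos k \<mu>) = 2 ^ k * limit_integral \<mu> (ev (c *\<^sub>R v))" if "adm k \<mu>" for k \<mu>
      using that unfolding ev by (subst limit_integral_scale[of "topspace T"])
        (auto simp: V_pos v bdd_ev adm_def)
    show "continuous_map T euclideanreal (ev (c *\<^sub>R v))"
      unfolding ev using V_cont[OF v] by (intro continuous_intros)
    fix e :: real assume "0 < e"
    then have "0 < e / (1 + \<bar>c\<bar>)" by simp
    then obtain k0 where k0: "\<And>k \<mu>. adm k \<mu> \<Longrightarrow> k0 \<le> k \<Longrightarrow> \<bar>v (pos k \<mu>)\<bar> \<le> e / (1 + \<bar>c\<bar>)"
      using V_vanish[OF v] by blast
    have "\<bar>(c *\<^sub>R v) (pos k \<mu>)\<bar> \<le> e" if "adm k \<mu>" "k0 \<le> k" for k \<mu>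
    proof -
      have "\<bar>c\<bar> * \<bar>v (pos k \<mu>)\<bar> \<le> (1 + \<bar>c\<bar>) * (e / (1 + \<bar>c\<bar>))"
        by (intro mult_mono k0 that) auto
      then show ?thesis by (simp add: abs_mult)
    qed
    then show "\<exists>k0. \<forall>k \<mu>. adm k \<mu> \<longrightarrow> k0 \<le> k \<longrightarrow> \<bar>(c *\<^sub>R v) (pos k \<mu>)\<bar> \<le> e" by blast
  qed
qed

text \<open>Norm convergence is uniform convergence of the tables and of the functions
  \<open>ev\<close>, under which each clause of \<open>V\<close> survives.\<close>

lemma closed_V: "closed V"
  unfolding closed_sequential_limits
proof (intro allI impI, elim conjE)
  fix s v assume s: "\<forall>n. s n \<in> V" and lim: "s \<longlonglongrightarrow> v"
  have close: "\<exists>u\<in>V. norm (u - v) < e" if "0 < e" for e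
    using LIMSEQ_D[OF lim that] s by blast
  have pt: "\<bar>apply_bcontfun v j - apply_bcontfun u j\<bar> \<le> norm (u - v)" for u j
    using abs_le_norm[of "u - v" j] by (simp add: abs_minus_commute)
  have 0: "a = 0" if "\<And>e. 0 < e \<Longrightarrow> \<bar>a\<bar> \<le> e" for a :: real
    using that dense_eq0_I by blast
  show "v \<in> V"
    unfolding V_def
  proof (intro CollectI conjI allI impI)
    fix j assume j: "\<forall>k \<mu>. adm k \<mu> \<longrightarrow> j \<noteq> pos k \<mu>"
    show "v j = 0"
    proof (rule 0)
      fix e :: real assume "0 < e"
      then obtain u where u: "u \<in> V" "norm (u - v) < e" using close by blast
      then show "\<bar>v j\<bar> \<le> e" using pt[of j u] V_zero[OF u(1), of j] j by auto
    qed
  next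
    fix k \<mu> assume a: "adm k \<mu>"
    then have sm: "sub_mass (topspace T) \<mu>" by (simp add: adm_def)
    have "v (pos k \<mu>) - 2 ^ k * limit_integral \<mu> (ev v) = 0"
    proof (rule 0)
      fix e :: real assume "0 < e"
      \<comment> \<open>Passing from \<open>u\<close> to \<open>v\<close> changes the two sides by
        at most \<open>norm (u - v)\<close> and \<open>2 ^ k * norm (u - v)\<close>.\<close>
      then have "0 < e / (1 + 2 ^ k)" by (simp add: add_pos_pos)
      then obtain u where u: "u \<in> V" "norm (u - v) < e / (1 + 2 ^ k)" using close by blast
      have "limit_integral \<mu> (ev (u - v)) = limit_integral \<mu> (ev u) - limit_integral \<mu> (ev v)"
        using limit_integral_add[OF sm bdd_ev bdd_ev, of "u - v" v] by (simp add: ev_diff)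
      moreover have "\<bar>limit_integral \<mu> (ev (u - v))\<bar> \<le> norm (u - v)"
        by (rule limit_integral_le[OF sm]) (auto simp: ev_le)
      ultimately have "\<bar>2 ^ k * limit_integral \<mu> (ev u) - 2 ^ k * limit_integral \<mu> (ev v)\<bar> \<le> 2 ^ k * norm (u - v)"
        by (simp add: abs_mult flip: right_diff_distrib)
      then have "\<bar>v (pos k \<mu>) - 2 ^ k * limit_integral \<mu> (ev v)\<bar> \<le> (1 + 2 ^ k) * norm (u - v)"
        using pt[of "pos k \<mu>" u] V_pos[OF u(1) a] by (simp add: distrib_right)
      also have "\<dots> \<le> (1 + 2 ^ k) * (e / (1 + 2 ^ k))" using u(2) by (intro mult_left_mono) auto
      also have "\<dots> = e" by (simp add: add_pos_pos less_imp_neq[symmetric])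
      finally show "\<bar>v (pos k \<mu>) - 2 ^ k * limit_integral \<mu> (ev v)\<bar> \<le> e" .
    qed
    then show "v (pos k \<mu>) = 2 ^ k * limit_integral \<mu> (ev v)" by simp
  next
    have "continuous_map T (Met_TC.mtopology) (ev v)"
    proof (rule Met_TC.continuous_map_uniform_limit[where f="\<lambda>n. ev (s n)" and F=sequentially])
      show "\<forall>\<^sub>F n in sequentially. continuous_map T Met_TC.mtopology (ev (s n))"
        using V_cont s by simp
      fix e :: real assume "0 < e"
      then obtain N where N: "\<And>n. n \<ge> N \<Longrightarrow> norm (s n - v) < e" using LIMSEQ_D[OF lim] by blast
      have "dist (ev (s n) x) (ev v x) < e" if "n \<ge> N" for n x
        using ev_le[of "s n - v" x] N[OF that] by (simp add: ev_diff dist_real_def)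
      then show "\<forall>\<^sub>F n in sequentially. \<forall>x\<in>topspace T. ev v x \<in> UNIV \<and> dist (ev (s n) x) (ev v x) < e"
        by (auto simp: eventually_sequentially)
    qed simp
    then show "continuous_map T euclideanreal (ev v)" by simp
  next
    fix e :: real assume "0 < e"
    then obtain u where u: "u \<in> V" "norm (u - v) < e / 2" using close half_gt_zero by blast
    obtain k0 where k0: "\<And>k \<mu>. adm k \<mu> \<Longrightarrow> k0 \<le> k \<Longrightarrow> \<bar>u (pos k \<mu>)\<bar> \<le> e / 2"
      using V_vanish[OF u(1)] \<open>0 < e\<close> half_gt_zero by blast
    have "\<bar>v (pos k \<mu>)\<bar> \<le> e" if "adm k \<mu>" "k0 \<le> k" for k \<mu>
      using pt[of "pos k \<mu>" u] u(2) k0[OF that] by linarith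
    then show "\<exists>k0. \<forall>k \<mu>. adm k \<mu> \<longrightarrow> k0 \<le> k \<longrightarrow> \<bar>v (pos k \<mu>)\<bar> \<le> e" by blast
  qed
qed

text \<open>Admissibility bounds the entries of the table of \<open>f\<close> at level
  \<open>k\<close> by \<open>(1/2) ^ k\<close>. The table is well defined because \<open>pos\<close>
  is injective.\<close>

lemma F_in_V:
  assumes f: "f \<in> F" shows "\<exists>v\<in>V. \<forall>x\<in>topspace T. ev v x = f x"
proof -
  define g where "g j = (if \<exists>k \<mu>. adm k \<mu> \<and> j = pos k \<mu>
    then (THE y. \<exists>k \<mu>. adm k \<mu> \<and> j = pos k \<mu> \<and> y = 2 ^ k * limit_integral \<mu> f) else 0)" for j
  have g_pos: "g (pos k \<mu>) = 2 ^ k * limit_integral \<mu> f" if "adm k \<mu>" for k \<mu>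
    using that by (auto simp: g_def)
  have small: "\<bar>2 ^ k * limit_integral \<mu> f\<bar> \<le> (1/2) ^ k" if "adm k \<mu>" for k \<mu>
  proof -
    have "2 ^ k * \<bar>limit_integral \<mu> f\<bar> \<le> 2 ^ k * (1/4) ^ k"
      using that f by (intro mult_left_mono) (auto simp: adm_def)
    also have "\<dots> = (1/2) ^ k" by (simp flip: power_mult_distrib)
    finally show ?thesis by (simp add: abs_mult)
  qed
  have "\<bar>g j\<bar> \<le> 1" for j
  proof (cases "\<exists>k \<mu>. adm k \<mu> \<and> j = pos k \<mu>")
    case True
    then obtain k \<mu> where a: "adm k \<mu>" "j = pos k \<mu>" by blast
    have "(1/2 :: real) ^ k \<le> 1" by (simp add: power_le_one)
    then show ?thesis using small[OF a(1)] g_pos[OF a(1)] a(2) by simp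
  next
    case False
    then have "g j = 0" unfolding g_def by (rule if_not_P)
    then show ?thesis by simp
  qed
  then have "g \<in> bcontfun" by (rule bcontfun_discrete)
  then have app: "apply_bcontfun (Bcontfun g) = g" by (rule Bcontfun_inverse)
  have ev: "ev (Bcontfun g) x = f x" if "x \<in> topspace T" for x
    using g_pos[OF adm_point_mass[OF that]] by (simp add: ev_def app limit_integral_point_mass)
  have "Bcontfun g \<in> V"
    unfolding V_def
  proof (intro CollectI conjI allI impI)
    show "Bcontfun g j = 0" if "\<forall>k \<mu>. adm k \<mu> \<longrightarrow> j \<noteq> pos k \<mu>" for j
      using that by (auto simp: app g_def)
    show "Bcontfun g (pos k \<mu>) = 2 ^ k * limit_integral \<mu> (ev (Bcontfun g))" if a: "adm k \<mu>" for k \<mu>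
      using limit_integral_cong[of "topspace T" \<mu> "ev (Bcontfun g)" f] a ev g_pos[OF a]
      by (simp add: app adm_def)
    show "continuous_map T euclideanreal (ev (Bcontfun g))"
      by (rule continuous_map_eq[OF F_cont[OF f]]) (simp add: ev)
    fix e :: real assume "0 < e"
    obtain k0 where k0: "(1/2 :: real) ^ k0 < e" using real_arch_pow_inv[OF \<open>0 < e\<close>, of "1/2"] by auto
    have "\<bar>Bcontfun g (pos k \<mu>)\<bar> \<le> e" if "adm k \<mu>" "k0 \<le> k" for k \<mu>
    proof -
      have "(1/2 :: real) ^ k \<le> (1/2) ^ k0" using that(2) by (intro power_decreasing) auto
      then show ?thesis using small[OF that(1)] k0 unfolding app g_pos[OF that(1)] by linarith
    qed
    then show "\<exists>k0. \<forall>k \<mu>. adm k \<mu> \<longrightarrow> k0 \<le> k \<longrightarrow> \<bar>Bcontfun g (pos k \<mu>)\<bar> \<le> e" by blast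
  qed
  then show ?thesis using ev by blast
qed

lemma V_norm_le:
  assumes v: "v \<in> V" and "0 \<le> b" and "\<And>k \<mu>. adm k \<mu> \<Longrightarrow> \<bar>v (pos k \<mu>)\<bar> \<le> b"
  shows "norm v \<le> b"
proof (rule norm_bound)
  fix j
  show "norm (v j) \<le> b"
    using assms(3) V_zero[OF v, of j] \<open>0 \<le> b\<close> by (cases "\<exists>k \<mu>. adm k \<mu> \<and> j = pos k \<mu>") auto
qed

text \<open>Otherwise the functions \<open>ev (x (N + i))\<close> would form an l1-sequence for the
  sup norm, and \<open>independent_of_l1\<close> would contradict the hypothesis. Its condition
  \<open>polar\<close> holds as soon as \<open>C * (1/2) ^ k\<close>, the bound for functionals
  admissible for \<open>k\<close>, is below \<open>e / 2\<close>.\<close>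

lemma ex_small_block:
  fixes x :: "nat \<Rightarrow> (nat + 't set) discrete \<Rightarrow>\<^sub>C real"
  assumes no_indep: "\<not> (\<exists>h p q. (\<forall>i. h i \<in> F) \<and> indep_seq (topspace T) h p q)"
    and x: "\<And>i. x i \<in> V" "\<And>i. norm (x i) \<le> C" and "0 < e"
  shows "\<exists>n a. (\<Sum>i<n. \<bar>a i\<bar>) = 1 \<and> (\<forall>t\<in>topspace T. \<bar>\<Sum>i<n. a i * ev (x (N + i)) t\<bar> < e)"
proof (rule ccontr)
  assume neg: "\<not> ?thesis"
  let ?z = "\<lambda>i. ev (x (N + i))"
  have C: "0 \<le> C" using x(2)[of 0] norm_ge_zero[of "x 0"] by linarith
  then have "0 < e / (2 * (C + 1))" using \<open>0 < e\<close> by simp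
  then obtain k where k: "(1/2 :: real) ^ k < e / (2 * (C + 1))"
    using real_arch_pow_inv[of _ "1/2 :: real"] by auto
  have "\<exists>h p q. (\<forall>i. h i \<in> F) \<and> indep_seq (topspace T) h p q"
  proof (rule independent_of_l1[where z="?z" and \<eta>=e and \<delta>="(1/4) ^ k" and C=C])
    show "\<bar>?z i t\<bar> \<le> C" for i t using ev_le[of "x (N + i)" t] x(2)[of "N + i"] by linarith
    show "\<bar>limit_integral \<mu> (?z i)\<bar> < e / 2"
      if "sub_mass (topspace T) \<mu>" "\<And>f. f \<in> F \<Longrightarrow> \<bar>limit_integral \<mu> f\<bar> \<le> (1/4) ^ k" for \<mu> i
    proof -
      have "adm k \<mu>" using that by (simp add: adm_def)
      then have "2 ^ k * \<bar>limit_integral \<mu> (?z i)\<bar> \<le> C"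
        using V_pos[OF x(1), of k \<mu> "N + i"] abs_le_norm[of "x (N + i)" "pos k \<mu>"] x(2)[of "N + i"]
        by (simp add: abs_mult)
      then have "\<bar>limit_integral \<mu> (?z i)\<bar> \<le> C * (1/2) ^ k" by (simp add: field_simps power_one_over)
      also have "\<dots> \<le> (C + 1) * (1/2) ^ k" by (intro mult_right_mono) auto
      also have "\<dots> < (C + 1) * (e / (2 * (C + 1)))" using k C by (intro mult_strict_left_mono) auto
      also have "\<dots> = e / 2" using C by (simp add: field_simps)
      finally show ?thesis .
    qed
    fix n and a :: "nat \<Rightarrow> real"
    have unit: "\<forall>l b. (\<Sum>i<l. \<bar>b i\<bar>) = 1 \<longrightarrow> (\<exists>t\<in>topspace T. e \<le> \<bar>\<Sum>i<l. b i * ?z i t\<bar>)"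
      using neg by (meson not_less)
    show "\<exists>t\<in>topspace T. e * (\<Sum>i<n. \<bar>a i\<bar>) \<le> \<bar>\<Sum>i<n. a i * ?z i t\<bar>"
    proof (cases "(\<Sum>i<n. \<bar>a i\<bar>) = 0")
      case True
      moreover obtain t where "t \<in> topspace T" using unit[rule_format, of "\<lambda>_. 1" 1] by auto
      ultimately show ?thesis by (intro bexI[of _ t]) auto
    next
      case False
      let ?s = "\<Sum>i<n. \<bar>a i\<bar>"
      have s: "0 < ?s" using False by (simp add: sum_nonneg less_le)
      have "(\<Sum>i<n. \<bar>a i / ?s\<bar>) = 1" using s False by (simp flip: sum_divide_distrib)
      then obtain t where t: "t \<in> topspace T" "e \<le> \<bar>\<Sum>i<n. a i / ?s * ?z i t\<bar>"
        using unit[rule_format, of "\<lambda>i. a i / ?s" n] by blast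
      have "(\<Sum>i<n. a i / ?s * ?z i t) = (\<Sum>i<n. a i * ?z i t) / ?s" by (simp add: sum_divide_distrib)
      then have "e \<le> \<bar>\<Sum>i<n. a i * ?z i t\<bar> / ?s" using t(2) s by simp
      then show ?thesis using t(1) s by (intro bexI[of _ t]) (simp_all add: pos_le_divide_eq)
    qed
  qed (use \<open>0 < e\<close> F_le_1 in auto)
  then show False using no_indep by blast
qed

lemma sum_lessThan_add: "(\<Sum>i<n + m. g i) = (\<Sum>i<n. g i) + (\<Sum>i<m. g (n + i))" for g :: "nat \<Rightarrow> 'b::comm_monoid_add"
  by (induction m) (auto simp: add.assoc)

text \<open>Gliding hump: after a vector whose \<open>k\<close>-th norms are small from \<open>k0\<close> on, a block is added
  whose first \<open>k0\<close> norms are small.\<close>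

lemma ex_bounded_l1_combination:
  fixes x :: "nat \<Rightarrow> (nat + 't set) discrete \<Rightarrow>\<^sub>C real" and \<theta> :: real
  assumes no_indep: "\<not> (\<exists>h p q. (\<forall>i. h i \<in> F) \<and> indep_seq (topspace T) h p q)"
    and x: "\<And>i. x i \<in> V" "\<And>i. norm (x i) \<le> C" and \<theta>: "0 < \<theta>"
  shows "\<exists>n a. (\<Sum>i<n. \<bar>a i\<bar>) = real M \<and> norm (\<Sum>i<n. a i *\<^sub>R x i) \<le> C + M * \<theta>"
proof (induction M)
  case 0
  have "0 \<le> C" using x(2)[of 0] norm_ge_zero[of "x 0"] by linarith
  then show ?case by (intro exI[of _ 0]) simp
next
  case (Suc M)
  then obtain n a where na: "(\<Sum>i<n. \<bar>a i\<bar>) = real M" "norm (\<Sum>i<n. a i *\<^sub>R x i) \<le> C + M * \<theta>" by blast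
  define v where "v = (\<Sum>i<n. a i *\<^sub>R x i)"
  have v: "v \<in> V" unfolding v_def using x(1) by (intro subspace_sum subspace_V subspace_scale)
  obtain k0 where k0: "\<And>k \<mu>. adm k \<mu> \<Longrightarrow> k0 \<le> k \<Longrightarrow> \<bar>v (pos k \<mu>)\<bar> \<le> \<theta>"
    using V_vanish[OF v \<theta>] by blast
  have "0 < \<theta> / 2 ^ k0" using \<theta> by simp
  then have "\<exists>m b. (\<Sum>i<m. \<bar>b i\<bar>) = 1 \<and>
      (\<forall>t\<in>topspace T. \<bar>\<Sum>i<m. b i * ev (x (n + i)) t\<bar> < \<theta> / 2 ^ k0)"
    by (rule ex_small_block[OF no_indep x])
  then obtain m b where b: "(\<Sum>i<m. \<bar>b i\<bar>) = 1"
    "\<forall>t\<in>topspace T. \<bar>\<Sum>i<m. b i * ev (x (n + i)) t\<bar> < \<theta> / 2 ^ k0"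
    by (elim exE conjE)
  define w where "w = (\<Sum>i<m. b i *\<^sub>R x (n + i))"
  have w: "w \<in> V" unfolding w_def using x(1) by (intro subspace_sum subspace_V subspace_scale)
  have "norm w \<le> (\<Sum>i<m. norm (b i *\<^sub>R x (n + i)))" unfolding w_def by (rule norm_sum)
  also have "\<dots> \<le> (\<Sum>i<m. \<bar>b i\<bar> * C)" using x(2) by (intro sum_mono) (simp add: mult_left_mono)
  also have "\<dots> = C" using b(1) by (simp flip: sum_distrib_right)
  finally have wC: "norm w \<le> C" .
  have ev_w: "ev w t = (\<Sum>i<m. b i * ev (x (n + i)) t)" for t
    by (simp add: w_def ev_def bcontfun_sum_apply)
  have w_small: "\<bar>w (pos k \<mu>)\<bar> \<le> \<theta>" if "adm k \<mu>" "k < k0" for k \<mu>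
  proof -
    have small: "\<bar>limit_integral \<mu> (ev w)\<bar> \<le> \<theta> / 2 ^ k0"
      using that(1) \<theta> b(2) by (intro limit_integral_le[of "topspace T"]) (auto simp: adm_def ev_w intro: less_imp_le)
    have "\<bar>w (pos k \<mu>)\<bar> = 2 ^ k * \<bar>limit_integral \<mu> (ev w)\<bar>"
      using V_pos[OF w that(1)] by (simp add: abs_mult)
    also have "\<dots> \<le> 2 ^ k * (\<theta> / 2 ^ k0)" using small by (rule mult_left_mono) simp
    also have "\<dots> \<le> 2 ^ k0 * (\<theta> / 2 ^ k0)" using that(2) \<theta> by (intro mult_right_mono power_increasing) auto
    finally show ?thesis by simp
  qed
  have vw: "norm (v + w) \<le> C + real (Suc M) * \<theta>"
  proof (rule V_norm_le)
    show "v + w \<in> V" using v w subspace_add[OF subspace_V] by blast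
    show "0 \<le> C + real (Suc M) * \<theta>" using \<theta> order_trans[OF norm_ge_zero wC] by (intro add_nonneg_nonneg) simp_all
    fix k \<mu> assume a: "adm k \<mu>"
    have "\<bar>v (pos k \<mu>)\<bar> \<le> C + real M * \<theta>" using abs_le_norm[of v "pos k \<mu>"] na(2) by (simp add: v_def)
    moreover have "\<bar>w (pos k \<mu>)\<bar> \<le> C" using abs_le_norm[of w "pos k \<mu>"] wC by simp
    moreover have "0 \<le> real M * \<theta>" using \<theta> by simp
    \<comment> \<open>At each position at most one summand exceeds \<open>\<theta>\<close>, so
      adding \<open>w\<close> raises the norm bound by \<open>\<theta>\<close> and not by
      \<open>C\<close>.\<close>
    moreover have "\<bar>v (pos k \<mu>)\<bar> \<le> \<theta> \<or> \<bar>w (pos k \<mu>)\<bar> \<le> \<theta>"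
      using k0[OF a] w_small[OF a] by (cases "k0 \<le> k") auto
    moreover have "(v + w) (pos k \<mu>) = v (pos k \<mu>) + w (pos k \<mu>)"
      and "real (Suc M) * \<theta> = real M * \<theta> + \<theta>" by (simp_all add: distrib_right)
    ultimately show "\<bar>(v + w) (pos k \<mu>)\<bar> \<le> C + real (Suc M) * \<theta>" by linarith
  qed
  let ?c = "\<lambda>i. if i < n then a i else b (i - n)"
  show ?case
  proof (intro exI conjI)
    show "(\<Sum>i<n + m. \<bar>?c i\<bar>) = real (Suc M)" by (simp add: sum_lessThan_add na(1) b(1))
    have "(\<Sum>i<n + m. ?c i *\<^sub>R x i) = v + w" by (simp add: sum_lessThan_add v_def w_def)
    then show "norm (\<Sum>i<n + m. ?c i *\<^sub>R x i) \<le> C + real (Suc M) * \<theta>" using vw by simp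
  qed
qed

text \<open>With \<open>\<theta> = c / 2\<close> the lower estimate would give
  \<open>c * M \<le> C + M * (c / 2)\<close>, which fails for \<open>M > 2 * C / c\<close>.\<close>

lemma V_not_contains_l1:
  assumes no_indep: "\<not> (\<exists>h p q. (\<forall>i. h i \<in> F) \<and> indep_seq (topspace T) h p q)"
  shows "\<not> contains_l1 V"
proof
  assume "contains_l1 V"
  then obtain x C c where x_all: "(\<forall>n. x n \<in> V) \<and> 0 < c \<and> (\<forall>n. norm (x n) \<le> C) \<and>
    (\<forall>(a :: nat \<Rightarrow> real) N. c * (\<Sum>i<N. \<bar>a i\<bar>) \<le> norm (\<Sum>i<N. a i *\<^sub>R x i))"
    unfolding contains_l1_def by (elim exE conjE) simp
  obtain M :: nat where M: "2 * C / c < M" using reals_Archimedean2 by blast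
  have "\<exists>n a. (\<Sum>i<n. \<bar>a i\<bar>) = real M \<and> norm (\<Sum>i<n. a i *\<^sub>R x i) \<le> C + M * (c / 2)"
    using x_all by (intro ex_bounded_l1_combination[OF no_indep]) auto
  then obtain n a where na: "(\<Sum>i<n. \<bar>a i\<bar>) = real M" "norm (\<Sum>i<n. a i *\<^sub>R x i) \<le> C + M * (c / 2)"
    by blast
  have "c * (\<Sum>i<n. \<bar>a i\<bar>) \<le> norm (\<Sum>i<n. a i *\<^sub>R x i)" using x_all by blast
  then have "c * M \<le> C + M * (c / 2)" using na by simp
  then have "M * c \<le> 2 * C" by (simp add: field_simps)
  moreover have "2 * C < M * c" using M x_all by (simp add: pos_divide_less_eq)
  ultimately show False by linarith
qed

end

theorem weakly_RN_criterion:
  fixes T :: "'t topology" and F :: "('t \<Rightarrow> real) set"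
  assumes T: "compact_space T" "Hausdorff_space T"
    and F: "\<And>f. f \<in> F \<Longrightarrow> continuous_map T euclideanreal f"
      "\<And>f x. f \<in> F \<Longrightarrow> x \<in> topspace T \<Longrightarrow> \<bar>f x\<bar> \<le> 1"
    and sep: "\<And>x y. x \<in> topspace T \<Longrightarrow> y \<in> topspace T \<Longrightarrow> x \<noteq> y \<Longrightarrow> \<exists>f\<in>F. f x \<noteq> f y"
    and no_indep: "\<not> (\<exists>h p q. (\<forall>i. h i \<in> F) \<and> indep_seq (topspace T) h p q)"
  shows "\<exists>V :: ((nat + 't set) discrete \<Rightarrow>\<^sub>C real) set. weakly_RN_via T V"
\<comment> \<open>Coding the functionals by sets of points presupposes an infinite type of
  points.\<close>
proof (cases "finite (topspace T)")
  case True
  then show ?thesis using T(2) by (rule weakly_RN_finite)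
next
  case False
  then have "infinite (UNIV :: 't set)" using infinite_super[OF subset_UNIV] by blast
  then obtain \<iota> :: "nat \<times> (nat \<Rightarrow> 't \<Rightarrow> real) \<Rightarrow> 't set" where \<iota>: "inj \<iota>"
    using ex_index_injection by blast
  obtain Ulim where "generalized_limit Ulim" using ex_generalized_limit by blast
  then interpret generalized_limit Ulim .
  interpret interpolation_space Ulim T F \<iota>
    by unfold_locales (use \<iota> F in auto)
  have "weakly_RN_via T V"
  proof (rule weakly_RN_viaI[where E="\<lambda>x v. ev v x"])
    show "compact_space T" by (fact T(1))
    show "banach_subspace V" using subspace_V closed_V by (simp add: banach_subspace_def complete_eq_closed)
    show "\<not> contains_l1 V" using no_indep by (rule V_not_contains_l1)
    show "\<exists>v\<in>V. ev v x \<noteq> ev v y" if "x \<in> topspace T" "y \<in> topspace T" "x \<noteq> y" for x y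
    proof -
      obtain f where f: "f \<in> F" "f x \<noteq> f y" using sep[OF \<open>x \<in> topspace T\<close> \<open>y \<in> topspace T\<close> \<open>x \<noteq> y\<close>] by blast
      obtain v where "v \<in> V" "\<forall>x\<in>topspace T. ev v x = f x" using F_in_V[OF f(1)] by blast
      then show ?thesis using f(2) that by (intro bexI[of _ v]) auto
    qed
  qed (auto simp: ev_add ev_scale ev_le V_cont)
  then show ?thesis by blast
qed

section \<open>Split spaces\<close>

lemma indep_seqD:
  "indep_seq K h p q \<Longrightarrow> \<exists>x\<in>K. \<forall>i<m. if \<epsilon> i then q \<le> h i x else h i x \<le> p"
  by (simp add: indep_seq_def)

lemma indep_seq_subseq:
  assumes "indep_seq K h p q" "strict_mono (n :: nat \<Rightarrow> nat)"
  shows "indep_seq K (\<lambda>i. h (n i)) p q"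
  unfolding indep_seq_def
proof (intro conjI allI)
  show "p < q" using assms(1) by (simp add: indep_seq_def)
  fix m \<epsilon>
  obtain x where x: "x \<in> K" "\<forall>j<n m. if \<exists>i. j = n i \<and> \<epsilon> i then q \<le> h j x else h j x \<le> p"
    using indep_seqD[OF assms(1), of "n m" "\<lambda>j. \<exists>i. j = n i \<and> \<epsilon> i"] by blast
  have "if \<epsilon> i then q \<le> h (n i) x else h (n i) x \<le> p" if "i < m" for i
  proof -
    have "n i < n m" using that assms(2) by (simp add: strict_monoD)
    moreover have "(\<exists>k. n i = n k \<and> \<epsilon> k) \<longleftrightarrow> \<epsilon> i" using assms(2) by (metis strict_mono_eq)
    ultimately show ?thesis using x(2) by (metis (no_types, lifting))
  qed
  then show "\<exists>x\<in>K. \<forall>i<m. if \<epsilon> i then q \<le> h (n i) x else h (n i) x \<le> p" using x(1) by blast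
qed

text \<open>The proof builds nested balls on which some functional is large.\<close>

lemma uniform_boundedness:
  fixes X :: "'v::real_normed_vector set" and S :: "('v \<Rightarrow> real) set"
  assumes X: "subspace X" "complete X"
    and add: "\<And>s x y. s \<in> S \<Longrightarrow> x \<in> X \<Longrightarrow> y \<in> X \<Longrightarrow> s (x + y) = s x + s y"
    and scale: "\<And>s c x. s \<in> S \<Longrightarrow> x \<in> X \<Longrightarrow> s (c *\<^sub>R x) = c * s x"
    and bounded: "\<And>s. s \<in> S \<Longrightarrow> \<exists>B. \<forall>x\<in>X. \<bar>s x\<bar> \<le> B * norm x"
    and pointwise: "\<And>x. x \<in> X \<Longrightarrow> \<exists>C. \<forall>s\<in>S. \<bar>s x\<bar> \<le> C"
  shows "\<exists>B>0. \<forall>s\<in>S. \<forall>x\<in>X. \<bar>s x\<bar> \<le> B * norm x"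
proof (rule ccontr)
  assume "\<not> ?thesis"
  then have large: "\<exists>s\<in>S. \<exists>x\<in>X. B * norm x < \<bar>s x\<bar>" if "0 < B" for B
    using that by (meson not_le)
  have step: "\<exists>s\<in>S. \<exists>x'\<in>X. \<exists>\<rho>'>0. norm (x' - x) \<le> \<rho> \<and> \<rho>' \<le> \<rho> / 2 \<and>
      (\<forall>y\<in>X. norm (y - x') \<le> 2 * \<rho>' \<longrightarrow> K \<le> \<bar>s y\<bar>)"
    if "x \<in> X" "0 < \<rho>" "0 \<le> K" for x \<rho> K
  proof -
    have "0 < (K + 1) / \<rho>" using that by simp
    then obtain s u where s: "s \<in> S" and u: "u \<in> X" "(K + 1) / \<rho> * norm u < \<bar>s u\<bar>" using large by blast
    have diff: "s (a - b) = s a - s b" if "a \<in> X" "b \<in> X" for a b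
      using add[OF s that(1) subspace_neg[OF X(1) that(2)]] scale[OF s that(2), of "-1"] by simp
    have "s 0 = 0" using scale[OF s, of 0 0] subspace_0[OF X(1)] by simp
    then have "u \<noteq> 0" using u by auto
    define w where "w = (\<rho> / norm u) *\<^sub>R u"
    have w: "w \<in> X" "norm w = \<rho>" using u \<open>u \<noteq> 0\<close> subspace_scale[OF X(1)] \<open>0 < \<rho>\<close> by (auto simp: w_def)
    have "\<bar>s w\<bar> = \<rho> / norm u * \<bar>s u\<bar>" using scale[OF s u(1)] \<open>0 < \<rho>\<close> by (simp add: w_def abs_mult)
    moreover have "\<rho> / norm u * ((K + 1) / \<rho> * norm u) \<le> \<rho> / norm u * \<bar>s u\<bar>"
      using u(2) \<open>0 < \<rho>\<close> by (intro mult_left_mono) auto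
    moreover have "\<rho> / norm u * ((K + 1) / \<rho> * norm u) = K + 1" using \<open>u \<noteq> 0\<close> \<open>0 < \<rho>\<close> by simp
    ultimately have "K + 1 \<le> \<bar>s w\<bar>" by simp
    moreover have "s (x + w) = s x + s w" "s (x - w) = s x - s w"
      using add[OF s] diff that(1) w(1) by auto
    \<comment> \<open>The two values differ by \<open>2 * s w\<close>, so one of them is at least
      \<open>\<bar>s w\<bar>\<close> in modulus.\<close>
    ultimately have "K + 1 \<le> \<bar>s (x + w)\<bar> \<or> K + 1 \<le> \<bar>s (x - w)\<bar>" by linarith
    moreover have "x + w \<in> X" "x - w \<in> X" "norm (x + w - x) \<le> \<rho>" "norm (x - w - x) \<le> \<rho>"
      using w subspace_add[OF X(1) that(1) w(1)] subspace_diff[OF X(1) that(1) w(1)] by auto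
    ultimately obtain x' where x': "x' \<in> X" "norm (x' - x) \<le> \<rho>" "K + 1 \<le> \<bar>s x'\<bar>" by blast
    obtain B where B: "\<forall>x\<in>X. \<bar>s x\<bar> \<le> B * norm x" using bounded[OF s] by blast
    \<comment> \<open>On the ball of radius \<open>2 * \<rho>'\<close> about \<open>x'\<close> the
      functional varies by at most 1, which uses up the extra 1 in \<open>K + 1\<close>.\<close>
    define \<rho>' where "\<rho>' = min (\<rho> / 2) (1 / (2 * (\<bar>B\<bar> + 1)))"
    have \<rho>': "0 < \<rho>'" "\<rho>' \<le> \<rho> / 2" "\<rho>' \<le> 1 / (2 * (\<bar>B\<bar> + 1))" using \<open>0 < \<rho>\<close> by (auto simp: \<rho>'_def)
    have "K \<le> \<bar>s y\<bar>" if y: "y \<in> X" "norm (y - x') \<le> 2 * \<rho>'" for y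
    proof -
      have "\<bar>s (y - x')\<bar> \<le> B * norm (y - x')" using B y x' subspace_diff[OF X(1)] by blast
      also have "\<dots> \<le> (\<bar>B\<bar> + 1) * (2 * (1 / (2 * (\<bar>B\<bar> + 1))))"
        using y(2) \<rho>'(3) by (intro mult_mono) auto
      also have "\<dots> = 1" by (simp add: field_simps add_pos_nonneg)
      finally show ?thesis using diff[OF y(1) x'(1)] x'(3) by linarith
    qed
    then show ?thesis using s x' \<rho>' by blast
  qed
  \<comment> \<open>The doubled radius is the total distance that later centres can still travel, as
    the radii at least halve.\<close>
  define R where "R n a b \<longleftrightarrow> norm (fst b - fst a) \<le> snd a \<and> snd b \<le> snd a / 2 \<and>
      (\<exists>s\<in>S. \<forall>y\<in>X. norm (y - fst b) \<le> 2 * snd b \<longrightarrow> real n \<le> \<bar>s y\<bar>)" for n and a b :: "'v \<times> real"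
  have "\<exists>g. \<forall>n. (fst (g n) \<in> X \<and> 0 < snd (g n) \<and> (n = 0 \<longrightarrow> snd (g n) = 1)) \<and> R n (g n) (g (Suc n))"
  proof (rule dependent_nat_choice)
    show "\<exists>a. fst a \<in> X \<and> 0 < snd a \<and> ((0::nat) = 0 \<longrightarrow> snd a = (1::real))"
      using subspace_0[OF X(1)] by (intro exI[of _ "(0, 1)"]) auto
    fix a :: "'v \<times> real" and n :: nat
    assume a: "fst a \<in> X \<and> 0 < snd a \<and> (n = 0 \<longrightarrow> snd a = 1)"
    then obtain s x' \<rho>' where "s \<in> S" "x' \<in> X" "0 < \<rho>'" "norm (x' - fst a) \<le> snd a" "\<rho>' \<le> snd a / 2"
      "\<forall>y\<in>X. norm (y - x') \<le> 2 * \<rho>' \<longrightarrow> real n \<le> \<bar>s y\<bar>"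
      using step[of "fst a" "snd a" "real n"] by auto
    then show "\<exists>b. (fst b \<in> X \<and> 0 < snd b \<and> (Suc n = 0 \<longrightarrow> snd b = 1)) \<and> R n a b"
      by (intro exI[of _ "(x', \<rho>')"]) (auto simp: R_def)
  qed
  then obtain g where g: "\<And>n. fst (g n) \<in> X" "\<And>n. 0 < snd (g n)" "snd (g 0) = 1"
    "\<And>n. R n (g n) (g (Suc n))" by blast
  have dist_le: "norm (fst (g (n + k)) - fst (g n)) \<le> 2 * snd (g n) - 2 * snd (g (n + k))" for n k
  proof (induction k)
    case (Suc k)
    have "norm (fst (g (Suc (n + k))) - fst (g n))
      \<le> norm (fst (g (Suc (n + k))) - fst (g (n + k))) + norm (fst (g (n + k)) - fst (g n))"
      using norm_triangle_ineq[of "fst (g (Suc (n + k))) - fst (g (n + k))" "fst (g (n + k)) - fst (g n)"] by simp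
    moreover have "norm (fst (g (Suc (n + k))) - fst (g (n + k))) \<le> snd (g (n + k))"
      "snd (g (Suc (n + k))) \<le> snd (g (n + k)) / 2"
      using g(4)[of "n + k"] by (auto simp: R_def)
    ultimately show ?case using Suc by simp
  qed simp
  have dist_le': "norm (fst (g m) - fst (g n)) \<le> 2 * snd (g n)" if "n \<le> m" for m n
    using dist_le[of n "m - n"] g(2)[of m] that by simp
  have \<rho>: "snd (g n) \<le> (1/2) ^ n" for n
  proof (induction n)
    case (Suc n)
    have "snd (g (Suc n)) \<le> snd (g n) / 2" using g(4)[of n] by (simp add: R_def)
    then show ?case using Suc by simp
  qed (simp add: g)
  have "Cauchy (\<lambda>n. fst (g n))"
  proof (rule metric_CauchyI)
    fix e :: real assume "0 < e"
    obtain N where N: "(1/2 :: real) ^ N < e / 4" using real_arch_pow_inv[of "e / 4" "1/2"] \<open>0 < e\<close> by auto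
    have "dist (fst (g m)) (fst (g n)) < e" if "N \<le> m" "N \<le> n" for m n
    proof -
      have "dist (fst (g m)) (fst (g n)) \<le> dist (fst (g m)) (fst (g N)) + dist (fst (g n)) (fst (g N))"
        by (rule dist_triangle2)
      also have "\<dots> \<le> 2 * snd (g N) + 2 * snd (g N)"
        using dist_le' that by (intro add_mono) (auto simp: dist_norm)
      also have "\<dots> < e" using \<rho>[of N] N by linarith
      finally show ?thesis .
    qed
    then show "\<exists>M. \<forall>m\<ge>M. \<forall>n\<ge>M. dist (fst (g m)) (fst (g n)) < e" by blast
  qed
  then obtain x where x: "x \<in> X" "(\<lambda>n. fst (g n)) \<longlonglongrightarrow> x"
    using X(2)[unfolded complete_def, rule_format, of "\<lambda>n. fst (g n)"] g(1) by blast
  have close: "norm (x - fst (g n)) \<le> 2 * snd (g n)" for n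
  proof (rule LIMSEQ_le_const2)
    show "(\<lambda>m. norm (fst (g m) - fst (g n))) \<longlonglongrightarrow> norm (x - fst (g n))"
      using x(2) by (intro tendsto_intros)
    show "\<exists>N. \<forall>m\<ge>N. norm (fst (g m) - fst (g n)) \<le> 2 * snd (g n)" using dist_le' by blast
  qed
  obtain C where C: "\<forall>s\<in>S. \<bar>s x\<bar> \<le> C" using pointwise[OF x(1)] by blast
  obtain n :: nat where n: "C < n" using reals_Archimedean2 by blast
  obtain s where "s \<in> S" "\<forall>y\<in>X. norm (y - fst (g (Suc n))) \<le> 2 * snd (g (Suc n)) \<longrightarrow> real n \<le> \<bar>s y\<bar>"
    using g(4)[of n] by (auto simp: R_def)
  then have "real n \<le> \<bar>s x\<bar>" using x(1) close by blast
  then show False using C \<open>s \<in> S\<close> n by force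
qed

text \<open>Evaluations are weak-star continuous, so \<open>S\<close> is pointwise bounded. The
  bound \<open>B\<close> later serves to rescale the functionals, so that the unit ball of
  \<open>X\<close> gives functions bounded by 1.\<close>

lemma weak_star_compact_bounded:
  assumes X: "banach_subspace X" and S: "compactin (weak_star X) S"
  shows "\<exists>B>0. \<forall>s\<in>S. \<forall>x\<in>X. \<bar>s x\<bar> \<le> B * norm x"
proof (rule uniform_boundedness)
  show "subspace X" "complete X" using X by (auto simp: banach_subspace_def)
  have SD: "S \<subseteq> dual_space X"
    using compactin_subset_topspace[OF S] by (auto simp: weak_star_def)
  show "s (x + y) = s x + s y" if "s \<in> S" "x \<in> X" "y \<in> X" for s x y
    using SD that by (auto simp: dual_space_def)
  show "s (c *\<^sub>R x) = c * s x" if "s \<in> S" "x \<in> X" for s c x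
    using SD that by (auto simp: dual_space_def)
  show "\<exists>B. \<forall>x\<in>X. \<bar>s x\<bar> \<le> B * norm x" if "s \<in> S" for s
    using SD that by (auto simp: dual_space_def)
  fix x assume x: "x \<in> X"
  have "continuous_map (weak_star X) euclideanreal (\<lambda>s. s x)"
    unfolding weak_star_def using x
    by (intro continuous_map_from_subtopology continuous_map_product_projection)
  then have "compactin euclideanreal ((\<lambda>s. s x) ` S)" using S image_compactin by blast
  then have "bounded ((\<lambda>s. s x) ` S)" by (simp add: compactin_euclidean_iff compact_imp_bounded)
  then show "\<exists>C. \<forall>s\<in>S. \<bar>s x\<bar> \<le> C" by (auto simp: bounded_iff)
qed

text \<open>Trades the two kinds of points for one condition per coordinate, so that closedness can
  be checked one \<open>\<eta>\<close> at a time; injectivity of \<open>r\<close> guarantees that at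
  most one coordinate is free.\<close>

lemma split_points_eq:
  assumes inj: "inj_on r I" and r: "r ` I \<subseteq> topspace L"
    and f: "\<And>\<xi> x. \<xi> \<in> I \<Longrightarrow> x \<in> topspace L \<Longrightarrow> x \<noteq> r \<xi> \<Longrightarrow> f \<xi> x \<in> M"
  shows "split_points L M I r f =
    {z \<in> topspace L \<times> (\<Pi>\<^sub>E \<eta>\<in>I. M). \<forall>\<eta>\<in>I. fst z = r \<eta> \<or> snd z \<eta> = f \<eta> (fst z)}" (is "?A = ?B")
proof (intro equalityI subsetI)
  fix z assume "z \<in> ?A"
  then consider \<xi> t where "\<xi> \<in> I" "t \<in> M" "z = (r \<xi>, (\<lambda>\<eta>\<in>I. if \<eta> = \<xi> then t else f \<eta> (r \<xi>)))"
    | x where "x \<in> topspace L" "x \<notin> r ` I" "z = (x, (\<lambda>\<eta>\<in>I. f \<eta> x))"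
    unfolding split_points_def by blast
  then show "z \<in> ?B"
  proof cases
    case 1
    have "f \<eta> (r \<xi>) \<in> M" if "\<eta> \<in> I" "\<eta> \<noteq> \<xi>" for \<eta>
      using 1(1) that inj r by (intro f) (auto dest: inj_onD)
    then show ?thesis using 1 r by auto
  next
    case 2
    then show ?thesis using f by auto
  qed
next
  fix z assume z: "z \<in> ?B"
  obtain x y where [simp]: "z = (x, y)" by fastforce
  have y: "y \<in> (\<Pi>\<^sub>E \<eta>\<in>I. M)" and x: "x \<in> topspace L"
    and eq: "\<And>\<eta>. \<eta> \<in> I \<Longrightarrow> x \<noteq> r \<eta> \<Longrightarrow> y \<eta> = f \<eta> x" using z by auto
  show "z \<in> ?A"
  proof (cases "x \<in> r ` I")
    case True
    then obtain \<xi> where \<xi>: "\<xi> \<in> I" "x = r \<xi>" by blast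
    have "y = (\<lambda>\<eta>\<in>I. if \<eta> = \<xi> then y \<xi> else f \<eta> (r \<xi>))"
    proof
      fix \<eta>
      show "y \<eta> = (\<lambda>\<eta>\<in>I. if \<eta> = \<xi> then y \<xi> else f \<eta> (r \<xi>)) \<eta>"
        using eq[of \<eta>] \<xi> inj PiE_arb[OF y, of \<eta>] by (auto dest: inj_onD)
    qed
    moreover have "y \<xi> \<in> M" using y \<xi> by auto
    ultimately show ?thesis unfolding split_points_def using \<xi> by auto
  next
    case False
    have "y = (\<lambda>\<eta>\<in>I. f \<eta> x)"
    proof
      fix \<eta>
      show "y \<eta> = (\<lambda>\<eta>\<in>I. f \<eta> x) \<eta>"
        using eq[of \<eta>] False PiE_arb[OF y, of \<eta>] by (cases "\<eta> \<in> I") auto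
    qed
    then show ?thesis unfolding split_points_def using False x by auto
  qed
qed

text \<open>For each \<open>\<eta>\<close> the violation of the condition is open: it takes place in
  the open set of points not over \<open>r \<eta>\<close>, where \<open>f \<eta>\<close> is
  continuous. So the split space is closed in a compact product.\<close>

lemma split_space_compact:
  fixes M :: "'m::metric_space set"
  assumes M: "compact M" and L: "compact_space L" "Hausdorff_space L"
    and inj: "inj_on r I" and r: "r ` I \<subseteq> topspace L"
    and cont: "\<forall>\<xi>\<in>I. continuous_map (subtopology L (topspace L - {r \<xi>})) (top_of_set M) (f \<xi>)"
  shows "compact_space (split_space L M I r f)" "Hausdorff_space (split_space L M I r f)"
    "topspace (split_space L M I r f) = split_points L M I r f"
proof -
  let ?P = "prod_topology L (product_topology (\<lambda>_. top_of_set M) I)"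
  have f: "f \<xi> x \<in> M" if "\<xi> \<in> I" "x \<in> topspace L" "x \<noteq> r \<xi>" for \<xi> x
    using cont that by (force simp: continuous_map_def)
  have eq: "split_points L M I r f =
    {z \<in> topspace L \<times> (\<Pi>\<^sub>E \<eta>\<in>I. M). \<forall>\<eta>\<in>I. fst z = r \<eta> \<or> snd z \<eta> = f \<eta> (fst z)}"
    by (rule split_points_eq[OF inj r]) (use f in auto)
  have top: "topspace ?P = topspace L \<times> (\<Pi>\<^sub>E \<eta>\<in>I. M)" by simp
  have closed1: "closedin ?P {z \<in> topspace ?P. fst z = r \<eta> \<or> snd z \<eta> = f \<eta> (fst z)}" (is "closedin _ ?C")
    if \<eta>: "\<eta> \<in> I" for \<eta>
  proof -
    let ?W = "{z \<in> topspace ?P. fst z \<in> topspace L - {r \<eta>}}"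
    have "openin L (topspace L - {r \<eta>})"
      using Hausdorff_imp_t1_space[OF L(2)] r \<eta>
      by (intro openin_diff) (auto simp: t1_space_closedin_singleton)
    then have W: "openin ?P ?W"
      by (intro openin_continuous_map_preimage[OF continuous_map_fst])
    let ?Q = "subtopology ?P ?W"
    have topQ: "topspace ?Q = ?W" by auto
    have 1: "continuous_map ?Q (top_of_set M) (\<lambda>z. snd z \<eta>)"
    proof (rule continuous_map_from_subtopology)
      have "continuous_map ?P (top_of_set M) ((\<lambda>y. y \<eta>) \<circ> snd)"
        using \<eta> by (intro continuous_map_compose[OF continuous_map_snd] continuous_map_product_projection)
      then show "continuous_map ?P (top_of_set M) (\<lambda>z. snd z \<eta>)" by (simp add: o_def)
    qed
    have 2: "continuous_map ?Q (top_of_set M) (\<lambda>z. f \<eta> (fst z))"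
    proof -
      have "continuous_map ?Q (subtopology L (topspace L - {r \<eta>})) fst"
        by (intro continuous_map_into_subtopology continuous_map_from_subtopology continuous_map_fst) auto
      then have "continuous_map ?Q (top_of_set M) (f \<eta> \<circ> fst)"
        using cont \<eta> by (intro continuous_map_compose) auto
      then show ?thesis by (simp add: o_def)
    qed
    have "closedin ?Q {z \<in> topspace ?Q. snd z \<eta> = f \<eta> (fst z)}"
      by (rule closedin_continuous_maps_eq[OF _ 1 2]) (simp add: Hausdorff_space_subtopology)
    then have "openin ?Q (topspace ?Q - {z \<in> topspace ?Q. snd z \<eta> = f \<eta> (fst z)})" by blast
    then have "openin ?P (topspace ?Q - {z \<in> topspace ?Q. snd z \<eta> = f \<eta> (fst z)})"
      using W openin_trans_full by blast
    moreover have "topspace ?Q - {z \<in> topspace ?Q. snd z \<eta> = f \<eta> (fst z)} = topspace ?P - ?C"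
      unfolding topQ by auto
    ultimately have "openin ?P (topspace ?P - ?C)" by simp
    then show ?thesis by (subst closedin_def) auto
  qed
  have "closedin ?P (split_points L M I r f)"
  proof (cases "I = {}")
    case True
    then have "split_points L M I r f = topspace ?P" unfolding eq by auto
    then show ?thesis by (simp only: closedin_topspace)
  next
    case False
    have "split_points L M I r f = (\<Inter>\<eta>\<in>I. {z \<in> topspace ?P. fst z = r \<eta> \<or> snd z \<eta> = f \<eta> (fst z)})"
      unfolding eq top using False by blast
    then show ?thesis using False closed1 by (simp only:) (intro closedin_INT; simp)
  qed
  moreover have "compact_space ?P"
    using L M by (simp add: compact_space_prod_topology compact_space_product_topology compact_space_subtopology)
  ultimately have "compactin ?P (split_points L M I r f)" by (rule closedin_compact_space[rotated])
  then show "compact_space (split_space L M I r f)"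
    unfolding split_space_def by (rule compact_space_subtopology)
  show "Hausdorff_space (split_space L M I r f)"
    unfolding split_space_def
    using L by (intro Hausdorff_space_subtopology)
      (simp add: Hausdorff_space_prod_topology Hausdorff_space_product_topology Hausdorff_space_subtopology)
  show "topspace (split_space L M I r f) = split_points L M I r f"
    unfolding split_space_def topspace_subtopology top eq by blast
qed

text \<open>One point \<open>k\<close> follows the signs of the coefficients and another point
  \<open>l\<close> the opposite signs; the difference of their functionals gains
  \<open>q - p\<close> per unit of \<open>\<bar>a i\<bar>\<close>. Two points are compared because
  \<open>p\<close> and \<open>q\<close> may have the same sign.\<close>

lemma contains_l1_of_indep_seq:
  assumes X: "subspace X" and x: "\<And>i. x i \<in> X" "\<And>i. norm (x i) \<le> 1"
    and add: "\<And>k u v. k \<in> K \<Longrightarrow> u \<in> X \<Longrightarrow> v \<in> X \<Longrightarrow> s k (u + v) = s k u + s k v"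
    and scale: "\<And>k c u. k \<in> K \<Longrightarrow> u \<in> X \<Longrightarrow> s k (c *\<^sub>R u) = c * s k u"
    and bound: "\<And>k u. k \<in> K \<Longrightarrow> u \<in> X \<Longrightarrow> \<bar>s k u\<bar> \<le> norm u"
    and indep: "indep_seq K (\<lambda>i k. s k (x i)) p q"
  shows "contains_l1 X"
proof -
  have pq: "p < q" using indep by (simp add: indep_seq_def)
  have lin: "s k (\<Sum>i<N. a i *\<^sub>R x i) = (\<Sum>i<N. a i * s k (x i))" if k: "k \<in> K" for k a and N :: nat
  proof (induction N)
    case 0
    have "s k 0 = 0" using scale[OF k x(1)[of 0], of 0] by simp
    then show ?case by simp
  next
    case (Suc N)
    have "(\<Sum>i<N. a i *\<^sub>R x i) \<in> X" using x(1) by (intro subspace_sum X subspace_scale)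
    then show ?case using Suc add[OF k _ subspace_scale[OF X x(1)]] scale[OF k x(1)] by simp
  qed
  have "(q - p) / 2 * (\<Sum>i<N. \<bar>a i\<bar>) \<le> norm (\<Sum>i<N. a i *\<^sub>R x i)" for N and a :: "nat \<Rightarrow> real"
  proof -
    obtain k where k: "k \<in> K" "\<forall>i<N. if 0 \<le> a i then q \<le> s k (x i) else s k (x i) \<le> p"
      using indep_seqD[OF indep, of N "\<lambda>i. 0 \<le> a i"] by blast
    obtain l where l: "l \<in> K" "\<forall>i<N. if \<not> 0 \<le> a i then q \<le> s l (x i) else s l (x i) \<le> p"
      using indep_seqD[OF indep, of N "\<lambda>i. \<not> 0 \<le> a i"] by blast
    let ?v = "\<Sum>i<N. a i *\<^sub>R x i"
    have v: "?v \<in> X" using x(1) by (intro subspace_sum X subspace_scale)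
    have "(q - p) * (\<Sum>i<N. \<bar>a i\<bar>) = (\<Sum>i<N. (q - p) * \<bar>a i\<bar>)" by (rule sum_distrib_left)
    also have "\<dots> \<le> (\<Sum>i<N. a i * s k (x i) - a i * s l (x i))"
    proof (rule sum_mono)
      fix i assume i: "i \<in> {..<N}"
      show "(q - p) * \<bar>a i\<bar> \<le> a i * s k (x i) - a i * s l (x i)"
      proof (cases "0 \<le> a i")
        case True
        then have "q - p \<le> s k (x i) - s l (x i)" using k(2) l(2) i by fastforce
        then have "a i * (q - p) \<le> a i * (s k (x i) - s l (x i))" using True by (rule mult_left_mono)
        then show ?thesis using True by (simp add: algebra_simps)
      next
        case False
        then have "q - p \<le> s l (x i) - s k (x i)" using k(2) l(2) i by fastforce
        then have "(- a i) * (q - p) \<le> (- a i) * (s l (x i) - s k (x i))"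
          using False by (intro mult_left_mono) auto
        then show ?thesis using False by (simp add: algebra_simps)
      qed
    qed
    also have "\<dots> = s k ?v - s l ?v" by (simp add: lin k l sum_subtractf)
    also have "\<dots> \<le> 2 * norm ?v" using bound[OF k(1) v] bound[OF l(1) v] by linarith
    finally show ?thesis by simp
  qed
  then show ?thesis
    unfolding contains_l1_def using x pq
    by (intro exI[of _ x] conjI exI[of _ 1] exI[of _ "(q - p) / 2"]) auto
qed

text \<open>The points of \<open>K\<close> over \<open>r (\<xi> i)\<close>, \<open>i < m\<close>, are the only ones at which the
  coordinates \<open>\<xi> i\<close> need not agree with \<open>f (\<xi> i)\<close>. All other coordinates are constant on each of
  these \<open>m\<close> fibres, so among \<open>m + 1\<close> points that differ pairwise on \<open>m + 1\<close> further
  coordinates one lies over another point.\<close>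

lemma has_M_independent_seq_of_coordinates:
  fixes \<xi> :: "nat \<Rightarrow> 'i" and M :: "'m::metric_space set"
  assumes inj: "inj_on r I"
    and f: "\<And>\<xi> x. \<xi> \<in> I \<Longrightarrow> x \<in> topspace L \<Longrightarrow> x \<noteq> r \<xi> \<Longrightarrow> f \<xi> x \<in> M"
    and K: "\<And>z. z \<in> K \<Longrightarrow> fst z \<in> topspace L"
      "\<And>z \<eta>. z \<in> K \<Longrightarrow> \<eta> \<in> I \<Longrightarrow> fst z \<noteq> r \<eta> \<Longrightarrow> snd z \<eta> = f \<eta> (fst z)"
    and \<xi>: "inj \<xi>" "range \<xi> \<subseteq> I"
    and C: "closedin (top_of_set M) C" "closedin (top_of_set M) C'" "C \<inter> C' = {}"
    and "M \<noteq> {}"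
    and indep: "\<And>m \<epsilon>. \<exists>z\<in>K. \<forall>i<m. snd z (\<xi> i) \<in> (if \<epsilon> i then C' else C)"
  shows "has_M_independent_seq L M I r f"
proof -
  have \<xi>I: "\<xi> i \<in> I" for i using \<xi>(2) by auto
  obtain m0 where m0: "m0 \<in> M" using \<open>M \<noteq> {}\<close> by blast
  \<comment> \<open>The value \<open>m0\<close> over \<open>r (\<xi> n)\<close> is arbitrary: the
    points realizing a pattern will avoid these fibres.\<close>
  define g where "g n x = (if x = r (\<xi> n) then m0 else f (\<xi> n) x)" for n x
  have gC: "\<exists>x\<in>topspace L. \<forall>i<m. g i x \<in> (if \<epsilon> i then C' else C)" for m and \<epsilon> :: "nat \<Rightarrow> bool"
  proof -
    \<comment> \<open>The pattern \<open>\<epsilon>\<close> occupies the first \<open>m\<close>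
      positions; the next \<open>m + 1\<close> tag \<open>z e\<close>, for \<open>e \<le> m\<close>,
      by \<open>C'\<close> at position \<open>m + e\<close> and \<open>C\<close> at the
      others.\<close>
    have "\<forall>e. \<exists>z. z \<in> K \<and> (\<forall>i<2 * m + 1. snd z (\<xi> i) \<in> (if (if i < m then \<epsilon> i else i = m + e) then C' else C))"
    proof
      fix e
      show "\<exists>z. z \<in> K \<and> (\<forall>i<2 * m + 1. snd z (\<xi> i) \<in> (if (if i < m then \<epsilon> i else i = m + e) then C' else C))"
        using indep[of "2 * m + 1" "\<lambda>i. if i < m then \<epsilon> i else i = m + e"] by blast
    qed
    from choice[OF this] obtain z where z: "\<forall>e. z e \<in> K \<and>
      (\<forall>i<2 * m + 1. snd (z e) (\<xi> i) \<in> (if (if i < m then \<epsilon> i else i = m + e) then C' else C))" ..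
    have "\<exists>e\<le>m. \<forall>i<m. fst (z e) \<noteq> r (\<xi> i)"
    proof (rule ccontr)
      assume "\<not> ?thesis"
      then have "\<forall>e. \<exists>i. e \<le> m \<longrightarrow> i < m \<and> fst (z e) = r (\<xi> i)" by blast
      from choice[OF this] obtain j where j: "\<forall>e. e \<le> m \<longrightarrow> j e < m \<and> fst (z e) = r (\<xi> (j e))" ..
      have "card (j ` {..m}) \<le> card {..<m}" using j by (intro card_mono) auto
      then have "\<not> inj_on j {..m}" by (intro pigeonhole) simp
      then obtain e e' where e: "e \<le> m" "e' \<le> m" "e \<noteq> e'" "j e = j e'"
        unfolding inj_on_def by blast
      let ?\<eta> = "\<xi> (m + e)"
      have "j e < m" using j e(1) by blast
      then have "m + e \<noteq> j e" by simp
      then have "\<xi> (j e) \<noteq> ?\<eta>" using injD[OF \<xi>(1)] by metis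
      then have ne: "r (\<xi> (j e)) \<noteq> r ?\<eta>" using inj_onD[OF inj] \<xi>I by metis
      have "snd (z e) ?\<eta> = f ?\<eta> (r (\<xi> (j e)))"
        using K(2)[of "z e" ?\<eta>] z j e ne \<xi>I by simp
      moreover have "snd (z e') ?\<eta> = f ?\<eta> (r (\<xi> (j e)))"
        using K(2)[of "z e'" ?\<eta>] z j e ne \<xi>I by simp
      moreover have "m + e < 2 * m + 1" using e by simp
      then have "snd (z e) ?\<eta> \<in> C'" "snd (z e') ?\<eta> \<in> C"
        using z[rule_format, THEN conjunct2, rule_format, of "m + e" e]
          z[rule_format, THEN conjunct2, rule_format, of "m + e" e'] e by simp_all
      ultimately show False using C(3) by auto
    qed
    then obtain e where e: "\<forall>i<m. fst (z e) \<noteq> r (\<xi> i)" by blast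
    have "g i (fst (z e)) \<in> (if \<epsilon> i then C' else C)" if "i < m" for i
    proof -
      have "snd (z e) (\<xi> i) = f (\<xi> i) (fst (z e))" using K(2) z e that \<xi>I by blast
      then show ?thesis using z[rule_format, THEN conjunct2, rule_format, of i e] e that
        by (simp add: g_def)
    qed
    then show ?thesis using K(1) z by blast
  qed
  have "M_independent M (topspace L) g"
    unfolding M_independent_def independent_pairs_def
  proof (rule exI[of _ C], rule exI[of _ C'], intro conjI allI C)
    show "fst ({x \<in> topspace L. g n x \<in> C}, {x \<in> topspace L. g n x \<in> C'})
        \<inter> snd ({x \<in> topspace L. g n x \<in> C}, {x \<in> topspace L. g n x \<in> C'}) = {}" for n
      using C(3) by auto
    fix m and \<epsilon> :: "nat \<Rightarrow> bool"
    obtain x where "x \<in> topspace L" "\<forall>i<m. g i x \<in> (if \<epsilon> i then C' else C)" using gC by blast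
    then have "x \<in> (\<Inter>i<m. if \<epsilon> i then snd ({x \<in> topspace L. g i x \<in> C}, {x \<in> topspace L. g i x \<in> C'})
        else fst ({x \<in> topspace L. g i x \<in> C}, {x \<in> topspace L. g i x \<in> C'}))"
      by (auto split: if_splits)
    then show "(\<Inter>i<m. if \<epsilon> i then snd ({x \<in> topspace L. g i x \<in> C}, {x \<in> topspace L. g i x \<in> C'})
        else fst ({x \<in> topspace L. g i x \<in> C}, {x \<in> topspace L. g i x \<in> C'})) \<noteq> {}" by blast
  qed
  moreover have "\<forall>n. \<forall>x\<in>topspace L. g n x \<in> M" using f m0 \<xi>I by (simp add: g_def)
  moreover have "\<forall>n. \<forall>x\<in>topspace L - {r (\<xi> n)}. g n x = f (\<xi> n) x" by (simp add: g_def)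
  ultimately show ?thesis
    unfolding has_M_independent_seq_def using \<xi> by (intro exI[of _ \<xi>] exI[of _ g] conjI)
qed

text \<open>By compactness of \<open>M\<close> the centres \<open>d i\<close> may be taken within
  \<open>e\<close> of one point \<open>c\<close>. The distance to \<open>c\<close> then serves all
  coordinates, with the thresholds moved inwards by \<open>e\<close>, a quarter of their
  gap.\<close>

lemma has_M_independent_seq_of_distances:
  fixes \<xi> :: "nat \<Rightarrow> 'i" and M :: "'m::metric_space set"
  assumes M: "compact M" and inj: "inj_on r I"
    and f: "\<And>\<xi> x. \<xi> \<in> I \<Longrightarrow> x \<in> topspace L \<Longrightarrow> x \<noteq> r \<xi> \<Longrightarrow> f \<xi> x \<in> M"
    and K: "\<And>z. z \<in> K \<Longrightarrow> fst z \<in> topspace L"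
      "\<And>z \<eta>. z \<in> K \<Longrightarrow> \<eta> \<in> I \<Longrightarrow> fst z \<noteq> r \<eta> \<Longrightarrow> snd z \<eta> = f \<eta> (fst z)"
      "\<And>z \<eta>. z \<in> K \<Longrightarrow> \<eta> \<in> I \<Longrightarrow> snd z \<eta> \<in> M"
    and \<xi>: "range \<xi> \<subseteq> I" and d: "\<And>i. d i \<in> M"
    and indep: "indep_seq K (\<lambda>i z. min 1 (dist (snd z (\<xi> i)) (d i))) p q"
  shows "has_M_independent_seq L M I r f"
proof -
  have pq: "p < q" using indep by (simp add: indep_seq_def)
  define e where "e = (q - p) / 4"
  have e: "0 < e" using pq by (simp add: e_def)
  obtain c n where c: "c \<in> M" "strict_mono n" "(d \<circ> n) \<longlonglongrightarrow> c"
    using M d unfolding compact_eq_seq_compact_metric seq_compact_def by blast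
  obtain N where N: "\<And>i. N \<le> i \<Longrightarrow> dist (d (n i)) c < e"
    using metric_LIMSEQ_D[OF c(3) e] by auto
  define k where "k i = n (N + i)" for i
  have k: "strict_mono k" using c(2) by (auto simp: strict_mono_def k_def)
  have dk: "dist (d (k i)) c < e" for i using N by (simp add: k_def)
  have sub: "indep_seq K (\<lambda>i z. min 1 (dist (snd z (\<xi> (k i))) (d (k i)))) p q"
    by (rule indep_seq_subseq[OF indep k])
  have near: "\<bar>min 1 (dist y (d (k i))) - min 1 (dist y c)\<bar> < e" for y i
  proof -
    have "\<bar>dist y (d (k i)) - dist y c\<bar> \<le> dist (d (k i)) c"
      using dist_triangle[of y "d (k i)" c] dist_triangle[of y c "d (k i)"]
      by (simp add: dist_commute abs_le_iff)
    moreover have "\<bar>min 1 a - min 1 b\<bar> \<le> \<bar>a - b\<bar>" for a b :: real by (simp add: min_def)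
    ultimately show ?thesis using dk[of i] by (meson le_less_trans)
  qed
  define C where "C = {y \<in> M. min 1 (dist y c) \<le> p + e}"
  define C' where "C' = {y \<in> M. q - e \<le> min 1 (dist y c)}"
  have pe: "p + e < q - e" using pq by (simp add: e_def field_simps)
  show ?thesis
  proof (rule has_M_independent_seq_of_coordinates[OF inj f K(1,2)])
    show "closedin (top_of_set M) C"
    proof -
      have "C = M \<inter> {y. min 1 (dist y c) \<le> p + e}" by (auto simp: C_def)
      then show ?thesis
        by (simp only:) (intro closedin_closed_Int closed_Collect_le continuous_intros)
    qed
    show "closedin (top_of_set M) C'"
    proof -
      have "C' = M \<inter> {y. q - e \<le> min 1 (dist y c)}" by (auto simp: C'_def)
      then show ?thesis
        by (simp only:) (intro closedin_closed_Int closed_Collect_le continuous_intros)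
    qed
    show "C \<inter> C' = {}" using pe by (auto simp: C_def C'_def)
    show "M \<noteq> {}" using c(1) by blast
    show "range (\<lambda>i. \<xi> (k i)) \<subseteq> I" using \<xi> by auto
    \<comment> \<open>Equal coordinates would make two of the functions differ by less than
      \<open>2 * e\<close>, while independence yields a point where they differ by at least
      \<open>q - p = 4 * e\<close>.\<close>
    show "inj (\<lambda>i. \<xi> (k i))"
    proof (rule injI, rule ccontr)
      fix i j assume ij: "\<xi> (k i) = \<xi> (k j)" "i \<noteq> j"
      obtain z where "z \<in> K" and z: "\<forall>l<Suc (max i j). if l = i then q \<le> min 1 (dist (snd z (\<xi> (k l))) (d (k l)))
          else min 1 (dist (snd z (\<xi> (k l))) (d (k l))) \<le> p"
        using indep_seqD[OF sub, of "Suc (max i j)" "\<lambda>l. l = i"] by (elim bexE)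
      from z[rule_format, of i] z[rule_format, of j]
      have "q \<le> min 1 (dist (snd z (\<xi> (k i))) (d (k i)))" "min 1 (dist (snd z (\<xi> (k i))) (d (k j))) \<le> p"
        using ij by (simp_all add: less_Suc_eq_le)
      moreover have "q - p < 2 * e" if "q \<le> a" "b \<le> p" "\<bar>a - y\<bar> < e" "\<bar>b - y\<bar> < e" for a b y
        using that by linarith
      ultimately have "q - p < 2 * e" using near by blast
      then show False using pq by (simp add: e_def)
    qed
    fix m and \<epsilon> :: "nat \<Rightarrow> bool"
    obtain z where z: "z \<in> K" "\<forall>i<m. if \<epsilon> i then q \<le> min 1 (dist (snd z (\<xi> (k i))) (d (k i)))
          else min 1 (dist (snd z (\<xi> (k i))) (d (k i))) \<le> p"
      using indep_seqD[OF sub, of m \<epsilon>] by (elim bexE)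
    have "snd z (\<xi> (k i)) \<in> (if \<epsilon> i then C' else C)" if "i < m" for i
    proof -
      have "snd z (\<xi> (k i)) \<in> M" using K(3)[OF z(1), of "\<xi> (k i)"] \<xi> by auto
      then show ?thesis
        using z(2)[rule_format, OF that] near[of "snd z (\<xi> (k i))" i]
        unfolding C_def C'_def by (auto split: if_splits)
    qed
    then show "\<exists>z\<in>K. \<forall>i<m. snd z (\<xi> (k i)) \<in> (if \<epsilon> i then C' else C)" using z(1) by blast
  qed
qed

theorem theorem7p5:
  fixes L :: "'l topology" and M :: "'m::metric_space set" and I :: "'i set"
    and r :: "'i \<Rightarrow> 'l" and f :: "'i \<Rightarrow> 'l \<Rightarrow> 'm" and X :: "'x::real_normed_vector set"
  assumes "compact M"
    and "compact_space L" and "Hausdorff_space L"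
    and "inj_on r I" and "r ` I \<subseteq> topspace L"
    and "\<forall>\<xi>\<in>I. continuous_map (subtopology L (topspace L - {r \<xi>})) (top_of_set M) (f \<xi>)"
    and "\<not> has_M_independent_seq L M I r f"
    and "weakly_RN_via L X"
  shows "\<exists>V :: ((nat + ('l \<times> ('i \<Rightarrow> 'm)) set) discrete \<Rightarrow>\<^sub>C real) set.
           weakly_RN_via (split_space L M I r f) V"
proof -
  let ?T = "split_space L M I r f"
  let ?K = "split_points L M I r f"
  note T = split_space_compact[OF assms(1-6)]
  have f: "f \<xi> x \<in> M" if "\<xi> \<in> I" "x \<in> topspace L" "x \<noteq> r \<xi>" for \<xi> x
    using assms(6) that by (force simp: continuous_map_def)
  have K_eq: "?K = {z \<in> topspace L \<times> (\<Pi>\<^sub>E \<eta>\<in>I. M). \<forall>\<eta>\<in>I. fst z = r \<eta> \<or> snd z \<eta> = f \<eta> (fst z)}"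
    by (rule split_points_eq[OF assms(4,5)]) (use f in auto)
  have K: "fst z \<in> topspace L" "snd z \<in> (\<Pi>\<^sub>E \<eta>\<in>I. M)"
    "\<And>\<eta>. \<eta> \<in> I \<Longrightarrow> fst z \<noteq> r \<eta> \<Longrightarrow> snd z \<eta> = f \<eta> (fst z)" if "z \<in> ?K" for z
    using that unfolding K_eq by auto
  obtain S where X: "banach_subspace X" "\<not> contains_l1 X" and S: "compactin (weak_star X) S"
    and hom: "L homeomorphic_space subtopology (weak_star X) S"
    using assms(8) unfolding weakly_RN_via_def by blast
  have subX: "subspace X" using X(1) by (simp add: banach_subspace_def)
  obtain \<theta> where \<theta>: "homeomorphic_map L (subtopology (weak_star X) S) \<theta>"
    using hom homeomorphic_space by blast
  have top: "topspace (subtopology (weak_star X) S) = S"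
    using compactin_subset_topspace[OF S] by auto
  have \<theta>S: "\<theta> l \<in> S" if "l \<in> topspace L" for l
    using homeomorphic_imp_surjective_map[OF \<theta>] that top by auto
  have \<theta>D: "\<theta> l \<in> dual_space X" if "l \<in> topspace L" for l
    using \<theta>S[OF that] compactin_subset_topspace[OF S] by (auto simp: weak_star_def)
  have \<theta>_add: "\<theta> l (x + y) = \<theta> l x + \<theta> l y" if "l \<in> topspace L" "x \<in> X" "y \<in> X" for l x y
    using \<theta>D[OF that(1)] that(2,3) by (simp add: dual_space_def)
  have \<theta>_scale: "\<theta> l (c *\<^sub>R x) = c * \<theta> l x" if "l \<in> topspace L" "x \<in> X" for l c x
    using \<theta>D[OF that(1)] that(2) by (simp add: dual_space_def)
  obtain B where B: "0 < B" "\<forall>s\<in>S. \<forall>x\<in>X. \<bar>s x\<bar> \<le> B * norm x"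
    using weak_star_compact_bounded[OF X(1) S] by blast
  define s where "s z x = \<theta> (fst z) x / B" for z :: "'l \<times> ('i \<Rightarrow> 'm)" and x
  have s_le: "\<bar>s z x\<bar> \<le> norm x" if "z \<in> ?K" "x \<in> X" for z x
    using B \<theta>S[OF K(1)[OF that(1)]] that(2) by (simp add: s_def pos_divide_le_eq mult.commute)
  define F1 where "F1 = (\<lambda>x z. s z x) ` {x \<in> X. norm x \<le> 1}"
  \<comment> \<open>Truncation at 1 gives the common bound. Letting the centre run through
    \<open>M\<close> separates the values of a coordinate: the distance to
    \<open>snd z \<xi>\<close> vanishes at \<open>z\<close> only where the coordinates
    agree.\<close>
  define F2 where "F2 = (\<lambda>(\<xi>, d) (z :: 'l \<times> ('i \<Rightarrow> 'm)). min 1 (dist (snd z \<xi>) d)) ` (I \<times> M)"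
  show ?thesis
  proof (rule weakly_RN_criterion[where F="F1 \<union> F2", OF T(1,2)])
    fix h assume h: "h \<in> F1 \<union> F2"
    show "continuous_map ?T euclideanreal h"
    proof (cases "h \<in> F1")
      case True
      then obtain x where x: "x \<in> X" "h = (\<lambda>z. s z x)" by (auto simp: F1_def)
      have "continuous_map (weak_star X) euclideanreal (\<lambda>y. y x)"
        unfolding weak_star_def using x(1)
        by (intro continuous_map_from_subtopology continuous_map_product_projection)
      then have "continuous_map (subtopology (weak_star X) S) euclideanreal (\<lambda>y. y x)"
        by (rule continuous_map_from_subtopology)
      then have "continuous_map L euclideanreal ((\<lambda>y. y x) \<circ> \<theta>)"
        using homeomorphic_imp_continuous_map[OF \<theta>] by (rule continuous_map_compose[rotated])
      moreover have "continuous_map ?T L fst"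
        unfolding split_space_def by (intro continuous_map_from_subtopology continuous_map_fst)
      ultimately have "continuous_map ?T euclideanreal (((\<lambda>y. y x) \<circ> \<theta>) \<circ> fst)"
        by (rule continuous_map_compose[rotated])
      then have "continuous_map ?T euclideanreal (\<lambda>z. \<theta> (fst z) x)" by (simp add: o_def)
      then show ?thesis unfolding x(2) s_def
        using continuous_map_real_mult_left[of ?T "\<lambda>z. \<theta> (fst z) x" "inverse B"]
        by (simp add: divide_inverse mult.commute)
    next
      case False
      then obtain \<xi> d where \<xi>: "\<xi> \<in> I" "h = (\<lambda>z. min 1 (dist (snd z \<xi>) d))" using h by (auto simp: F2_def)
      have "continuous_map (prod_topology L (product_topology (\<lambda>_. top_of_set M) I)) (top_of_set M) ((\<lambda>y. y \<xi>) \<circ> snd)"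
        using \<xi>(1) by (intro continuous_map_compose[OF continuous_map_snd] continuous_map_product_projection)
      then have "continuous_map ?T (top_of_set M) ((\<lambda>y. y \<xi>) \<circ> snd)"
        unfolding split_space_def by (rule continuous_map_from_subtopology)
      moreover have "continuous_map (top_of_set M) euclideanreal (\<lambda>y. min 1 (dist y d))"
        by (simp add: continuous_intros)
      ultimately have "continuous_map ?T euclideanreal ((\<lambda>y. min 1 (dist y d)) \<circ> ((\<lambda>y. y \<xi>) \<circ> snd))"
        by (rule continuous_map_compose)
      then show ?thesis unfolding \<xi>(2) by (simp add: o_def)
    qed
    fix z assume "z \<in> topspace ?T"
    then have z: "z \<in> ?K" by (simp only: T(3))
    show "\<bar>h z\<bar> \<le> 1"
      using h s_le[OF z] by (force simp: F1_def F2_def)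
  next
    fix z z' assume "z \<in> topspace ?T" "z' \<in> topspace ?T" and ne: "z \<noteq> z'"
    then have z: "z \<in> ?K" "z' \<in> ?K" by (simp_all only: T(3))
    show "\<exists>h\<in>F1 \<union> F2. h z \<noteq> h z'"
    proof (cases "fst z = fst z'")
      case False
      then have "\<theta> (fst z) \<noteq> \<theta> (fst z')"
        using homeomorphic_imp_injective_map[OF \<theta>] K(1)[OF z(1)] K(1)[OF z(2)] by (auto dest: inj_onD)
      then obtain x where x: "\<theta> (fst z) x \<noteq> \<theta> (fst z') x" by blast
      have ext: "\<theta> (fst z) \<in> extensional X" "\<theta> (fst z') \<in> extensional X"
        using \<theta>D[OF K(1)[OF z(1)]] \<theta>D[OF K(1)[OF z(2)]] by (auto simp: dual_space_def)
      \<comment> \<open>Both functionals are extensional, so they can differ only inside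
        \<open>X\<close>.\<close>
      have xX: "x \<in> X" using x ext by (metis extensional_arb)
      define y where "y = (1 / (norm x + 1)) *\<^sub>R x"
      have "0 < norm x + 1" by (simp add: add_nonneg_pos)
      then have "y \<in> X" "norm y \<le> 1" using xX subspace_scale[OF subX] by (auto simp: y_def field_simps)
      moreover have "s z y \<noteq> s z' y"
        using x B(1) \<open>0 < norm x + 1\<close> \<theta>_scale[OF K(1)[OF z(1)] xX] \<theta>_scale[OF K(1)[OF z(2)] xX]
        by (simp add: s_def y_def)
      ultimately show ?thesis
        by (intro bexI[of _ "\<lambda>w. s w y"]) (simp_all add: F1_def)
    next
      case True
      then have "snd z \<noteq> snd z'" using ne by (simp add: prod_eq_iff)
      then obtain \<xi> where "snd z \<xi> \<noteq> snd z' \<xi>" by blast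
      moreover from this have "\<xi> \<in> I" using PiE_arb[OF K(2)[OF z(1)], of \<xi>] PiE_arb[OF K(2)[OF z(2)], of \<xi>] by metis
      moreover have "snd z \<xi> \<in> M" using K(2)[OF z(1)] \<open>\<xi> \<in> I\<close> by auto
      ultimately have "(\<lambda>w. min 1 (dist (snd w \<xi>) (snd z \<xi>))) \<in> F1 \<union> F2"
        unfolding F2_def by (intro UnI2 rev_image_eqI[of "(\<xi>, snd z \<xi>)"]) auto
      then show ?thesis
        by (rule bexI[rotated]) (use \<open>snd z \<xi> \<noteq> snd z' \<xi>\<close> in \<open>simp add: min_def\<close>)
    qed
  next
    show "\<not> (\<exists>h p q. (\<forall>i. h i \<in> F1 \<union> F2) \<and> indep_seq (topspace ?T) h p q)"
    proof
      assume "\<exists>h p q. (\<forall>i. h i \<in> F1 \<union> F2) \<and> indep_seq (topspace ?T) h p q"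
      then obtain h p q where h: "\<forall>i. h i \<in> F1 \<union> F2" and "indep_seq (topspace ?T) h p q" by blast
      then have ind: "indep_seq ?K h p q" by (simp only: T(3))
      \<comment> \<open>Independence passes to subsequences, so one of the two families contains an
        independent sequence by itself.\<close>
      have "infinite {i. h i \<in> F1} \<or> infinite {i. h i \<in> F2}"
      proof (rule ccontr)
        assume "\<not> ?thesis"
        then have "finite ({i. h i \<in> F1} \<union> {i. h i \<in> F2})" by simp
        moreover have "{i. h i \<in> F1} \<union> {i. h i \<in> F2} = UNIV" using h by auto
        ultimately show False by simp
      qed
      then show False
      proof
        assume "infinite {i. h i \<in> F1}"
        from infinite_enumerate[OF this] obtain n :: "nat \<Rightarrow> nat" where
          n: "strict_mono n" and hn: "\<forall>i. h (n i) \<in> F1" by auto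
        from hn have "\<forall>i. \<exists>x. x \<in> X \<and> norm x \<le> 1 \<and> h (n i) = (\<lambda>z. s z x)" by (auto simp: F1_def)
        from choice[OF this] obtain x where x: "\<forall>i. x i \<in> X \<and> norm (x i) \<le> 1 \<and> h (n i) = (\<lambda>z. s z (x i))" ..
        have "indep_seq ?K (\<lambda>i. h (n i)) p q" by (rule indep_seq_subseq[OF ind n])
        then have "indep_seq ?K (\<lambda>i z. s z (x i)) p q" using x by simp
        then have "contains_l1 X"
          by (intro contains_l1_of_indep_seq[where s=s and K="?K" and x=x, OF subX])
            (use x s_le K(1) \<theta>_add \<theta>_scale in \<open>auto simp: s_def add_divide_distrib\<close>)
        then show False using X(2) by blast
      next
        assume "infinite {i. h i \<in> F2}"
        from infinite_enumerate[OF this] obtain n :: "nat \<Rightarrow> nat" where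
          n: "strict_mono n" and hn: "\<forall>i. h (n i) \<in> F2" by auto
        from hn have "\<forall>i. \<exists>e. fst e \<in> I \<and> snd e \<in> M \<and> h (n i) = (\<lambda>z. min 1 (dist (snd z (fst e)) (snd e)))"
          by (fastforce simp: F2_def)
        from choice[OF this] obtain e where e: "\<forall>i. fst (e i) \<in> I \<and> snd (e i) \<in> M \<and>
          h (n i) = (\<lambda>z. min 1 (dist (snd z (fst (e i))) (snd (e i))))" ..
        have "indep_seq ?K (\<lambda>i. h (n i)) p q" by (rule indep_seq_subseq[OF ind n])
        then have "indep_seq ?K (\<lambda>i z. min 1 (dist (snd z (fst (e i))) (snd (e i)))) p q" using e by simp
        then have "has_M_independent_seq L M I r f"
          by (rule has_M_independent_seq_of_distances[OF assms(1,4) f K(1,3), rotated -1])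
            (use e K(2) in auto)
        then show False using assms(7) by blast
      qed
    qed
  qed
qed

end
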